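(* Let $\alpha>0$, $B_1>1$, $C_1>1$ and $C_2,\beta>0$. Assume that: (i) $1\le N_j\le C_1$ for each $j$; (ii) $N(n)\ge C_1^{-1}n$ for each $n\ge 1$, where $N(n)=\frac12\sum_{j\le n}N_j(N_j-1)$; (iii) $B_1^{-1}(1+|t|)^{-\alpha}\le |f_U^{\mathrm{Ft}}(t)|\le B_1(1+|t|)^{-\alpha}$ for all real $t$; (iv) $\alpha>\frac12$; (v) $\sup|K^{\mathrm{Ft}}|<\infty$ and, for some $c>0$, $K^{\mathrm{Ft}}(t)=0$ for all $|t|>c$; (vi) $h_1(n)\le h\le h_2(n)$, where $0<h_1(n)\le h_2(n)$, $h_2(n)\to0$ as $n\to\infty$ and, for some $\delta>0$, $n^{(1-\delta)/(4\alpha)}h_1(n)$ is bounded away from zero; (vii) $c_1n^{-c_2}\le\rho\le c_3\min\{h_1(n)^{4\alpha+2},n^{-1}\}$, where $c_1,c_2,c_3>0$ are constants. Then, for each integer $k\ge1$, $$\sup_{f_X\in\mathcal F(\beta,C_2)}\ \sup_{-\infty<x<\infty}E\{\hat f_X(x)-\tilde f_X(x)\}^2\le \mathrm{const.}\,p_n,$$ where $$p_n=p_n(k)=n^{-1}\{h^{\beta-2\alpha-1}+h^{2(\beta-2\alpha)-1}+(\log n)^2\}+n^{-2}\bigl(h^{2(\beta-4\alpha)-2}+h^{-6\alpha-1}\bigr)+n^{-k}h^{-4(k+2)\alpha-2},$$ and the constant depends on $k$ but not on $h\in[h_1(n),h_2(n)]$ or on $n$.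
   Context: Model. One observes $W_{jk}=X_j+U_{jk}$ for $1\le k\le N_j$, $1\le j\le n$, where the $X_j$ are identically distributed as $X$ (density $f_X$), the $U_{jk}$ are identically distributed as $U$ (density $f_U$), and all the $X_j$'s and $U_{jk}$'s are totally independent. The $N_j$ are deterministic positive integers. For a function $f$, $f^{\mathrm{Ft}}(t)=\int e^{itx}f(x)\,dx$. It is assumed throughout that $f_U^{\mathrm{Ft}}$ is real-valued and does not vanish at any point of the real line. Notation. $M=\sum_{j\le n}N_j$, $N=N(n)=\frac12\sum_{j\le n}N_j(N_j-1)$, and $\mathcal S_j$ is the set of pairs $(k_1,k_2)$ with $1\le k_1<k_2\le N_j$ (empty if $N_j=1$). The estimator of $f_U^{\mathrm{Ft}}$ is $$\hat f_U^{\mathrm{Ft}}(t)=\Bigl|\frac1N\sum_{j=1}^n\sum_{(k_1,k_2)\in\mathcal S_j}\cos\{t(W_{jk_1}-W_{jk_2})\}\Bigr|^{1/2}.$$ $K$ is a symmetric kernel function (real-valued, integrable, $\int K=1$) with compactly supported Fourier transform $K^{\mathrm{Ft}}$, $h>0$ is a bandwidth, and $\rho\ge0$ is a ridge parameter ($h$ and $\rho$ may depend on $n$). Define $$\hat L(u)=\frac1{2\pi}\int e^{-itu}\frac{K^{\mathrm{Ft}}(t)}{\hat f_U^{\mathrm{Ft}}(t/h)+\rho}\,dt,\qquad L(u)=\frac1{2\pi}\int e^{-itu}\frac{K^{\mathrm{Ft}}(t)}{f_U^{\mathrm{Ft}}(t/h)}\,dt,$$ $$\hat f_X(x)=\frac1{Mh}\sum_{j=1}^n\sum_{k=1}^{N_j}\hat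 L\Bigl(\frac{x-W_{jk}}h\Bigr),\qquad \tilde f_X(x)=\frac1{Mh}\sum_{j=1}^n\sum_{k=1}^{N_j}L\Bigl(\frac{x-W_{jk}}h\Bigr).$$ For $\beta,B>0$, $\mathcal F(\beta,B)$ is the class of probability densities $f_X$ with $\sup_{t\in\mathbb R}(1+|t|)^\beta|f_X^{\mathrm{Ft}}(t)|\le B$. The error density $f_U$ is fixed. *)

theory Defs
  imports "HOL-Probability.Probability"
begin

text \<open>
  \<open>f\<^sup>F\<^sup>t(t) = \<integral> e\<^sup>i\<^sup>t\<^sup>x f(x) dx\<close>.  The library function \<^const>\<open>char\<close> is not used here because
  the kernel may take negative values and so is not the density of a measure.
\<close>

definition fourier :: "(real \<Rightarrow> real) \<Rightarrow> real \<Rightarrow> complex" where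
  "fourier f t = (CLINT x|lborel. iexp (t * x) * complex_of_real (f x))"

definition prob_density :: "(real \<Rightarrow> real) \<Rightarrow> bool" where
  "prob_density f \<longleftrightarrow> (\<forall>x. 0 \<le> f x) \<and> integrable lborel f \<and> (LINT x|lborel. f x) = 1"

definition density_class :: "real \<Rightarrow> real \<Rightarrow> (real \<Rightarrow> real) set" where
  "density_class \<beta> B =
     {f. prob_density f \<and> (\<forall>t. (1 + \<bar>t\<bar>) powr \<beta> * cmod (fourier f t) \<le> B)}"

definition symmetric_kernel :: "(real \<Rightarrow> real) \<Rightarrow> bool" where
  "symmetric_kernel K \<longleftrightarrow>
     integrable lborel K \<and> (LINT x|lborel. K x) = 1 \<and> (\<forall>x. K (- x) = K x)"

text \<open>
  In the following, \<open>N j\<close> is the number of replicates for individual \<open>j\<close>, with indices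
  starting at 1, and \<open>w j k\<close> stands for the observed value of \<open>W\<^sub>j\<^sub>k\<close>.
\<close>

definition replicated_sample ::
  "'a measure \<Rightarrow> nat \<Rightarrow> (nat \<Rightarrow> nat) \<Rightarrow> (real \<Rightarrow> real) \<Rightarrow> (real \<Rightarrow> real)
     \<Rightarrow> (nat \<Rightarrow> 'a \<Rightarrow> real) \<Rightarrow> (nat \<Rightarrow> nat \<Rightarrow> 'a \<Rightarrow> real) \<Rightarrow> bool" where
  "replicated_sample P n N f\<^sub>X f\<^sub>U X U \<longleftrightarrow>
     prob_space P \<and>
     (\<forall>j\<in>{1..n}. distributed P lborel (X j) (\<lambda>x. ennreal (f\<^sub>X x))) \<and>
     (\<forall>j\<in>{1..n}. \<forall>k\<in>{1..N j}. distributed P lborel (U j k) (\<lambda>x. ennreal (f\<^sub>U x))) \<and>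
     prob_space.indep_vars P (\<lambda>_. borel) (case_sum X (\<lambda>(j, k). U j k))
       ({1..n} <+> (SIGMA j:{1..n}. {1..N j}))"

definition total_obs :: "nat \<Rightarrow> (nat \<Rightarrow> nat) \<Rightarrow> real" where
  "total_obs n N = (\<Sum>j=1..n. real (N j))"

definition num_pairs :: "nat \<Rightarrow> (nat \<Rightarrow> nat) \<Rightarrow> real" where
  "num_pairs n N = (1 / 2) * (\<Sum>j=1..n. real (N j) * (real (N j) - 1))"

definition pair_set :: "nat \<Rightarrow> (nat \<times> nat) set" where
  "pair_set m = {(k\<^sub>1, k\<^sub>2). 1 \<le> k\<^sub>1 \<and> k\<^sub>1 < k\<^sub>2 \<and> k\<^sub>2 \<le> m}"

definition fU_hat :: "nat \<Rightarrow> (nat \<Rightarrow> nat) \<Rightarrow> (nat \<Rightarrow> nat \<Rightarrow> real) \<Rightarrow> real \<Rightarrow> real" where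
  "fU_hat n N w t =
     sqrt \<bar>(1 / num_pairs n N) *
        (\<Sum>j=1..n. \<Sum>(k\<^sub>1, k\<^sub>2)\<in>pair_set (N j). cos (t * (w j k\<^sub>1 - w j k\<^sub>2)))\<bar>"

text \<open>
  The real part only adjusts the type: whenever \<open>g(-s)\<close> is the complex conjugate of \<open>g(s)\<close>,
  as is the case for both choices of \<open>g\<close> below, the integral is real (see
  \<open>deconv_integral_real\<close>).
\<close>

definition deconv_kernel :: "(real \<Rightarrow> real) \<Rightarrow> real \<Rightarrow> (real \<Rightarrow> complex) \<Rightarrow> real \<Rightarrow> real" where
  "deconv_kernel K h g u =
     Re (complex_of_real (1 / (2 * pi)) *
         (CLINT t|lborel. iexp (- (t * u)) * (fourier K t / g (t / h))))"

definition L_hat ::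
  "(real \<Rightarrow> real) \<Rightarrow> real \<Rightarrow> real \<Rightarrow> nat \<Rightarrow> (nat \<Rightarrow> nat) \<Rightarrow> (nat \<Rightarrow> nat \<Rightarrow> real) \<Rightarrow> real \<Rightarrow> real" where
  "L_hat K h \<rho> n N w = deconv_kernel K h (\<lambda>s. complex_of_real (fU_hat n N w s + \<rho>))"

definition L_true :: "(real \<Rightarrow> real) \<Rightarrow> real \<Rightarrow> (real \<Rightarrow> real) \<Rightarrow> real \<Rightarrow> real" where
  "L_true K h f\<^sub>U = deconv_kernel K h (fourier f\<^sub>U)"

definition kernel_estimator ::
  "(real \<Rightarrow> real) \<Rightarrow> real \<Rightarrow> nat \<Rightarrow> (nat \<Rightarrow> nat) \<Rightarrow> (nat \<Rightarrow> nat \<Rightarrow> real) \<Rightarrow> real \<Rightarrow> real" where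
  "kernel_estimator l h n N w x =
     1 / (total_obs n N * h) * (\<Sum>j=1..n. \<Sum>k=1..N j. l ((x - w j k) / h))"

definition fX_hat ::
  "(real \<Rightarrow> real) \<Rightarrow> real \<Rightarrow> real \<Rightarrow> nat \<Rightarrow> (nat \<Rightarrow> nat) \<Rightarrow> (nat \<Rightarrow> nat \<Rightarrow> real) \<Rightarrow> real \<Rightarrow> real" where
  "fX_hat K h \<rho> n N w = kernel_estimator (L_hat K h \<rho> n N w) h n N w"

definition fX_tilde ::
  "(real \<Rightarrow> real) \<Rightarrow> real \<Rightarrow> (real \<Rightarrow> real) \<Rightarrow> nat \<Rightarrow> (nat \<Rightarrow> nat) \<Rightarrow> (nat \<Rightarrow> nat \<Rightarrow> real) \<Rightarrow> real \<Rightarrow> real" where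
  "fX_tilde K h f\<^sub>U n N w = kernel_estimator (L_true K h f\<^sub>U) h n N w"

definition p_rate :: "real \<Rightarrow> real \<Rightarrow> nat \<Rightarrow> nat \<Rightarrow> real \<Rightarrow> real" where
  "p_rate \<alpha> \<beta> k n h =
     1 / real n * (h powr (\<beta> - 2 * \<alpha> - 1) + h powr (2 * (\<beta> - 2 * \<alpha>) - 1) + (ln (real n))\<^sup>2)
     + 1 / (real n)\<^sup>2 * (h powr (2 * (\<beta> - 4 * \<alpha>) - 2) + h powr (- 6 * \<alpha> - 1))
     + 1 / (real n) ^ k * h powr (- 4 * (real k + 2) * \<alpha> - 2)"

lemma fourier_uminus: "fourier f (- t) = cnj (fourier f t)"
proof -
  have "fourier f (- t) = (CLINT x|lborel. cnj (iexp (t * x) * complex_of_real (f x)))"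
    unfolding fourier_def
    by (rule Bochner_Integration.integral_cong) (simp_all add: exp_cnj)
  then show ?thesis
    by (simp only: fourier_def Bochner_Integration.integral_cnj)
qed

lemma fU_hat_uminus: "fU_hat n N w (- t) = fU_hat n N w t"
  by (simp add: fU_hat_def)

lemma deconv_integral_real:
  assumes "\<And>s. g (- s) = cnj (g s)"
  shows "(CLINT t|lborel. iexp (- (t * u)) * (fourier K t / g (t / h))) \<in> \<real>"
proof -
  let ?q = "\<lambda>t. iexp (- (t * u)) * (fourier K t / g (t / h))"
  have "cnj (?q t) = ?q (- t)" for t
    using assms[of "t / h"] by (simp add: fourier_uminus exp_cnj)
  then have "cnj (CLINT t|lborel. ?q t) = (CLINT t|lborel. ?q (- t))"
    by (subst Bochner_Integration.integral_cnj[symmetric]) presburger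
  also have "\<dots> = (CLINT t|lborel. ?q t)"
    using lborel_integral_real_affine[of "-1" ?q 0] by simp
  finally show ?thesis
    by (simp add: complex_is_Real_iff complex_eq_iff)
qed

end

theory Submission
  imports Defs
begin

text \<open>
  Write \<open>\<phi>\<close> for the Fourier transform of \<open>f\<^sub>U\<close>, \<open>D\<close> for the deviation of the empirical version of
  \<open>\<phi>\<^sup>2\<close> from \<open>\<phi>\<^sup>2\<close>, and \<open>R = 1 / (\<phi>_hat + \<rho>) - 1 / \<phi>\<close>. Since \<open>D\<close> and \<open>R\<close> depend on the errors
  \<open>U\<^sub>j\<^sub>k\<close> only, the difference of the two estimators is, given the errors, a sum of independent
  functions of the \<open>X\<^sub>j\<close>, and its second moment splits into a squared conditional mean and a
  conditional variance.

  In the conditional mean the linear part \<open>- D / (2 \<phi>\<^sup>3)\<close> of \<open>R\<close> gives a sum of independent terms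
  whose variance is a quadratic form with kernel \<open>\<phi>(s + t)\<^sup>2 + \<phi>(s - t)\<^sup>2\<close>; this kernel is
  integrable because \<open>\<alpha> > 1/2\<close>, so Schur's test applies. The remainder of \<open>R\<close> is of second order
  in \<open>D\<close> and is bounded absolutely. The conditional variance is a quadratic form whose kernel is the
  Fourier transform of the distribution of \<open>X + U\<close>, up to a fluctuation of order \<open>n\<^sup>-\<^sup>1\<^sup>/\<^sup>2\<close>. If
  \<open>\<beta> > \<alpha>\<close>, this Fourier transform is integrable and Schur's test applies again; if \<open>\<beta> \<le> \<alpha>\<close>, the
  crude absolute bound is already dominated by the term \<open>n\<^sup>-\<^sup>2 h\<^sup>2\<^sup>(\<^sup>\<beta>\<^sup>-\<^sup>4\<^sup>\<alpha>\<^sup>)\<^sup>-\<^sup>2\<close> of the rate.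

  The rare event that \<open>D\<close> is comparable with \<open>\<phi>\<^sup>2\<close> costs a negative power of the ridge, which is
  compensated by a high moment of \<open>n\<^sup>1\<^sup>/\<^sup>2 D\<close>. No expansion of \<open>R\<close> beyond the
  second order is needed, so the bound holds without the last term of the rate.
\<close>

section \<open>Integral inequalities\<close>

text \<open>Powers of 1+|t| explain the exponents. With noise level n^(-1/2) and
  1/\<open>\<phi>\<close> of order (1+|t|)^\<alpha>, \<open>R\<close> has size n^(-1/2)
  (1+|t|)^(3\<alpha>), and n^(-1) (1+|t|)^(5\<alpha>) once its linear part is removed. The decay of
  the transforms of \<open>fX\<close> and \<open>fU\<close> turns this into the exponents
  2\<alpha>-\<beta> for the linear part and 4\<alpha>-\<beta> for the remainder, integrated over |t|
  \<le> c/h. Each such truncated moment is a power of h, a logarithm or a constant. The obstacle is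
  that \<open>R\<close> is not uniformly small: where the empirical square is near 0, only 1/\<rho>
  bounds it. On the cutoff range the relative error (1+|t|)^(2\<alpha>) n^(-1/2) is
  O(n^(-\<delta>/2)), so a power \<open>q\<close> with q\<delta>/2 \<ge> c_2+1 pays for 1/\<rho>
  \<le> n^(c_2)/c_1 and still leaves 1/n. The randomness of \<open>R\<close> is thereby pushed into
  the factor \<open>1 + (\<bar>D\<bar> * sqrt n) ^ q\<close>, whose moments are bounded in terms of
  C_1 and \<open>q\<close> alone. Second moments are written as nonnegative extended-real integrals,
  so that exchanging integrals asks for measurability only and infinite bounds are harmless.\<close>

lemma ennreal_mult_le_power2_sum: "x * y \<le> x\<^sup>2 + y\<^sup>2" for x y :: ennreal
proof (cases "x \<le> y")
  case True
  then have "x * y \<le> y * y" by (rule mult_right_mono) simp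
  then show ?thesis by (simp add: power2_eq_square add_increasing)
next
  case False
  then have "x * y \<le> x * x" by (intro mult_left_mono) auto
  then show ?thesis by (simp add: power2_eq_square add_increasing2)
qed

lemma nn_integral_square_eq:
  fixes f :: "'b \<Rightarrow> ennreal"
  assumes [measurable]: "f \<in> borel_measurable L"
  shows "(\<integral>\<^sup>+t. f t \<partial>L)\<^sup>2 = (\<integral>\<^sup>+s. \<integral>\<^sup>+t. f s * f t \<partial>L \<partial>L)"
  by (simp add: nn_integral_cmult nn_integral_multc power2_eq_square)

text \<open>Tonelli moves the integral over \<open>M\<close> innermost, where the bound
  \<open>C\<close>, uniform in \<open>s\<close> and \<open>t\<close>, applies; the integral of the
  weights then factors.\<close>

lemma nn_integral_double_form_le:
  fixes a :: "'b \<Rightarrow> ennreal" and F :: "'b \<Rightarrow> 'b \<Rightarrow> 'a \<Rightarrow> ennreal"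
  assumes "sigma_finite_measure M" "sigma_finite_measure L"
  assumes [measurable]: "a \<in> borel_measurable L"
    "(\<lambda>z. F (fst (fst z)) (snd (fst z)) (snd z)) \<in> borel_measurable ((L \<Otimes>\<^sub>M L) \<Otimes>\<^sub>M M)"
  assumes F: "\<And>s t. s \<in> space L \<Longrightarrow> t \<in> space L \<Longrightarrow> (\<integral>\<^sup>+\<omega>. F s t \<omega> \<partial>M) \<le> C"
  shows "(\<integral>\<^sup>+\<omega>. (\<integral>\<^sup>+s. \<integral>\<^sup>+t. a s * a t * F s t \<omega> \<partial>L \<partial>L) \<partial>M) \<le> C * (\<integral>\<^sup>+t. a t \<partial>L)\<^sup>2"
proof -
  interpret M: sigma_finite_measure M by fact
  interpret L: sigma_finite_measure L by fact
  interpret LxM: pair_sigma_finite L M ..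
  \<comment> \<open>Composition with arbitrary measurable maps, so that each exchange below finds
    the three variables in the order it needs.\<close>
  have meas[measurable]: "(\<lambda>x. F (f x) (g x) (k x)) \<in> borel_measurable K"
    if [measurable]: "f \<in> measurable K L" "g \<in> measurable K L" "k \<in> measurable K M" for f g k and K :: "'d measure"
  proof -
    have "(\<lambda>x. (\<lambda>z. F (fst (fst z)) (snd (fst z)) (snd z)) ((f x, g x), k x)) \<in> borel_measurable K"
      by measurable
    then show ?thesis by simp
  qed
  have "(\<integral>\<^sup>+\<omega>. (\<integral>\<^sup>+s. \<integral>\<^sup>+t. a s * a t * F s t \<omega> \<partial>L \<partial>L) \<partial>M)
      = (\<integral>\<^sup>+s. (\<integral>\<^sup>+\<omega>. (\<integral>\<^sup>+t. a s * a t * F s t \<omega> \<partial>L) \<partial>M) \<partial>L)"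
    by (rule LxM.Fubini') measurable
  also have "\<dots> = (\<integral>\<^sup>+s. \<integral>\<^sup>+t. (\<integral>\<^sup>+\<omega>. a s * a t * F s t \<omega> \<partial>M) \<partial>L \<partial>L)"
    by (intro nn_integral_cong LxM.Fubini') measurable
  also have "\<dots> = (\<integral>\<^sup>+s. \<integral>\<^sup>+t. a s * a t * (\<integral>\<^sup>+\<omega>. F s t \<omega> \<partial>M) \<partial>L \<partial>L)"
    by (intro nn_integral_cong nn_integral_cmult) measurable
  also have "\<dots> \<le> (\<integral>\<^sup>+s. \<integral>\<^sup>+t. a s * a t * C \<partial>L \<partial>L)"
    by (intro nn_integral_mono mult_left_mono F) auto
  also have "\<dots> = C * (\<integral>\<^sup>+t. a t \<partial>L)\<^sup>2"
    by (simp add: nn_integral_cmult nn_integral_multc power2_eq_square mult_ac)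
  finally show ?thesis .
qed

text \<open>
  A form of Minkowski's integral inequality; weighting by \<open>a\<close> and using
  \<open>B s * B t \<le> (B s)\<^sup>2 + (B t)\<^sup>2\<close> avoids square roots.
\<close>

lemma nn_integral_power2_integral_le:
  fixes a :: "'b \<Rightarrow> ennreal" and B :: "'b \<Rightarrow> 'a \<Rightarrow> ennreal"
  assumes "sigma_finite_measure M" "sigma_finite_measure L"
  assumes [measurable]: "a \<in> borel_measurable L"
    "(\<lambda>(t, \<omega>). B t \<omega>) \<in> borel_measurable (L \<Otimes>\<^sub>M M)"
  assumes B: "\<And>t. t \<in> space L \<Longrightarrow> (\<integral>\<^sup>+\<omega>. (B t \<omega>)\<^sup>2 \<partial>M) \<le> C"
  shows "(\<integral>\<^sup>+\<omega>. (\<integral>\<^sup>+t. a t * B t \<omega> \<partial>L)\<^sup>2 \<partial>M) \<le> 2 * C * (\<integral>\<^sup>+t. a t \<partial>L)\<^sup>2"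
proof -
  have "(\<integral>\<^sup>+\<omega>. (\<integral>\<^sup>+t. a t * B t \<omega> \<partial>L)\<^sup>2 \<partial>M)
      = (\<integral>\<^sup>+\<omega>. (\<integral>\<^sup>+s. \<integral>\<^sup>+t. a s * B s \<omega> * (a t * B t \<omega>) \<partial>L \<partial>L) \<partial>M)"
    by (intro nn_integral_cong nn_integral_square_eq) measurable
  also have "\<dots> = (\<integral>\<^sup>+\<omega>. (\<integral>\<^sup>+s. \<integral>\<^sup>+t. a s * a t * (B s \<omega> * B t \<omega>) \<partial>L \<partial>L) \<partial>M)"
    by (simp only: mult_ac)
  also have "\<dots> \<le> 2 * C * (\<integral>\<^sup>+t. a t \<partial>L)\<^sup>2"
  proof (rule nn_integral_double_form_le)
    fix s t assume st: "s \<in> space L" "t \<in> space L"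
    have "(\<integral>\<^sup>+\<omega>. B s \<omega> * B t \<omega> \<partial>M) \<le> (\<integral>\<^sup>+\<omega>. (B s \<omega>)\<^sup>2 + (B t \<omega>)\<^sup>2 \<partial>M)"
      by (intro nn_integral_mono ennreal_mult_le_power2_sum)
    also have "\<dots> = (\<integral>\<^sup>+\<omega>. (B s \<omega>)\<^sup>2 \<partial>M) + (\<integral>\<^sup>+\<omega>. (B t \<omega>)\<^sup>2 \<partial>M)"
      using st by (intro nn_integral_add) measurable
    also have "\<dots> \<le> C + C"
      using st by (intro add_mono B)
    finally show "(\<integral>\<^sup>+\<omega>. B s \<omega> * B t \<omega> \<partial>M) \<le> 2 * C" by (simp only: mult_2)
  qed (use assms in measurable)
  finally show ?thesis .
qed

lemma nn_integral_lborel_reflect: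
  fixes f :: "real \<Rightarrow> ennreal"
  assumes [measurable]: "f \<in> borel_measurable borel"
  shows "(\<integral>\<^sup>+t. f (s - t) \<partial>lborel) = (\<integral>\<^sup>+t. f t \<partial>lborel)"
  using nn_integral_real_affine[of f "-1" s] by simp

lemma nn_integral_lborel_shift:
  fixes f :: "real \<Rightarrow> ennreal"
  assumes [measurable]: "f \<in> borel_measurable borel"
  shows "(\<integral>\<^sup>+t. f (s + t) \<partial>lborel) = (\<integral>\<^sup>+t. f t \<partial>lborel)"
  using nn_integral_real_affine[of f 1 s] by simp

text \<open>Schur's test: the kernel is symmetric because \<open>c\<close> is even, and each of its
  rows integrates to twice the integral of \<open>c\<close>. The crude
  \<open>x * y \<le> x\<^sup>2 + y\<^sup>2\<close> doubles the constant to 4.\<close>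

lemma nn_integral_convolution_form_le:
  fixes A c :: "real \<Rightarrow> ennreal"
  assumes [measurable]: "A \<in> borel_measurable borel" "c \<in> borel_measurable borel"
  assumes even: "\<And>t. c (- t) = c t"
  shows "(\<integral>\<^sup>+s. \<integral>\<^sup>+t. A s * A t * (c (s + t) + c (s - t)) \<partial>lborel \<partial>lborel)
    \<le> 4 * (\<integral>\<^sup>+t. (A t)\<^sup>2 \<partial>lborel) * (\<integral>\<^sup>+t. c t \<partial>lborel)"
proof -
  interpret lborel_pair: pair_sigma_finite lborel "lborel :: real measure" ..
  let ?I = "\<integral>\<^sup>+t. c t \<partial>lborel" and ?J = "\<integral>\<^sup>+t. (A t)\<^sup>2 \<partial>lborel"
  let ?k = "\<lambda>s t. c (s + t) + c (s - t)"
  have k: "(\<integral>\<^sup>+t. ?k s t \<partial>lborel) = 2 * ?I" for s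
    by (subst nn_integral_add) (auto simp: nn_integral_lborel_shift nn_integral_lborel_reflect mult_2)
  have sym: "?k s t = ?k t s" for s t
    using even[of "s - t"] by (simp add: add.commute)
  have "(\<integral>\<^sup>+s. \<integral>\<^sup>+t. A s * A t * ?k s t \<partial>lborel \<partial>lborel)
      \<le> (\<integral>\<^sup>+s. \<integral>\<^sup>+t. (A s)\<^sup>2 * ?k s t + (A t)\<^sup>2 * ?k s t \<partial>lborel \<partial>lborel)"
    unfolding distrib_right[symmetric]
    by (intro nn_integral_mono mult_right_mono ennreal_mult_le_power2_sum) auto
  also have "\<dots> = (\<integral>\<^sup>+s. \<integral>\<^sup>+t. (A s)\<^sup>2 * ?k s t \<partial>lborel \<partial>lborel)
      + (\<integral>\<^sup>+s. \<integral>\<^sup>+t. (A t)\<^sup>2 * ?k s t \<partial>lborel \<partial>lborel)"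
    by (simp add: nn_integral_add)
  also have "(\<integral>\<^sup>+s. \<integral>\<^sup>+t. (A t)\<^sup>2 * ?k s t \<partial>lborel \<partial>lborel)
      = (\<integral>\<^sup>+t. \<integral>\<^sup>+s. (A t)\<^sup>2 * ?k s t \<partial>lborel \<partial>lborel)"
    by (rule lborel_pair.Fubini') measurable
  also have "\<dots> = (\<integral>\<^sup>+s. \<integral>\<^sup>+t. (A s)\<^sup>2 * ?k s t \<partial>lborel \<partial>lborel)"
    by (simp only: sym)
  also have "(\<integral>\<^sup>+s. \<integral>\<^sup>+t. (A s)\<^sup>2 * ?k s t \<partial>lborel \<partial>lborel) = ?J * (2 * ?I)"
    by (simp add: nn_integral_cmult k nn_integral_multc)
  finally show ?thesis
    by (simp add: mult_ac flip: mult_2)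
qed

section \<open>Sums of independent bounded random variables\<close>

text \<open>Conditioning on \<open>Y\<close> without conditional expectations: the joint law is a
  product, so \<open>X\<close> may be evaluated at a fresh sample point while \<open>Y\<close> stays
  frozen at the outer one.\<close>

lemma (in prob_space) indep_var_nn_integral:
  assumes ind: "indep_var S X T Y" and F: "F \<in> borel_measurable (S \<Otimes>\<^sub>M T)"
  shows "(\<integral>\<^sup>+\<omega>. F (X \<omega>, Y \<omega>) \<partial>M) = (\<integral>\<^sup>+\<omega>'. \<integral>\<^sup>+\<omega>. F (X \<omega>, Y \<omega>') \<partial>M \<partial>M)"
proof -
  note [measurable] = F
  have X[measurable]: "X \<in> measurable M S" and Y[measurable]: "Y \<in> measurable M T"
    and eq: "distr M S X \<Otimes>\<^sub>M distr M T Y = distr M (S \<Otimes>\<^sub>M T) (\<lambda>x. (X x, Y x))"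
    using ind unfolding indep_var_distribution_eq by auto
  interpret X: prob_space "distr M S X" by (rule prob_space_distr) fact
  interpret Y: prob_space "distr M T Y" by (rule prob_space_distr) fact
  interpret XY: pair_sigma_finite "distr M S X" "distr M T Y" ..
  have "(\<integral>\<^sup>+\<omega>. F (X \<omega>, Y \<omega>) \<partial>M) = (\<integral>\<^sup>+z. F z \<partial>(distr M S X \<Otimes>\<^sub>M distr M T Y))"
    unfolding eq by (subst nn_integral_distr) auto
  also have "\<dots> = (\<integral>\<^sup>+y. \<integral>\<^sup>+x. F (x, y) \<partial>distr M S X \<partial>distr M T Y)"
    by (rule XY.nn_integral_snd[symmetric]) simp
  also have "\<dots> = (\<integral>\<^sup>+\<omega>'. \<integral>\<^sup>+x. F (x, Y \<omega>') \<partial>distr M S X \<partial>M)"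
    by (subst nn_integral_distr) auto
  also have "\<dots> = (\<integral>\<^sup>+\<omega>'. \<integral>\<^sup>+\<omega>. F (X \<omega>, Y \<omega>') \<partial>M \<partial>M)"
    by (intro nn_integral_cong, subst nn_integral_distr) auto
  finally show ?thesis .
qed

lemma (in prob_space) integrable_bounded:
  fixes Y :: "'a \<Rightarrow> 'b :: {banach, second_countable_topology}"
  assumes "Y \<in> borel_measurable M" "\<And>\<omega>. \<omega> \<in> space M \<Longrightarrow> norm (Y \<omega>) \<le> B"
  shows "integrable M Y"
  using assms by (intro integrable_const_bound[where B = B]) auto

text \<open>The variance of the sum is the sum of the variances, each at most a second moment. The
  summands are left uncentred because their means will make up the conditional mean of the risk. The
  bound \<open>B\<close> supplies integrability and does not enter the estimate.\<close>

lemma (in prob_space) expectation_square_indep_sum_le: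
  fixes Y :: "'i \<Rightarrow> 'a \<Rightarrow> real"
  assumes "finite J" "indep_vars (\<lambda>_. borel) Y J"
    and bounded: "\<And>j \<omega>. j \<in> J \<Longrightarrow> \<omega> \<in> space M \<Longrightarrow> \<bar>Y j \<omega>\<bar> \<le> B"
  shows "expectation (\<lambda>\<omega>. (\<Sum>j\<in>J. Y j \<omega>)\<^sup>2)
    \<le> (\<Sum>j\<in>J. expectation (Y j))\<^sup>2 + (\<Sum>j\<in>J. expectation (\<lambda>\<omega>. (Y j \<omega>)\<^sup>2))"
  using assms
proof (induction J rule: finite_induct)
  case (insert i J)
  have rv: "Y j \<in> borel_measurable M" if "j \<in> insert i J" for j
    using insert.prems(1) that by (auto simp: indep_vars_def)
  note [measurable] = rv
  have int1: "integrable M (Y j)" if "j \<in> insert i J" for j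
    using that insert.prems(2)[of j] by (intro integrable_bounded[where B = B]) auto
  have int2: "integrable M (\<lambda>\<omega>. Y j \<omega> * Y l \<omega>)" if "j \<in> insert i J" "l \<in> insert i J" for j l
  proof (intro integrable_bounded[where B = "B * B"])
    fix \<omega> assume \<omega>: "\<omega> \<in> space M"
    have "\<bar>Y j \<omega>\<bar> * \<bar>Y l \<omega>\<bar> \<le> B * B"
      using insert.prems(2)[OF _ \<omega>] that by (intro mult_mono') auto
    then show "norm (Y j \<omega> * Y l \<omega>) \<le> B * B" by (simp add: abs_mult)
  qed (use that in measurable)
  let ?S = "\<lambda>\<omega>. \<Sum>j\<in>J. Y j \<omega>"
  have ind: "indep_var borel (Y i) borel ?S"
    by (rule indep_vars_sum) (use insert in auto)
  have intS: "integrable M ?S" by (intro Bochner_Integration.integrable_sum int1) auto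
  have intS2: "integrable M (\<lambda>\<omega>. (?S \<omega>)\<^sup>2)"
    unfolding power2_eq_square sum_product by (intro Bochner_Integration.integrable_sum int2) auto
  have intiS: "integrable M (\<lambda>\<omega>. Y i \<omega> * ?S \<omega>)"
    unfolding sum_distrib_left by (intro Bochner_Integration.integrable_sum int2) auto
  have int_i2: "integrable M (\<lambda>\<omega>. (Y i \<omega>)\<^sup>2)"
    unfolding power2_eq_square using int2 by auto
  have "expectation (\<lambda>\<omega>. (\<Sum>j\<in>insert i J. Y j \<omega>)\<^sup>2)
      = expectation (\<lambda>\<omega>. (Y i \<omega>)\<^sup>2 + (?S \<omega>)\<^sup>2 + 2 * (Y i \<omega> * ?S \<omega>))"
    using insert.hyps by (simp add: power2_eq_square algebra_simps)
  also have "\<dots> = expectation (\<lambda>\<omega>. (Y i \<omega>)\<^sup>2) + expectation (\<lambda>\<omega>. (?S \<omega>)\<^sup>2)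
      + 2 * (expectation (Y i) * expectation ?S)"
    using intS2 intiS int_i2 indep_var_lebesgue_integral[OF ind int1 intS] by simp
  also have "expectation ?S = (\<Sum>j\<in>J. expectation (Y j))"
    by (intro Bochner_Integration.integral_sum int1) auto
  also have "expectation (\<lambda>\<omega>. (?S \<omega>)\<^sup>2) \<le> (\<Sum>j\<in>J. expectation (Y j))\<^sup>2
      + (\<Sum>j\<in>J. expectation (\<lambda>\<omega>. (Y j \<omega>)\<^sup>2))"
    using insert.prems by (intro insert.IH) (auto intro: indep_vars_subset)
  \<comment> \<open>The only loss in the induction step is the squared mean of
    \<open>Y i\<close>.\<close>
  also have "expectation (\<lambda>\<omega>. (Y i \<omega>)\<^sup>2) + ((\<Sum>j\<in>J. expectation (Y j))\<^sup>2
      + (\<Sum>j\<in>J. expectation (\<lambda>\<omega>. (Y j \<omega>)\<^sup>2)))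
      + 2 * (expectation (Y i) * (\<Sum>j\<in>J. expectation (Y j)))
      \<le> (\<Sum>j\<in>insert i J. expectation (Y j))\<^sup>2
      + (\<Sum>j\<in>insert i J. expectation (\<lambda>\<omega>. (Y j \<omega>)\<^sup>2))"
    using insert.hyps by (simp add: power2_sum mult.assoc)
  finally show ?case by simp
qed auto

text \<open>The proof compares \<open>x ^ (2 * p)\<close> with the exponential moments of Hoeffding's lemma.\<close>

lemma (in prob_space) even_moment_indep_sum_le:
  fixes Y :: "'i \<Rightarrow> 'a \<Rightarrow> real"
  assumes "finite J" and ind: "indep_vars (\<lambda>_. borel) Y J"
    and bounded: "\<And>j \<omega>. j \<in> J \<Longrightarrow> \<omega> \<in> space M \<Longrightarrow> \<bar>Y j \<omega>\<bar> \<le> B"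
    and mean: "\<And>j. j \<in> J \<Longrightarrow> expectation (Y j) = 0"
    and m: "card J \<le> m" "m > 0"
  shows "(\<integral>\<^sup>+\<omega>. ennreal (((\<Sum>j\<in>J. Y j \<omega>) / sqrt m) ^ (2 * p)) \<partial>M)
    \<le> ennreal (2 * fact (2 * p) * exp (B\<^sup>2 / 2))"
proof -
  have rv[measurable]: "Y j \<in> borel_measurable M" if "j \<in> J" for j
    using ind that by (auto simp: indep_vars_def)
  have sqrtm: "sqrt m > 0" using m by simp
  let ?S = "\<lambda>\<omega>. (\<Sum>j\<in>J. Y j \<omega>) / sqrt m"
  have exp_bound: "(\<integral>\<^sup>+\<omega>. ennreal (exp (s * ?S \<omega>)) \<partial>M) \<le> ennreal (exp (B\<^sup>2 / 2))"
    if s: "s = 1 \<or> s = - 1" for s :: real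
  proof -
    \<comment> \<open>A range of length \<open>2 * B\<close>, scaled by \<open>1 / sqrt m\<close>,
      gives the exponent \<open>B\<^sup>2 / 2\<close> divided by \<open>m\<close>; at most
      \<open>m\<close> such factors multiply to \<open>exp (B\<^sup>2 / 2)\<close>.\<close>
    have single: "(\<integral>\<^sup>+\<omega>. ennreal (exp (1 / sqrt m * (s * Y j \<omega>))) \<partial>M)
        \<le> ennreal (exp ((1 / sqrt m)\<^sup>2 * (B - (- B))\<^sup>2 / 8))" if j: "j \<in> J" for j
    proof -
      interpret Yj: interval_bounded_random_variable M "\<lambda>\<omega>. s * Y j \<omega>" "- B" B
      proof
        show "random_variable borel (\<lambda>\<omega>. s * Y j \<omega>)" using j by measurable
        show "AE \<omega> in M. s * Y j \<omega> \<in> {- B..B}"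
          using bounded[OF j] s by (intro AE_I2) (force simp: abs_le_iff)
      qed
      show ?thesis
        using mean[OF j] sqrtm
        by (intro Yj.Hoeffdings_lemma_nn_integral_0) auto
    qed
    have "(\<integral>\<^sup>+\<omega>. ennreal (exp (s * ?S \<omega>)) \<partial>M)
        = (\<integral>\<^sup>+\<omega>. (\<Prod>j\<in>J. ennreal (exp (1 / sqrt m * (s * Y j \<omega>)))) \<partial>M)"
    proof (intro nn_integral_cong)
      fix \<omega>
      have "s * ?S \<omega> = (\<Sum>j\<in>J. 1 / sqrt m * (s * Y j \<omega>))"
        by (simp add: sum_distrib_left sum_divide_distrib)
      then show "ennreal (exp (s * ?S \<omega>)) = (\<Prod>j\<in>J. ennreal (exp (1 / sqrt m * (s * Y j \<omega>))))"
        using \<open>finite J\<close> by (simp only: exp_sum) (simp add: prod_ennreal)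
    qed
    also have "\<dots> = (\<Prod>j\<in>J. \<integral>\<^sup>+\<omega>. ennreal (exp (1 / sqrt m * (s * Y j \<omega>))) \<partial>M)"
      using \<open>finite J\<close> by (intro indep_vars_nn_integral indep_vars_compose2[OF ind]) auto
    also have "\<dots> \<le> (\<Prod>j\<in>J. ennreal (exp ((1 / sqrt m)\<^sup>2 * (B - (- B))\<^sup>2 / 8)))"
      by (intro prod_mono_ennreal single)
    also have "\<dots> = ennreal (exp (card J * ((1 / sqrt m)\<^sup>2 * (B - (- B))\<^sup>2 / 8)))"
      by (simp only: prod_constant ennreal_power exp_ge_zero exp_of_nat_mult)
    also have "\<dots> \<le> ennreal (exp (B\<^sup>2 / 2))"
    proof -
      have "card J * ((1 / sqrt m)\<^sup>2 * (B - (- B))\<^sup>2 / 8) = (card J / m) * (B\<^sup>2 / 2)"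
        using m by (simp add: power_divide power2_eq_square field_simps)
      also have "\<dots> \<le> 1 * (B\<^sup>2 / 2)"
        using m by (intro mult_right_mono) auto
      finally show ?thesis by (intro ennreal_leI) simp
    qed
    finally show ?thesis .
  qed
  \<comment> \<open>One term of the exponential series at \<open>\<bar>x\<bar>\<close>; both signs
    together dominate \<open>exp \<bar>x\<bar>\<close>, which is why \<open>exp_bound\<close> is
    stated for \<open>s = 1\<close> and \<open>s = - 1\<close>.\<close>
  have pow: "x ^ (2 * p) \<le> fact (2 * p) * (exp x + exp (- x))" for x :: real
  proof -
    have "\<bar>x\<bar> ^ (2 * p) / fact (2 * p) \<le> (\<Sum>i\<in>{..2 * p}. \<bar>x\<bar> ^ i / fact i)"
      by (rule member_le_sum) auto
    also have "\<dots> = (\<Sum>i\<in>{..2 * p}. \<bar>x\<bar> ^ i /\<^sub>R fact i)" by (simp add: divide_inverse mult.commute)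
    also have "\<dots> \<le> exp \<bar>x\<bar>"
      using summable_exp_generic[of "\<bar>x\<bar>"] by (simp add: exp_def sum_le_suminf)
    also have "\<dots> \<le> exp x + exp (- x)" by (simp add: abs_if)
    finally show ?thesis by (simp add: field_simps power_even_abs)
  qed
  let ?e = "\<lambda>\<omega>. exp (1 * ?S \<omega>)" and ?e' = "\<lambda>\<omega>. exp (- 1 * ?S \<omega>)"
  have "(\<integral>\<^sup>+\<omega>. ennreal (?S \<omega> ^ (2 * p)) \<partial>M)
      \<le> (\<integral>\<^sup>+\<omega>. ennreal (fact (2 * p)) * (ennreal (?e \<omega>) + ennreal (?e' \<omega>)) \<partial>M)"
  proof (intro nn_integral_mono)
    fix \<omega>
    have "ennreal (?S \<omega> ^ (2 * p)) \<le> ennreal (fact (2 * p) * (?e \<omega> + ?e' \<omega>))"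
      using pow[of "?S \<omega>"] by (intro ennreal_leI) simp
    also have "\<dots> = ennreal (fact (2 * p)) * (ennreal (?e \<omega>) + ennreal (?e' \<omega>))"
      by (simp only: ennreal_mult' ennreal_plus exp_ge_zero fact_ge_zero)
    finally show "ennreal (?S \<omega> ^ (2 * p))
      \<le> ennreal (fact (2 * p)) * (ennreal (?e \<omega>) + ennreal (?e' \<omega>))" .
  qed
  also have "\<dots> = ennreal (fact (2 * p)) * ((\<integral>\<^sup>+\<omega>. ennreal (?e \<omega>) \<partial>M)
      + (\<integral>\<^sup>+\<omega>. ennreal (?e' \<omega>) \<partial>M))"
    by (subst nn_integral_cmult, measurable) (subst nn_integral_add, auto)
  also have "\<dots> \<le> ennreal (fact (2 * p)) * (ennreal (exp (B\<^sup>2 / 2)) + ennreal (exp (B\<^sup>2 / 2)))"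
    by (intro mult_left_mono add_mono exp_bound) auto
  also have "\<dots> = ennreal (fact (2 * p) * (exp (B\<^sup>2 / 2) + exp (B\<^sup>2 / 2)))"
    by (simp only: ennreal_mult' ennreal_plus exp_ge_zero fact_ge_zero)
  finally show ?thesis by (simp only: mult_2[symmetric] mult.assoc mult.left_commute)
qed

text \<open>Fubini: the integrand is dominated by \<open>B * norm (a t)\<close>, which is integrable
  on the product with a probability space.\<close>

lemma (in prob_space) expectation_weighted_integral:
  fixes a :: "real \<Rightarrow> complex" and \<Phi> :: "real \<Rightarrow> 'a \<Rightarrow> complex"
  assumes a: "integrable lborel a"
    and [measurable]: "(\<lambda>(t, \<omega>). \<Phi> t \<omega>) \<in> borel_measurable (lborel \<Otimes>\<^sub>M M)"
    and bounded: "\<And>t \<omega>. \<omega> \<in> space M \<Longrightarrow> norm (\<Phi> t \<omega>) \<le> B"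
  shows "expectation (\<lambda>\<omega>. LINT t|lborel. a t * \<Phi> t \<omega>) = (LINT t|lborel. a t * expectation (\<Phi> t))"
proof -
  interpret LxM: pair_sigma_finite lborel M ..
  have B0: "0 \<le> B" using bounded not_empty norm_ge_zero order_trans by blast
  note [measurable] = borel_measurable_integrable[OF a]
  have \<Phi>t[measurable]: "\<Phi> t \<in> borel_measurable M" for t
    using measurable_Pair2[of "\<lambda>(t, \<omega>). \<Phi> t \<omega>" lborel M borel t] by simp
  have "integrable (lborel \<Otimes>\<^sub>M M) (\<lambda>(t, \<omega>). a t * \<Phi> t \<omega>)"
  proof (rule LxM.Fubini_integrable)
    show "integrable lborel (\<lambda>t. LINT \<omega>|M. norm (case (t, \<omega>) of (t, \<omega>) \<Rightarrow> a t * \<Phi> t \<omega>))"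
    proof (rule Bochner_Integration.integrable_bound[where f = "\<lambda>t. B * norm (a t)"])
      show "integrable lborel (\<lambda>t. B * norm (a t))" using a by simp
      show "AE t in lborel. norm (LINT \<omega>|M. norm (case (t, \<omega>) of (t, \<omega>) \<Rightarrow> a t * \<Phi> t \<omega>))
          \<le> norm (B * norm (a t))"
      proof (rule AE_I2)
        fix t
        have "(LINT \<omega>|M. norm (a t * \<Phi> t \<omega>)) \<le> (LINT \<omega>|M. norm (a t) * B)"
          using bounded
          by (intro integral_mono integrable_bounded[where B = "norm (a t) * B"])
             (auto simp: norm_mult B0 intro!: mult_left_mono)
        then have "(LINT \<omega>|M. norm (a t * \<Phi> t \<omega>)) \<le> B * norm (a t)"
          by (simp add: prob_space mult.commute)
        moreover have "0 \<le> (LINT \<omega>|M. norm (a t * \<Phi> t \<omega>))" by (rule Bochner_Integration.integral_nonneg) auto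
        ultimately show "norm (LINT \<omega>|M. norm (case (t, \<omega>) of (t, \<omega>) \<Rightarrow> a t * \<Phi> t \<omega>))
          \<le> norm (B * norm (a t))" by simp
      qed
    qed measurable
    show "AE t in lborel. integrable M (\<lambda>\<omega>. case (t, \<omega>) of (t, \<omega>) \<Rightarrow> a t * \<Phi> t \<omega>)"
    proof (rule AE_I2)
      fix t
      show "integrable M (\<lambda>\<omega>. case (t, \<omega>) of (t, \<omega>) \<Rightarrow> a t * \<Phi> t \<omega>)"
        using bounded by (intro integrable_bounded[where B = "norm (a t) * B"])
             (auto simp: norm_mult B0 intro!: mult_left_mono)
    qed
  qed measurable
  from LxM.Fubini_integral[OF this] show ?thesis by simp
qed

section \<open>Quadratic forms in Fourier transforms\<close>

lemma integrable_mult_bounded: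
  fixes a b :: "real \<Rightarrow> complex"
  assumes "integrable lborel a" "b \<in> borel_measurable borel" "\<And>t. norm (b t) \<le> B"
  shows "integrable lborel (\<lambda>t. a t * b t)"
proof (rule Bochner_Integration.integrable_bound[where f = "\<lambda>t. B * norm (a t)"])
  note [measurable] = borel_measurable_integrable[OF assms(1)] assms(2)
  show "(\<lambda>t. a t * b t) \<in> borel_measurable lborel" by measurable
  show "AE t in lborel. norm (a t * b t) \<le> norm (B * norm (a t))"
  proof (rule AE_I2)
    fix t
    have "norm (a t) * norm (b t) \<le> norm (a t) * \<bar>B\<bar>"
      using assms(3)[of t] by (intro mult_left_mono) auto
    then show "norm (a t * b t) \<le> norm (B * norm (a t))"
      by (simp add: norm_mult abs_mult mult.commute)
  qed
qed (use assms in auto)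

context prob_space
begin

text \<open>Expanding both factors under the expectation leaves the characteristic function of
  \<open>V i\<close> at \<open>s + \<sigma> * t\<close>. The triangle inequality is applied to the
  weights but not to the sum over \<open>i\<close>, so that cancellation among the characteristic
  functions survives inside the modulus.\<close>

lemma expectation_fourier_product_le:
  fixes a b :: "real \<Rightarrow> complex" and V :: "'i \<Rightarrow> 'a \<Rightarrow> real"
  assumes I: "finite I" and V[measurable]: "\<And>i. i \<in> I \<Longrightarrow> V i \<in> borel_measurable M"
    and a: "integrable lborel a" and b: "integrable lborel b"
  shows "ennreal (cmod (\<Sum>i\<in>I. expectation (\<lambda>\<omega>. (LINT s|lborel. a s * iexp (s * V i \<omega>)) *
        (LINT t|lborel. b t * iexp (\<sigma> * t * V i \<omega>)))))
    \<le> (\<integral>\<^sup>+t. \<integral>\<^sup>+s. ennreal (cmod (a s) * cmod (b t) *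
        cmod (\<Sum>i\<in>I. expectation (\<lambda>\<omega>. iexp ((s + \<sigma> * t) * V i \<omega>)))) \<partial>lborel \<partial>lborel)"
proof -
  note [measurable] = borel_measurable_integrable[OF a] borel_measurable_integrable[OF b]
  define A where "A v = (LINT s|lborel. a s * iexp (s * v))" for v
  define ch where "ch i t = expectation (\<lambda>\<omega>. iexp (t * V i \<omega>))" for i t
  have A_meas[measurable]: "A \<in> borel_measurable borel" unfolding A_def by measurable
  have ch_meas[measurable]: "ch i \<in> borel_measurable borel" if "i \<in> I" for i
    unfolding ch_def using that by measurable
  have ch_le: "norm (ch i t) \<le> 1" if "i \<in> I" for i t
  proof -
    have "norm (ch i t) \<le> expectation (\<lambda>\<omega>. norm (iexp (t * V i \<omega>)))"
      unfolding ch_def by (rule integral_norm_bound)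
    then show ?thesis by (simp add: prob_space)
  qed
  have A_le: "norm (A v) \<le> (LINT s|lborel. norm (a s))" for v
  proof -
    have "norm (A v) \<le> (LINT s|lborel. norm (a s * iexp (s * v)))"
      unfolding A_def by (rule integral_norm_bound)
    then show ?thesis by (simp add: norm_mult)
  qed
  \<comment> \<open>The half-expanded stage: the integral over \<open>t\<close> has been pulled out
    of the expectation, while the one over \<open>s\<close> still sits inside \<open>A\<close> as a
    bounded factor.\<close>
  define G where "G i t = expectation (\<lambda>\<omega>. iexp (\<sigma> * t * V i \<omega>) * A (V i \<omega>))" for i t
  have G_meas[measurable]: "G i \<in> borel_measurable borel" if "i \<in> I" for i
    unfolding G_def using that by measurable
  have G_le: "norm (G i t) \<le> (LINT s|lborel. norm (a s))" if i: "i \<in> I" for i t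
  proof -
    have "norm (G i t) \<le> expectation (\<lambda>\<omega>. norm (iexp (\<sigma> * t * V i \<omega>) * A (V i \<omega>)))"
      unfolding G_def by (rule integral_norm_bound)
    also have "\<dots> = expectation (\<lambda>\<omega>. norm (A (V i \<omega>)))" by (simp add: norm_mult)
    also have "\<dots> \<le> expectation (\<lambda>\<omega>. (LINT s|lborel. norm (a s)))"
      using i A_le by (intro integral_mono integrable_bounded[where B = "LINT s|lborel. norm (a s)"]) auto
    finally show ?thesis by (simp add: prob_space)
  qed
  have G_eq: "G i t = (LINT s|lborel. a s * ch i (s + \<sigma> * t))" if i: "i \<in> I" for i t
  proof -
    have "G i t = expectation (\<lambda>\<omega>. LINT s|lborel. a s * iexp ((s + \<sigma> * t) * V i \<omega>))"
      unfolding G_def A_def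
      by (subst integral_mult_right_zero[symmetric])
         (simp add: distrib_right distrib_left exp_add mult_ac)
    also have "\<dots> = (LINT s|lborel. a s * ch i (s + \<sigma> * t))"
      unfolding ch_def using i a by (intro expectation_weighted_integral[where B = 1]) auto
    finally show ?thesis .
  qed
  have prod_eq: "expectation (\<lambda>\<omega>. A (V i \<omega>) * (LINT t|lborel. b t * iexp (\<sigma> * t * V i \<omega>)))
      = (LINT t|lborel. b t * G i t)" if i: "i \<in> I" for i
  proof -
    have "expectation (\<lambda>\<omega>. A (V i \<omega>) * (LINT t|lborel. b t * iexp (\<sigma> * t * V i \<omega>)))
        = expectation (\<lambda>\<omega>. LINT t|lborel. b t * (iexp (\<sigma> * t * V i \<omega>) * A (V i \<omega>)))"
      by (subst integral_mult_right_zero[symmetric]) (simp add: mult_ac)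
    also have "\<dots> = (LINT t|lborel. b t * G i t)"
      unfolding G_def using i b A_le
      by (intro expectation_weighted_integral[where B = "LINT s|lborel. norm (a s)"])
         (auto simp: norm_mult)
    finally show ?thesis .
  qed
  have "(\<Sum>i\<in>I. expectation (\<lambda>\<omega>. A (V i \<omega>) * (LINT t|lborel. b t * iexp (\<sigma> * t * V i \<omega>))))
      = (\<Sum>i\<in>I. (LINT t|lborel. b t * G i t))"
    by (intro sum.cong refl prod_eq)
  also have "\<dots> = (LINT t|lborel. (\<Sum>i\<in>I. b t * G i t))"
    by (rule Bochner_Integration.integral_sum[symmetric])
       (rule integrable_mult_bounded[OF b G_meas G_le])
  also have "\<dots> = (LINT t|lborel. b t * (\<Sum>i\<in>I. G i t))"
    by (simp add: sum_distrib_left)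
  finally have "ennreal (cmod (\<Sum>i\<in>I. expectation (\<lambda>\<omega>. A (V i \<omega>) *
      (LINT t|lborel. b t * iexp (\<sigma> * t * V i \<omega>)))))
      = ennreal (cmod (LINT t|lborel. b t * (\<Sum>i\<in>I. G i t)))" by simp
  also have "\<dots> \<le> (\<integral>\<^sup>+t. ennreal (cmod (b t * (\<Sum>i\<in>I. G i t))) \<partial>lborel)"
  proof (rule integral_norm_bound_ennreal)
    have "integrable lborel (\<lambda>t. \<Sum>i\<in>I. b t * G i t)"
      by (rule Bochner_Integration.integrable_sum, rule integrable_mult_bounded[OF b G_meas G_le])
    then show "integrable lborel (\<lambda>t. b t * (\<Sum>i\<in>I. G i t))" by (simp add: sum_distrib_left)
  qed
  also have "\<dots> \<le> (\<integral>\<^sup>+t. ennreal (cmod (b t)) *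
      (\<integral>\<^sup>+s. ennreal (cmod (a s * (\<Sum>i\<in>I. ch i (s + \<sigma> * t)))) \<partial>lborel) \<partial>lborel)"
  proof (intro nn_integral_mono)
    fix t
    have int: "integrable lborel (\<lambda>s. a s * ch i (s + \<sigma> * t))" if "i \<in> I" for i
      using that a ch_le by (intro integrable_mult_bounded[where B = 1]) auto
    have "(\<Sum>i\<in>I. G i t) = (\<Sum>i\<in>I. (LINT s|lborel. a s * ch i (s + \<sigma> * t)))"
      by (intro sum.cong refl G_eq)
    also have "\<dots> = (LINT s|lborel. (\<Sum>i\<in>I. a s * ch i (s + \<sigma> * t)))"
      by (intro Bochner_Integration.integral_sum[symmetric] int)
    also have "\<dots> = (LINT s|lborel. a s * (\<Sum>i\<in>I. ch i (s + \<sigma> * t)))"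
      by (simp add: sum_distrib_left)
    finally have eq: "(\<Sum>i\<in>I. G i t) = \<dots>" .
    have "ennreal (cmod (\<Sum>i\<in>I. G i t))
        \<le> (\<integral>\<^sup>+s. ennreal (cmod (a s * (\<Sum>i\<in>I. ch i (s + \<sigma> * t)))) \<partial>lborel)"
      unfolding eq
    proof (rule integral_norm_bound_ennreal)
      have "integrable lborel (\<lambda>s. \<Sum>i\<in>I. a s * ch i (s + \<sigma> * t))"
        by (intro Bochner_Integration.integrable_sum int)
      then show "integrable lborel (\<lambda>s. a s * (\<Sum>i\<in>I. ch i (s + \<sigma> * t)))"
        by (simp add: sum_distrib_left)
    qed
    then show "ennreal (cmod (b t * (\<Sum>i\<in>I. G i t))) \<le> ennreal (cmod (b t)) *
      (\<integral>\<^sup>+s. ennreal (cmod (a s * (\<Sum>i\<in>I. ch i (s + \<sigma> * t)))) \<partial>lborel)"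
      by (simp add: norm_mult ennreal_mult mult_left_mono)
  qed
  also have "\<dots> = (\<integral>\<^sup>+t. \<integral>\<^sup>+s. ennreal (cmod (a s) * cmod (b t) *
      cmod (\<Sum>i\<in>I. ch i (s + \<sigma> * t))) \<partial>lborel \<partial>lborel)"
    by (intro nn_integral_cong, subst nn_integral_cmult[symmetric])
       (auto simp: norm_mult ennreal_mult mult_ac)
  finally show ?thesis by (simp add: A_def ch_def)
qed

lemma integral_Re_iexp:
  assumes a: "integrable lborel a"
  shows "(LINT t|lborel. Re (a t * iexp (t * v))) = Re (LINT t|lborel. a t * iexp (t * v))"
  by (rule integral_Re) (intro integrable_mult_bounded[where B = 1] a, auto)

text \<open>Twice the squared real part of \<open>z\<close> is the real part of
  \<open>z * z + z * cnj z\<close>. The first product adds frequencies; conjugation reverses a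
  frequency, so the second subtracts them. These are the cases \<open>\<sigma> = 1\<close> and
  \<open>\<sigma> = - 1\<close> of the preceding product bound.\<close>

lemma expectation_fourier_square_le:
  fixes a :: "real \<Rightarrow> complex" and V :: "'i \<Rightarrow> 'a \<Rightarrow> real"
  assumes I: "finite I" and V[measurable]: "\<And>i. i \<in> I \<Longrightarrow> V i \<in> borel_measurable M"
    and a: "integrable lborel a"
  shows "ennreal (\<Sum>i\<in>I. expectation (\<lambda>\<omega>. (LINT t|lborel. Re (a t * iexp (t * V i \<omega>)))\<^sup>2))
    \<le> (\<integral>\<^sup>+s. \<integral>\<^sup>+t. ennreal (cmod (a s) * cmod (a t) *
        (cmod (\<Sum>i\<in>I. expectation (\<lambda>\<omega>. iexp ((s + t) * V i \<omega>)))
         + cmod (\<Sum>i\<in>I. expectation (\<lambda>\<omega>. iexp ((s - t) * V i \<omega>))))) \<partial>lborel \<partial>lborel)"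
proof -
  interpret lborel_pair: pair_sigma_finite lborel "lborel :: real measure" ..
  note [measurable] = borel_measurable_integrable[OF a]
  define A where "A v = (LINT s|lborel. a s * iexp (s * v))" for v
  define ch where "ch t = (\<Sum>i\<in>I. expectation (\<lambda>\<omega>. iexp (t * V i \<omega>)))" for t
  have A_meas[measurable]: "A \<in> borel_measurable borel" unfolding A_def by measurable
  have ch_meas[measurable]: "ch \<in> borel_measurable borel" unfolding ch_def by measurable
  have [measurable]: "cnj \<in> borel_measurable borel"
    by (intro borel_measurable_continuous_onI continuous_intros)
  have A_le: "norm (A v) \<le> (LINT s|lborel. norm (a s))" for v
  proof -
    have "norm (A v) \<le> (LINT s|lborel. norm (a s * iexp (s * v)))"
      unfolding A_def by (rule integral_norm_bound)
    then show ?thesis by (simp add: norm_mult)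
  qed
  have AA: "norm (A v) * norm (A v) \<le> (LINT s|lborel. norm (a s))\<^sup>2" for v
    unfolding power2_eq_square using A_le by (intro mult_mono') auto
  have int1: "integrable M (\<lambda>\<omega>. A (V i \<omega>) * A (V i \<omega>))" if "i \<in> I" for i
    using that AA by (intro integrable_bounded[where B = "(LINT s|lborel. norm (a s))\<^sup>2"])
      (auto simp: norm_mult)
  have int2: "integrable M (\<lambda>\<omega>. A (V i \<omega>) * cnj (A (V i \<omega>)))" if "i \<in> I" for i
    using that AA by (intro integrable_bounded[where B = "(LINT s|lborel. norm (a s))\<^sup>2"])
      (auto simp: norm_mult)
  have cnjA: "cnj (A v) = (LINT t|lborel. cnj (a t) * iexp (- 1 * t * v))" for v
  proof -
    have "cnj (A v) = (LINT t|lborel. cnj (a t * iexp (t * v)))"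
      unfolding A_def by (rule Bochner_Integration.integral_cnj[symmetric])
    also have "\<dots> = (LINT t|lborel. cnj (a t) * iexp (- 1 * t * v))"
      by (rule Bochner_Integration.integral_cong) (simp_all add: exp_cnj)
    finally show ?thesis .
  qed
  let ?S1 = "\<Sum>i\<in>I. expectation (\<lambda>\<omega>. A (V i \<omega>) * A (V i \<omega>))"
  let ?S2 = "\<Sum>i\<in>I. expectation (\<lambda>\<omega>. A (V i \<omega>) * cnj (A (V i \<omega>)))"
  have Re2: "(Re z)\<^sup>2 = Re (z * z + z * cnj z) / 2" for z :: complex
    by (simp add: power2_eq_square)
  have "expectation (\<lambda>\<omega>. (Re (A (V i \<omega>)))\<^sup>2)
      = Re (expectation (\<lambda>\<omega>. A (V i \<omega>) * A (V i \<omega>))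
          + expectation (\<lambda>\<omega>. A (V i \<omega>) * cnj (A (V i \<omega>)))) / 2" if "i \<in> I" for i
    unfolding Re2 using int1[OF that] int2[OF that]
    by (simp only: integral_divide_zero integral_Re Bochner_Integration.integral_add
        Bochner_Integration.integrable_add)
  then have "(\<Sum>i\<in>I. expectation (\<lambda>\<omega>. (Re (A (V i \<omega>)))\<^sup>2))
      = (\<Sum>i\<in>I. Re (expectation (\<lambda>\<omega>. A (V i \<omega>) * A (V i \<omega>))
          + expectation (\<lambda>\<omega>. A (V i \<omega>) * cnj (A (V i \<omega>)))) / 2)"
    by (intro sum.cong refl)
  also have "\<dots> = Re (?S1 + ?S2) / 2"
    by (simp only: Re_sum sum.distrib plus_complex.sel sum_divide_distrib[symmetric])
  also have "\<dots> \<le> cmod (?S1 + ?S2)"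
    using complex_Re_le_cmod[of "?S1 + ?S2"] norm_ge_zero[of "?S1 + ?S2"] by linarith
  also have "\<dots> \<le> cmod ?S1 + cmod ?S2"
    by (rule norm_triangle_ineq)
  finally have "ennreal (\<Sum>i\<in>I. expectation (\<lambda>\<omega>. (Re (A (V i \<omega>)))\<^sup>2))
      \<le> ennreal (cmod ?S1) + ennreal (cmod ?S2)"
    by (simp add: ennreal_leI flip: ennreal_plus)
  also have "ennreal (cmod ?S1) \<le> (\<integral>\<^sup>+t. \<integral>\<^sup>+s. ennreal (cmod (a s) * cmod (a t) *
      cmod (ch (s + t))) \<partial>lborel \<partial>lborel)"
    using expectation_fourier_product_le[OF I V a a, where \<sigma> = 1] by (simp add: A_def ch_def)
  also have "ennreal (cmod ?S2) \<le> (\<integral>\<^sup>+t. \<integral>\<^sup>+s. ennreal (cmod (a s) * cmod (a t) *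
      cmod (ch (s - t))) \<partial>lborel \<partial>lborel)"
    using expectation_fourier_product_le[OF I V a integrable_cnj[OF a], where \<sigma> = "- 1"]
    unfolding cnjA by (simp add: A_def ch_def)
  also have "(\<integral>\<^sup>+t. \<integral>\<^sup>+s. ennreal (cmod (a s) * cmod (a t) * cmod (ch (s + t))) \<partial>lborel \<partial>lborel)
      + (\<integral>\<^sup>+t. \<integral>\<^sup>+s. ennreal (cmod (a s) * cmod (a t) * cmod (ch (s - t))) \<partial>lborel \<partial>lborel)
      = (\<integral>\<^sup>+t. \<integral>\<^sup>+s. ennreal (cmod (a s) * cmod (a t) * (cmod (ch (s + t)) + cmod (ch (s - t))))
          \<partial>lborel \<partial>lborel)"
    by (simp add: nn_integral_add[symmetric] distrib_left ennreal_plus)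
  also have "\<dots> = (\<integral>\<^sup>+s. \<integral>\<^sup>+t. ennreal (cmod (a s) * cmod (a t) * (cmod (ch (s + t)) + cmod (ch (s - t))))
          \<partial>lborel \<partial>lborel)"
    by (rule lborel_pair.Fubini') measurable
  finally show ?thesis
    unfolding integral_Re_iexp[OF a] by (simp add: A_def ch_def add_mono)
qed

lemma expectation_integral_Re_iexp:
  fixes a :: "real \<Rightarrow> complex" and V :: "'a \<Rightarrow> real"
  assumes V[measurable]: "V \<in> borel_measurable M" and a: "integrable lborel a"
  shows "expectation (\<lambda>\<omega>. LINT t|lborel. Re (a t * iexp (t * V \<omega>)))
    = (LINT t|lborel. Re (a t * expectation (\<lambda>\<omega>. iexp (t * V \<omega>))))"
proof -
  note [measurable] = borel_measurable_integrable[OF a]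
  have meas: "(\<lambda>t. expectation (\<lambda>\<omega>. iexp (t * V \<omega>))) \<in> borel_measurable borel" by measurable
  have le: "norm (expectation (\<lambda>\<omega>. iexp (t * V \<omega>))) \<le> 1" for t
    using integral_norm_bound[of M "\<lambda>\<omega>. iexp (t * V \<omega>)"] by (simp add: prob_space)
  have le2: "norm (LINT t|lborel. a t * iexp (t * v)) \<le> (LINT t|lborel. norm (a t))" for v
    using integral_norm_bound[of lborel "\<lambda>t. a t * iexp (t * v)"] by (simp add: norm_mult)
  have "expectation (\<lambda>\<omega>. LINT t|lborel. Re (a t * iexp (t * V \<omega>)))
      = expectation (\<lambda>\<omega>. Re (LINT t|lborel. a t * iexp (t * V \<omega>)))"
    by (simp only: integral_Re_iexp[OF a])
  also have "\<dots> = Re (expectation (\<lambda>\<omega>. LINT t|lborel. a t * iexp (t * V \<omega>)))"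
    by (rule integral_Re, rule integrable_bounded[OF _ le2]) measurable
  also have "expectation (\<lambda>\<omega>. LINT t|lborel. a t * iexp (t * V \<omega>))
      = (LINT t|lborel. a t * expectation (\<lambda>\<omega>. iexp (t * V \<omega>)))"
    by (intro expectation_weighted_integral[where B = 1] a) auto
  also have "Re \<dots> = (LINT t|lborel. Re (a t * expectation (\<lambda>\<omega>. iexp (t * V \<omega>))))"
    by (rule integral_Re[symmetric], intro integrable_mult_bounded[where B = 1] a meas le)
  finally show ?thesis .
qed

end

section \<open>Fourier transforms of densities and the ridged reciprocal\<close>

lemma prob_density_distribution:
  assumes "prob_density f"
  shows "real_distribution (density lborel (\<lambda>x. ennreal (f x)))"
proof -
  have [measurable]: "f \<in> borel_measurable borel" and int: "integrable lborel f"
    and nn: "\<And>x. 0 \<le> f x" and one: "(LINT x|lborel. f x) = 1"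
    using assms borel_measurable_integrable by (auto simp: prob_density_def)
  have "emeasure (density lborel (\<lambda>x. ennreal (f x))) (space (density lborel (\<lambda>x. ennreal (f x)))) = 1"
    using nn_integral_eq_integral[OF int] nn one by (simp add: emeasure_density)
  then interpret prob_space "density lborel (\<lambda>x. ennreal (f x))" by (rule prob_spaceI)
  show ?thesis by unfold_locales auto
qed

text \<open>For a density the transform is a characteristic function in the library's sense; its
  bound by 1, its value at 0 and its continuity are inherited from there.\<close>

lemma fourier_eq_char:
  assumes "prob_density f"
  shows "fourier f t = char (density lborel (\<lambda>x. ennreal (f x))) t"
proof -
  have [measurable]: "f \<in> borel_measurable borel" and nn: "\<And>x. 0 \<le> f x"
    using assms borel_measurable_integrable by (auto simp: prob_density_def)
  show ?thesis
    unfolding fourier_def char_def using nn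
    by (subst integral_density) (auto simp: scaleR_conv_of_real mult.commute)
qed

lemma fourier_measurable[measurable]:
  assumes [measurable]: "f \<in> borel_measurable borel"
  shows "fourier f \<in> borel_measurable borel"
proof -
  have "(\<lambda>t. fourier f t) \<in> borel_measurable borel" unfolding fourier_def by measurable
  then show ?thesis by simp
qed

lemma fourier_density_le_1: "prob_density f \<Longrightarrow> cmod (fourier f t) \<le> 1"
  using real_distribution.cmod_char_le_1[OF prob_density_distribution] by (simp add: fourier_eq_char)

lemma fourier_density_0: "prob_density f \<Longrightarrow> fourier f 0 = 1"
  using real_distribution.char_zero[OF prob_density_distribution] by (simp add: fourier_eq_char)

lemma continuous_fourier_density:
  assumes "prob_density f"
  shows "continuous_on UNIV (fourier f)"
proof -
  have "fourier f = char (density lborel (\<lambda>x. ennreal (f x)))"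
    using assms by (auto simp: fourier_eq_char)
  then show ?thesis
    using real_distribution.isCont_char[OF prob_density_distribution[OF assms]]
    by (simp add: continuous_on_eq_continuous_at)
qed

text \<open>Intermediate value theorem: the transform is continuous, equals 1 at 0 and never
  vanishes. Positivity is what lets a square root of the estimated square recover the transform
  itself, with no ambiguity of sign.\<close>

lemma fourier_density_real_pos:
  assumes f: "prob_density f" and nz: "\<forall>t. fourier f t \<in> \<real> \<and> fourier f t \<noteq> 0"
  shows "0 < Re (fourier f t)"
proof (rule ccontr)
  assume neg: "\<not> 0 < Re (fourier f t)"
  have "continuous_on UNIV (\<lambda>t. Re (fourier f t))"
    by (intro continuous_intros continuous_fourier_density f)
  then have conn: "connected (range (\<lambda>t. Re (fourier f t)))"
    by (intro connected_continuous_image) auto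
  have "0 \<in> range (\<lambda>t. Re (fourier f t))"
    using neg fourier_density_0[OF f]
    by (intro connectedD_interval[OF conn rangeI[of _ t] rangeI[of _ 0]]) simp_all
  then obtain s where "Re (fourier f s) = 0" by (auto simp: image_iff)
  with nz[rule_format, of s] show False by (simp add: complex_is_Real_iff complex_eq_iff)
qed

text \<open>The size condition keeps \<open>a\<^sup>2 + D\<close> above
  \<open>(a / 2)\<^sup>2\<close>, so the absolute value is harmless; then
  \<open>D = (b - a) * (b + a)\<close> gives the deviation.\<close>

lemma sqrt_deviation:
  assumes a: "a > 0" and D: "\<bar>D\<bar> \<le> a\<^sup>2 / 2"
  defines "b \<equiv> sqrt \<bar>a\<^sup>2 + D\<bar>"
  shows "b \<ge> a / 2" "\<bar>b - a\<bar> \<le> \<bar>D\<bar> / a" "b\<^sup>2 = a\<^sup>2 + D"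
proof -
  have nn: "a\<^sup>2 + D \<ge> (a / 2)\<^sup>2"
    using D zero_le_power2[of a] by (auto simp: power_divide abs_le_iff)
  then show b2: "b\<^sup>2 = a\<^sup>2 + D"
    using order_trans[OF zero_le_power2 nn] unfolding b_def by simp
  show "b \<ge> a / 2"
    using nn unfolding b_def by (intro real_le_rsqrt) auto
  then have b: "b > 0" using a by linarith
  have "D = (b - a) * (b + a)" using b2 by (simp add: power2_eq_square algebra_simps)
  then have "\<bar>D\<bar> = \<bar>b - a\<bar> * (b + a)" using a b by (simp add: abs_mult)
  also have "\<dots> \<ge> \<bar>b - a\<bar> * a" using b by (intro mult_left_mono) auto
  finally show "\<bar>b - a\<bar> \<le> \<bar>D\<bar> / a" using a by (simp add: field_simps)
qed

text \<open>
  When \<open>D\<close> is not small compared with \<open>a\<^sup>2\<close>, only the ridge \<open>\<rho>\<close> controls the reciprocal; the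
  power \<open>q\<close> then expresses that this event is rare.
\<close>

lemma ridge_reciprocal_bounds:
  fixes a D \<rho> :: real and q :: nat
  assumes a: "a > 0" and \<rho>: "\<rho> > 0"
  defines "R \<equiv> 1 / (sqrt \<bar>a\<^sup>2 + D\<bar> + \<rho>) - 1 / a"
  shows "\<bar>R\<bar> \<le> 2 * \<bar>D\<bar> / a ^ 3 + 2 * \<rho> / a\<^sup>2 + (2 * \<bar>D\<bar> / a\<^sup>2) ^ q / \<rho>" (is ?th1)
    and "\<bar>R + D / (2 * a ^ 3)\<bar> \<le> 5 * D\<^sup>2 / a ^ 5 + 4 * \<rho> / a\<^sup>2 + (2 * \<bar>D\<bar> / a\<^sup>2) ^ q / \<rho>" (is ?th2)
proof -
  define b where "b = sqrt \<bar>a\<^sup>2 + D\<bar>"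
  have b0: "b \<ge> 0" unfolding b_def by simp
  have "?th1 \<and> ?th2"
  proof (cases "\<bar>D\<bar> \<le> a\<^sup>2 / 2")
    case True
    note sd = sqrt_deviation[OF a True, folded b_def]
    have b: "b > 0" using sd(1) a by linarith
    have q0: "(2 * \<bar>D\<bar> / a\<^sup>2) ^ q / \<rho> \<ge> 0" using \<rho> by simp
    have "R = (a - b - \<rho>) / (a * (b + \<rho>))"
      unfolding R_def b_def[symmetric] using a b \<rho> by (simp add: field_simps)
    then have "\<bar>R\<bar> = \<bar>a - b - \<rho>\<bar> / (a * (b + \<rho>))"
      using a b \<rho> by (simp add: abs_mult)
    also have "\<dots> \<le> (\<bar>D\<bar> / a + \<rho>) / (a * (a / 2))"
      using sd a b \<rho> by (intro frac_le mult_left_mono) auto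
    also have "\<dots> = 2 * \<bar>D\<bar> / a ^ 3 + 2 * \<rho> / a\<^sup>2"
      using a by (simp add: field_simps power2_eq_square power3_eq_cube)
    finally have 1: ?th1 using q0 by linarith
    have Deq: "D = b\<^sup>2 - a\<^sup>2" using sd(3) by simp
    \<comment> \<open>The exact second-order remainder of the reciprocal root as a function of its
      square: the double zero \<open>(b - a)\<^sup>2\<close> makes the error quadratic in
      \<open>D\<close>. The subtracted term is the effect of the ridge.\<close>
    have "R + D / (2 * a ^ 3) = (b - a)\<^sup>2 * ((b + 2 * a) / (2 * a ^ 3 * b)) - \<rho> / (b * (b + \<rho>))"
    proof -
      have "1 / (b + \<rho>) = 1 / b - \<rho> / (b * (b + \<rho>))"
        using b \<rho> by (simp add: divide_simps)
      moreover have "1 / b - 1 / a + (b\<^sup>2 - a\<^sup>2) / (2 * a ^ 3) = (b - a)\<^sup>2 * ((b + 2 * a) / (2 * a ^ 3 * b))"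
        using a b by (simp add: field_simps eval_nat_numeral)
      ultimately show ?thesis
        unfolding R_def b_def[symmetric] arg_cong[OF Deq, of "\<lambda>x. x / (2 * a ^ 3)"] by linarith
    qed
    then have "\<bar>R + D / (2 * a ^ 3)\<bar> \<le> \<bar>(b - a)\<^sup>2 * ((b + 2 * a) / (2 * a ^ 3 * b))\<bar> + \<bar>\<rho> / (b * (b + \<rho>))\<bar>"
      by (simp only: abs_triangle_ineq4)
    also have "\<bar>(b - a)\<^sup>2 * ((b + 2 * a) / (2 * a ^ 3 * b))\<bar> = (b - a)\<^sup>2 * ((b + 2 * a) / (2 * a ^ 3 * b))"
      using a b by simp
    also have "\<dots> \<le> (\<bar>D\<bar> / a)\<^sup>2 * (5 / a ^ 3)"
    proof (intro mult_mono)
      show "(b - a)\<^sup>2 \<le> (\<bar>D\<bar> / a)\<^sup>2" using sd(2) by (metis abs_ge_zero power2_abs power_mono)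
      have "(b + 2 * a) / (2 * a ^ 3 * b) \<le> (10 * b) / (2 * a ^ 3 * b)"
        using sd(1) a b by (intro divide_right_mono) auto
      also have "\<dots> = 5 / a ^ 3" using a b by (simp add: field_simps)
      finally show "(b + 2 * a) / (2 * a ^ 3 * b) \<le> 5 / a ^ 3" .
    qed (use a b in auto)
    also have "(\<bar>D\<bar> / a)\<^sup>2 * (5 / a ^ 3) = 5 * D\<^sup>2 / a ^ 5"
      by (simp add: power_divide power_add[symmetric])
    also have "\<bar>\<rho> / (b * (b + \<rho>))\<bar> \<le> \<rho> / (a / 2 * (a / 2))"
    proof -
      have "a / 2 * (a / 2) \<le> b * (b + \<rho>)" using sd(1) a b \<rho> by (intro mult_mono) auto
      then have "\<rho> / (b * (b + \<rho>)) \<le> \<rho> / (a / 2 * (a / 2))"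
        using a b \<rho> by (intro divide_left_mono) auto
      then show ?thesis using b \<rho> by simp
    qed
    also have "\<rho> / (a / 2 * (a / 2)) = 4 * \<rho> / a\<^sup>2" by (simp add: power2_eq_square)
    finally show ?thesis using 1 q0 by linarith
  next
    case False
    define x where "x = 2 * \<bar>D\<bar> / a\<^sup>2"
    have x1: "x > 1" using False a by (simp add: x_def field_simps)
    \<comment> \<open>Here \<open>x > 1\<close> expresses that \<open>D\<close> is large, so any
      power of \<open>x\<close> may be attached to the crude bound
      \<open>1 / \<rho>\<close>.\<close>
    have xq: "1 / \<rho> \<le> x ^ q / \<rho>" using x1 \<rho> by (simp add: divide_right_mono)
    have "1 / (b + \<rho>) \<le> 1 / \<rho>" "0 < 1 / (b + \<rho>)" "0 < 1 / a"
      using b0 \<rho> a by (auto simp: frac_le)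
    then have "\<bar>R\<bar> \<le> 1 / \<rho> + 1 / a" unfolding R_def b_def[symmetric] abs_le_iff by linarith
    then have R: "\<bar>R\<bar> \<le> x ^ q / \<rho> + 1 / a" using xq by linarith
    have D: "\<bar>D\<bar> = x * a\<^sup>2 / 2" using a by (simp add: x_def)
    have "D\<^sup>2 = (x * a\<^sup>2 / 2)\<^sup>2" using D by (metis power2_abs)
    then have D2: "D\<^sup>2 = x\<^sup>2 * a ^ 4 / 4"
      by (simp add: power_divide power_mult_distrib)
    have "1 / a \<le> x / a" using x1 a by (simp add: divide_right_mono)
    also have "x / a = 2 * \<bar>D\<bar> / a ^ 3" unfolding D using a by (simp add: field_simps power2_eq_square power3_eq_cube)
    finally have s1: "1 / a \<le> 2 * \<bar>D\<bar> / a ^ 3" .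
    have \<rho>0: "2 * \<rho> / a\<^sup>2 \<ge> 0" "4 * \<rho> / a\<^sup>2 \<ge> 0" using \<rho> by auto
    have 1: ?th1 using R s1 \<rho>0 unfolding x_def by linarith
    \<comment> \<open>The constant 5 of the second bound is fitted here:
      \<open>1 + x / 4 \<le> 5 * x\<^sup>2 / 4\<close> for \<open>x \<ge> 1\<close>, with equality
      at 1.\<close>
    have "1 / a + \<bar>D\<bar> / (2 * a ^ 3) = (1 + x / 4) / a"
      unfolding D using a by (simp add: field_simps power2_eq_square power3_eq_cube)
    also have "\<dots> \<le> (5 * x\<^sup>2 / 4) / a"
    proof (intro divide_right_mono)
      have "x * 1 \<le> x * x" "1 * 1 \<le> x * x" using x1 by (intro mult_mono; simp)+
      then show "1 + x / 4 \<le> 5 * x\<^sup>2 / 4" by (simp add: power2_eq_square)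
    qed (use a in auto)
    also have "\<dots> = 5 * D\<^sup>2 / a ^ 5"
      unfolding D2 using a by (simp add: field_simps eval_nat_numeral)
    finally have s2: "1 / a + \<bar>D\<bar> / (2 * a ^ 3) \<le> 5 * D\<^sup>2 / a ^ 5" .
    have "\<bar>R + D / (2 * a ^ 3)\<bar> \<le> \<bar>R\<bar> + \<bar>D / (2 * a ^ 3)\<bar>" by (rule abs_triangle_ineq)
    also have "\<bar>D / (2 * a ^ 3)\<bar> = \<bar>D\<bar> / (2 * a ^ 3)" using a by simp
    finally have ?th2 using R s2 \<rho>0 unfolding x_def by linarith
    with 1 show ?thesis ..
  qed
  then show ?th1 ?th2 by auto
qed

text \<open>The deviation is measured in units of the noise level \<open>\<nu>\<close> and the
  reciprocal of \<open>a\<close> in units of \<open>g\<close>; later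
  \<open>\<nu> = 1 / sqrt n\<close> and \<open>g = (1 + \<bar>t\<bar>) powr \<alpha>\<close>. Since
  \<open>q \<ge> 2\<close>, both \<open>y\<close> and its square are below \<open>1 + y ^ q\<close>,
  so every term becomes a deterministic order times one random factor. The hypothesis on
  \<open>A\<close> says that the tail term is of order \<open>\<nu>\<^sup>2\<close>.\<close>

lemma scaled_ridge_reciprocal_bounds:
  fixes a D \<rho> \<nu> g B c\<^sub>3 A :: real and q :: nat
  assumes a: "a > 0" "1 / a \<le> B * g" and g: "g \<ge> 1" and B: "B > 0" and \<nu>: "0 < \<nu>" "\<nu> \<le> 1"
    and \<rho>: "\<rho> > 0" "\<rho> \<le> c\<^sub>3 * \<nu>\<^sup>2" and q: "q \<ge> 2" and A: "(2 * B\<^sup>2 * g\<^sup>2 * \<nu>) ^ q / \<rho> \<le> A * \<nu>\<^sup>2"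
  defines "R \<equiv> 1 / (sqrt \<bar>a\<^sup>2 + D\<bar> + \<rho>) - 1 / a" and "y \<equiv> \<bar>D\<bar> / \<nu>"
    and "C \<equiv> 5 * B ^ 5 + 2 * B ^ 3 + 4 * c\<^sub>3 * B\<^sup>2 + A"
  shows "\<bar>R\<bar> \<le> C * (\<nu> * g ^ 3) * (1 + y ^ q)"
    and "\<bar>R + D / (2 * a ^ 3)\<bar> \<le> C * (\<nu>\<^sup>2 * g ^ 5) * (1 + y ^ q)"
proof -
  have y0: "y \<ge> 0" unfolding y_def using \<nu> by simp
  have c3: "c\<^sub>3 > 0" using \<rho> \<nu> by (smt (verit) mult_nonpos_nonneg zero_le_power2)
  have A0: "A \<ge> 0"
  proof -
    have "0 \<le> (2 * B\<^sup>2 * g\<^sup>2 * \<nu>) ^ q / \<rho>" using \<nu> \<rho> by simp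
    then have "0 \<le> A * \<nu>\<^sup>2" using A by linarith
    then show ?thesis using \<nu> by (simp add: zero_le_mult_iff)
  qed
  have y1: "y \<le> 1 + y ^ q"
  proof (cases "y \<le> 1")
    case False
    then show ?thesis using power_increasing[of 1 q y] q by simp
  qed (use y0 in \<open>simp add: add_increasing2\<close>)
  have y2: "y\<^sup>2 \<le> 1 + y ^ q"
  proof (cases "y \<le> 1")
    case True
    then have "y\<^sup>2 \<le> 1" using y0 by (simp add: power_le_one)
    then show ?thesis using y0 by (simp add: add_increasing2)
  next
    case False
    then have "y\<^sup>2 \<le> y ^ q" using q by (intro power_increasing) auto
    then show ?thesis by linarith
  qed
  let ?Y = "1 + y ^ q"
  have Y1: "?Y \<ge> 1" using y0 by simp
  have D: "\<bar>D\<bar> = \<nu> * y" "D\<^sup>2 = \<nu>\<^sup>2 * y\<^sup>2"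
  proof -
    show "\<bar>D\<bar> = \<nu> * y" using \<nu> by (simp add: y_def)
    then show "D\<^sup>2 = \<nu>\<^sup>2 * y\<^sup>2" by (metis power2_abs power_mult_distrib)
  qed
  have inv: "1 / a ^ m \<le> (B * g) ^ m" for m
  proof -
    have "(1 / a) ^ m \<le> (B * g) ^ m" using a by (intro power_mono) auto
    then show ?thesis by (simp add: power_one_over)
  qed
  have inv': "x / a ^ m \<le> x * (B * g) ^ m" if "x \<ge> 0" for x m
    using mult_left_mono[OF inv[of m] that] by simp
  have g01: "g ^ i \<le> g ^ j" if "i \<le> j" for i j using g that by (rule power_increasing[rotated])
  have \<nu>2: "\<nu>\<^sup>2 \<le> \<nu>" using \<nu> by (simp add: power2_eq_square mult_left_le)
  \<comment> \<open>The \<open>q\<close>-th power splits into a deterministic part, governed by the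
    hypothesis on \<open>A\<close>, and \<open>y ^ q\<close>.\<close>
  have r1: "(2 * \<bar>D\<bar> / a\<^sup>2) ^ q / \<rho> \<le> A * \<nu>\<^sup>2 * ?Y"
  proof -
    have "2 * \<bar>D\<bar> / a\<^sup>2 \<le> 2 * \<bar>D\<bar> * (B * g)\<^sup>2" by (rule inv') simp
    also have "\<dots> = 2 * B\<^sup>2 * g\<^sup>2 * \<nu> * y" unfolding D by (simp add: power_mult_distrib)
    finally have "(2 * \<bar>D\<bar> / a\<^sup>2) ^ q / \<rho> \<le> (2 * B\<^sup>2 * g\<^sup>2 * \<nu> * y) ^ q / \<rho>"
      using \<rho> by (intro divide_right_mono power_mono) auto
    also have "\<dots> = (2 * B\<^sup>2 * g\<^sup>2 * \<nu>) ^ q / \<rho> * y ^ q" by (simp add: power_mult_distrib)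
    also have "\<dots> \<le> A * \<nu>\<^sup>2 * y ^ q" using A y0 by (intro mult_right_mono) auto
    also have "\<dots> \<le> A * \<nu>\<^sup>2 * ?Y" using A0 by (intro mult_left_mono) auto
    finally show ?thesis .
  qed
  have r2: "\<rho> / a\<^sup>2 \<le> c\<^sub>3 * B\<^sup>2 * (\<nu>\<^sup>2 * g\<^sup>2) * ?Y"
  proof -
    have "\<rho> / a\<^sup>2 \<le> \<rho> * (B * g)\<^sup>2" using \<rho> by (intro inv') simp
    also have "\<dots> \<le> c\<^sub>3 * \<nu>\<^sup>2 * (B * g)\<^sup>2 * 1" using \<rho> by (simp add: mult_right_mono)
    also have "\<dots> \<le> c\<^sub>3 * \<nu>\<^sup>2 * (B * g)\<^sup>2 * ?Y" using Y1 c3 by (intro mult_left_mono) auto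
    finally show ?thesis by (simp add: power_mult_distrib mult_ac)
  qed
  have r3: "\<bar>D\<bar> / a ^ 3 \<le> B ^ 3 * (\<nu> * g ^ 3) * ?Y"
  proof -
    have "\<bar>D\<bar> / a ^ 3 \<le> \<bar>D\<bar> * (B * g) ^ 3" by (rule inv') simp
    also have "\<dots> = B ^ 3 * (\<nu> * g ^ 3) * y" unfolding D by (simp add: power_mult_distrib)
    also have "\<dots> \<le> B ^ 3 * (\<nu> * g ^ 3) * ?Y" using y1 B g \<nu> by (intro mult_left_mono) auto
    finally show ?thesis .
  qed
  have r4: "D\<^sup>2 / a ^ 5 \<le> B ^ 5 * (\<nu>\<^sup>2 * g ^ 5) * ?Y"
  proof -
    have "D\<^sup>2 / a ^ 5 \<le> D\<^sup>2 * (B * g) ^ 5" by (rule inv') simp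
    also have "\<dots> = B ^ 5 * (\<nu>\<^sup>2 * g ^ 5) * y\<^sup>2" unfolding D by (simp add: power_mult_distrib)
    also have "\<dots> \<le> B ^ 5 * (\<nu>\<^sup>2 * g ^ 5) * ?Y" using y2 B g \<nu> by (intro mult_left_mono) auto
    finally show ?thesis .
  qed
  have m1: "c\<^sub>3 * B\<^sup>2 * (\<nu>\<^sup>2 * g\<^sup>2) * ?Y \<le> c\<^sub>3 * B\<^sup>2 * G * ?Y" if "\<nu>\<^sup>2 * g\<^sup>2 \<le> G" for G
    using that c3 Y1 by (intro mult_right_mono mult_left_mono) auto
  have m2: "A * \<nu>\<^sup>2 * ?Y \<le> A * G * ?Y" if "\<nu>\<^sup>2 * g\<^sup>2 \<le> G" for G
  proof -
    have "\<nu>\<^sup>2 * 1 \<le> \<nu>\<^sup>2 * g\<^sup>2" using g by (intro mult_left_mono) auto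
    then show ?thesis using that A0 Y1 by (intro mult_right_mono mult_left_mono) auto
  qed
  note bounds = ridge_reciprocal_bounds[OF a(1) \<rho>(1), of D q, folded R_def]
  \<comment> \<open>The ridge and tail terms are at most of order
    \<open>\<nu>\<^sup>2 * g\<^sup>2\<close>, which both target orders dominate; hence one constant
    \<open>C\<close> can serve both bounds.\<close>
  have G1: "\<nu>\<^sup>2 * g\<^sup>2 \<le> \<nu> * g ^ 3" using g01[of 2 3] \<nu>2 g \<nu> by (intro mult_mono) auto
  have G2: "\<nu>\<^sup>2 * g\<^sup>2 \<le> \<nu>\<^sup>2 * g ^ 5" using g01[of 2 5] by (intro mult_left_mono) auto
  have nn: "0 \<le> B ^ 5 * (\<nu> * g ^ 3) * ?Y" "0 \<le> c\<^sub>3 * B\<^sup>2 * (\<nu> * g ^ 3) * ?Y" "0 \<le> B ^ 3 * (\<nu>\<^sup>2 * g ^ 5) * ?Y"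
    using B c3 \<nu> g Y1 by auto
  have "\<bar>R\<bar> \<le> 2 * (B ^ 3 * (\<nu> * g ^ 3) * ?Y) + 2 * (c\<^sub>3 * B\<^sup>2 * (\<nu> * g ^ 3) * ?Y) + A * (\<nu> * g ^ 3) * ?Y"
    using bounds(1) r3 r2 r1 m1[OF G1] m2[OF G1] by linarith
  also have "\<dots> \<le> 5 * (B ^ 5 * (\<nu> * g ^ 3) * ?Y) + 2 * (B ^ 3 * (\<nu> * g ^ 3) * ?Y)
      + 4 * (c\<^sub>3 * B\<^sup>2 * (\<nu> * g ^ 3) * ?Y) + A * (\<nu> * g ^ 3) * ?Y"
    using nn by linarith
  also have "\<dots> = C * (\<nu> * g ^ 3) * ?Y" unfolding C_def by (simp add: algebra_simps)
  finally show "\<bar>R\<bar> \<le> C * (\<nu> * g ^ 3) * ?Y" .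
  have "\<bar>R + D / (2 * a ^ 3)\<bar> \<le> 5 * (B ^ 5 * (\<nu>\<^sup>2 * g ^ 5) * ?Y)
      + 4 * (c\<^sub>3 * B\<^sup>2 * (\<nu>\<^sup>2 * g ^ 5) * ?Y) + A * (\<nu>\<^sup>2 * g ^ 5) * ?Y"
    using bounds(2) r4 r2 r1 m1[OF G2] m2[OF G2] by linarith
  also have "\<dots> \<le> 5 * (B ^ 5 * (\<nu>\<^sup>2 * g ^ 5) * ?Y) + 2 * (B ^ 3 * (\<nu>\<^sup>2 * g ^ 5) * ?Y)
      + 4 * (c\<^sub>3 * B\<^sup>2 * (\<nu>\<^sup>2 * g ^ 5) * ?Y) + A * (\<nu>\<^sup>2 * g ^ 5) * ?Y"
    using nn by linarith
  also have "\<dots> = C * (\<nu>\<^sup>2 * g ^ 5) * ?Y" unfolding C_def by (simp add: algebra_simps)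
  finally show "\<bar>R + D / (2 * a ^ 3)\<bar> \<le> C * (\<nu>\<^sup>2 * g ^ 5) * ?Y" .
qed

section \<open>Rates\<close>

text \<open>The cutoff will be \<open>T = c / h\<close>, the range on which the rescaled kernel
  transform can be nonzero; all rates reduce to these moments.\<close>

definition trunc_moment :: "real \<Rightarrow> real \<Rightarrow> ennreal" where
  "trunc_moment \<gamma> T = (\<integral>\<^sup>+t. indicator {-T..T} t * ennreal ((1 + \<bar>t\<bar>) powr \<gamma>) \<partial>lborel)"

text \<open>Folding the interval at the origin counts the point 0 twice, hence a pointwise
  inequality, which is enough for an upper bound.\<close>

lemma trunc_moment_eq:
  assumes "T \<ge> 0"
  shows "trunc_moment \<gamma> T \<le> 2 * (\<integral>\<^sup>+t. ennreal ((1 + t) powr \<gamma>) * indicator {0..T} t \<partial>lborel)"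
proof -
  let ?f = "\<lambda>t. ennreal ((1 + t) powr \<gamma>) * indicator {0..T} t"
  have "trunc_moment \<gamma> T \<le> (\<integral>\<^sup>+t. ?f t + ?f (0 - t) \<partial>lborel)"
    unfolding trunc_moment_def
    by (intro nn_integral_mono) (auto simp: indicator_def)
  also have "\<dots> = (\<integral>\<^sup>+t. ?f t \<partial>lborel) + (\<integral>\<^sup>+t. ?f (0 - t) \<partial>lborel)"
    by (rule nn_integral_add) auto
  also have "(\<integral>\<^sup>+t. ?f (0 - t) \<partial>lborel) = (\<integral>\<^sup>+t. ?f t \<partial>lborel)"
    by (rule nn_integral_lborel_reflect) auto
  finally show ?thesis by (simp add: mult_2)
qed

text \<open>The absolute value and the added 1 let one formula cover growing and decaying powers;
  the exponent -1, whose antiderivative is a logarithm, is separate.\<close>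

lemma trunc_moment_powr:
  assumes T: "T \<ge> 0" and \<gamma>: "\<gamma> \<noteq> -1"
  shows "trunc_moment \<gamma> T \<le> ennreal (2 / \<bar>\<gamma> + 1\<bar> * ((1 + T) powr (\<gamma> + 1) + 1))"
proof -
  have "(\<integral>\<^sup>+t. ennreal ((1 + t) powr \<gamma>) * indicator {0..T} t \<partial>lborel)
      = ennreal ((1 + T) powr (\<gamma> + 1) / (\<gamma> + 1) - (1 + 0) powr (\<gamma> + 1) / (\<gamma> + 1))"
  proof (rule nn_integral_FTC_Icc[where F = "\<lambda>t. (1 + t) powr (\<gamma> + 1) / (\<gamma> + 1)"])
    show "((\<lambda>t. (1 + t) powr (\<gamma> + 1) / (\<gamma> + 1)) has_real_derivative (1 + x) powr \<gamma>) (at x)"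
      if "x \<in> {0..T}" for x
    proof -
      have "((\<lambda>t. (1 + t) powr (\<gamma> + 1)) has_real_derivative (\<gamma> + 1) * (1 + x) powr (\<gamma> + 1 - 1) * 1) (at x)"
        using that by (intro DERIV_chain2[OF has_real_derivative_powr]) (auto intro!: derivative_eq_intros)
      from DERIV_cdivide[OF this, of "\<gamma> + 1"] show ?thesis using \<gamma> by (simp add: add_eq_0_iff)
    qed
  qed (use T in auto)
  also have "\<dots> \<le> ennreal (1 / \<bar>\<gamma> + 1\<bar> * ((1 + T) powr (\<gamma> + 1) + 1))"
  proof (intro ennreal_leI)
    have "((1 + T) powr (\<gamma> + 1) - 1) / (\<gamma> + 1) \<le> \<bar>(1 + T) powr (\<gamma> + 1) - 1\<bar> / \<bar>\<gamma> + 1\<bar>"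
      by (metis abs_divide abs_ge_self)
    also have "\<dots> \<le> ((1 + T) powr (\<gamma> + 1) + 1) / \<bar>\<gamma> + 1\<bar>"
      by (intro divide_right_mono) (auto simp: abs_le_iff)
    finally show "(1 + T) powr (\<gamma> + 1) / (\<gamma> + 1) - (1 + 0) powr (\<gamma> + 1) / (\<gamma> + 1)
      \<le> 1 / \<bar>\<gamma> + 1\<bar> * ((1 + T) powr (\<gamma> + 1) + 1)" by (simp add: diff_divide_distrib)
  qed
  finally have "2 * (\<integral>\<^sup>+t. ennreal ((1 + t) powr \<gamma>) * indicator {0..T} t \<partial>lborel)
      \<le> 2 * ennreal (1 / \<bar>\<gamma> + 1\<bar> * ((1 + T) powr (\<gamma> + 1) + 1))" by (intro mult_left_mono) auto
  also have "\<dots> = ennreal (2 * (1 / \<bar>\<gamma> + 1\<bar> * ((1 + T) powr (\<gamma> + 1) + 1)))"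
    by (subst ennreal_mult') auto
  finally show ?thesis using order_trans[OF trunc_moment_eq[OF T, of \<gamma>]] by simp
qed

lemma trunc_moment_ln:
  assumes T: "T \<ge> 0"
  shows "trunc_moment (-1) T \<le> ennreal (2 * ln (1 + T))"
proof -
  have "(\<integral>\<^sup>+t. ennreal ((1 + t) powr -1) * indicator {0..T} t \<partial>lborel) = ennreal (ln (1 + T) - ln (1 + 0))"
  proof (rule nn_integral_FTC_Icc[where F = "\<lambda>t. ln (1 + t)"])
    show "((\<lambda>t. ln (1 + t)) has_real_derivative (1 + x) powr - 1) (at x)"
      if "x \<in> {0..T}" for x
    proof -
      have "((\<lambda>t. ln (1 + t)) has_real_derivative 1 / (1 + x) * 1) (at x)"
        using that by (intro DERIV_chain2[OF DERIV_ln_divide]) (auto intro!: derivative_eq_intros)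
      then show ?thesis using that by (simp add: powr_minus_divide)
    qed
  qed (use T in auto)
  then have "2 * (\<integral>\<^sup>+t. ennreal ((1 + t) powr -1) * indicator {0..T} t \<partial>lborel) = ennreal (2 * ln (1 + T))"
    using T by (subst ennreal_mult') auto
  then show ?thesis using trunc_moment_eq[OF T, of "-1"] by simp
qed

text \<open>The order of the conditional variance. One factor 1/n comes from averaging the
  observations, one from the squared size of \<open>R\<close>; the extra
  \<open>sqrt (real n)\<close> comes from the fluctuation of the empirical characteristic function
  of the errors. The case split decides whether the transform of \<open>X + U\<close> is integrable
  for certain.\<close>

definition noise_rate :: "real \<Rightarrow> real \<Rightarrow> nat \<Rightarrow> real \<Rightarrow> ennreal" where
  "noise_rate \<alpha> \<beta> n T =
    (if \<beta> \<le> \<alpha> then ennreal (1 / (real n)\<^sup>2) * (trunc_moment (3 * \<alpha>) T)\<^sup>2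
     else ennreal (1 / (real n)\<^sup>2) * trunc_moment (6 * \<alpha>) T
       + ennreal (1 / ((real n)\<^sup>2 * sqrt (real n))) * (trunc_moment (3 * \<alpha>) T)\<^sup>2)"

text \<open>The summands belong to the linear part of the conditional mean, to its remainder and to
  the conditional variance. The linear part enters through an L2 norm, so its exponent
  2\<alpha>-\<beta> is doubled; the remainder enters through the square of an L1 norm.\<close>

definition risk_bound :: "real \<Rightarrow> real \<Rightarrow> nat \<Rightarrow> real \<Rightarrow> ennreal" where
  "risk_bound \<alpha> \<beta> n T = ennreal (1 / real n) * trunc_moment (4 * \<alpha> - 2 * \<beta>) T
    + ennreal (1 / (real n)\<^sup>2) * (trunc_moment (4 * \<alpha> - \<beta>) T)\<^sup>2 + noise_rate \<alpha> \<beta> n T"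

section \<open>Comparison of the truncated moments with the rate\<close>

locale bandwidth_regime =
  fixes \<alpha> c H A :: real
  assumes \<alpha>: "\<alpha> > 1 / 2" and c: "c > 0" and H: "H > 0" and A: "A > 0"
begin

text \<open>The last condition bounds n h^(4\<alpha>) from below, written through the largest value
  of (1+|t|)^(4\<alpha>) on the cutoff range.\<close>

definition admissible :: "nat \<Rightarrow> real \<Rightarrow> bool" where
  "admissible n h \<longleftrightarrow> n \<ge> 1 \<and> 0 < h \<and> h \<le> H \<and> (1 + c / h) powr (4 * \<alpha>) \<le> A * real n"

lemma one_plus_le: "admissible n h \<Longrightarrow> 1 + c / h \<le> (H + c) / h"
  by (simp add: admissible_def field_simps)

text \<open>The upper endpoint dominates, and the additive 1 is absorbed because
  \<open>H / h \<ge> 1\<close>.\<close>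

lemma trunc_moment_pos_exponent:
  assumes \<gamma>: "\<gamma> > -1"
  shows "\<exists>C>0. \<forall>n h. admissible n h \<longrightarrow> trunc_moment \<gamma> (c / h) \<le> ennreal (C * h powr (- \<gamma> - 1))"
proof (intro exI conjI allI impI)
  define C where "C = 2 / (\<gamma> + 1) * ((H + c) powr (\<gamma> + 1) + H powr (\<gamma> + 1))"
  have "(H + c) powr (\<gamma> + 1) + H powr (\<gamma> + 1) > 0"
    using H c by (intro add_pos_nonneg) auto
  then show "C > 0" using \<gamma> by (simp only: C_def zero_less_mult_iff zero_less_divide_iff) simp
  fix n h assume adm: "admissible n h"
  then have h: "0 < h" "h \<le> H" by (auto simp: admissible_def)
  have "trunc_moment \<gamma> (c / h) \<le> ennreal (2 / \<bar>\<gamma> + 1\<bar> * ((1 + c / h) powr (\<gamma> + 1) + 1))"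
    using c h \<gamma> by (intro trunc_moment_powr) auto
  also have "\<dots> \<le> ennreal (2 / (\<gamma> + 1) * (((H + c) / h) powr (\<gamma> + 1) + (H / h) powr (\<gamma> + 1)))"
  proof (intro ennreal_leI mult_mono add_mono)
    show "(1 + c / h) powr (\<gamma> + 1) \<le> ((H + c) / h) powr (\<gamma> + 1)"
      using one_plus_le[OF adm] c h \<gamma> by (intro powr_mono2) auto
    show "1 \<le> (H / h) powr (\<gamma> + 1)" using h \<gamma> by (intro ge_one_powr_ge_zero) auto
  qed (use \<gamma> in auto)
  also have "\<dots> = ennreal (C * h powr (- \<gamma> - 1))"
  proof -
    have "(y / h) powr (\<gamma> + 1) = y powr (\<gamma> + 1) * h powr (- \<gamma> - 1)" if "y \<ge> 0" for y
      using powr_minus_divide[of h "\<gamma> + 1"] h that by (simp add: powr_divide)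
    then show ?thesis using H c by (simp add: C_def distrib_right distrib_left mult.assoc)
  qed
  finally show "trunc_moment \<gamma> (c / h) \<le> ennreal (C * h powr (- \<gamma> - 1))" .
qed

text \<open>Growing, critical and convergent moments give a power of \<open>h\<close>, a logarithm
  and a constant respectively. The three are added because the regime of \<gamma> varies with
  \<beta>.\<close>

lemma trunc_moment_any_exponent:
  "\<exists>C>0. \<forall>n h. admissible n h \<longrightarrow>
    trunc_moment \<gamma> (c / h) \<le> ennreal (C * (h powr (- \<gamma> - 1) + 1 + ln (real n)))"
proof -
  consider "\<gamma> > -1" | "\<gamma> = -1" | "\<gamma> < -1" by linarith
  then show ?thesis
  proof cases
    case 1
    then obtain C where C: "C > 0"
      "\<And>n h. admissible n h \<Longrightarrow> trunc_moment \<gamma> (c / h) \<le> ennreal (C * h powr (- \<gamma> - 1))"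
      using trunc_moment_pos_exponent by blast
    have "trunc_moment \<gamma> (c / h) \<le> ennreal (C * (h powr (- \<gamma> - 1) + 1 + ln (real n)))"
      if "admissible n h" for n h
    proof -
      have "C * h powr (- \<gamma> - 1) \<le> C * (h powr (- \<gamma> - 1) + 1 + ln (real n))"
        using C(1) that by (intro mult_left_mono) (auto simp: admissible_def)
      then show ?thesis using C(2)[OF that] by (meson ennreal_leI order_trans)
    qed
    then show ?thesis using C(1) by blast
  next
    case 2
    \<comment> \<open>Admissibility bounds \<open>4 * \<alpha> * ln (1 + c / h)\<close> by
      \<open>ln A + ln (real n)\<close>, and the moment is at most
      \<open>2 * ln (1 + c / h)\<close>; \<open>\<bar>ln A\<bar> + 1\<close> makes the comparison
      uniform in \<open>n\<close>.\<close>
    define C where "C = (\<bar>ln A\<bar> + 1) / (2 * \<alpha>)"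
    have C: "C > 0" unfolding C_def using \<alpha> by (simp add: add_nonneg_pos)
    have "trunc_moment \<gamma> (c / h) \<le> ennreal (C * (h powr (- \<gamma> - 1) + 1 + ln (real n)))"
      if "admissible n h" for n h
    proof -
      have h: "0 < h" "n \<ge> 1" "(1 + c / h) powr (4 * \<alpha>) \<le> A * real n" using that by (auto simp: admissible_def)
      have pos: "1 + c / h > 0" using c h by (simp add: add_pos_pos)
      have "4 * \<alpha> * ln (1 + c / h) = ln ((1 + c / h) powr (4 * \<alpha>))" using pos by (simp add: ln_powr)
      also have "\<dots> \<le> ln (A * real n)" using h pos A by (subst ln_le_cancel_iff) auto
      also have "\<dots> = ln A + ln (real n)" using A h by (simp add: ln_mult)
      also have "\<dots> \<le> (\<bar>ln A\<bar> + 1) * (1 + ln (real n))"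
      proof -
        have "ln (real n) \<ge> 0" using h by simp
        then have "\<bar>ln A\<bar> * ln (real n) \<ge> 0" by simp
        then show ?thesis by (simp add: algebra_simps)
      qed
      finally have "2 * ln (1 + c / h) \<le> C * (1 + ln (real n))"
        unfolding C_def using \<alpha> by (simp add: field_simps)
      also have "\<dots> \<le> C * (h powr (- \<gamma> - 1) + 1 + ln (real n))"
        using C by (intro mult_left_mono) auto
      finally show ?thesis
        using trunc_moment_ln[of "c / h"] c h 2 by (auto intro: order_trans ennreal_leI)
    qed
    then show ?thesis using C by blast
  next
    case 3
    define C where "C = 4 / \<bar>\<gamma> + 1\<bar>"
    have C: "C > 0" unfolding C_def using 3 by simp
    have "trunc_moment \<gamma> (c / h) \<le> ennreal (C * (h powr (- \<gamma> - 1) + 1 + ln (real n)))"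
      if "admissible n h" for n h
    proof -
      have h: "0 < h" "n \<ge> 1" using that by (auto simp: admissible_def)
      have "(1 + c / h) powr (\<gamma> + 1) \<le> (1 + c / h) powr 0"
        using c h 3 by (intro powr_mono) auto
      then have "(1 + c / h) powr (\<gamma> + 1) \<le> 1" using c h by (simp add: add_pos_pos split: if_splits)
      then have "2 / \<bar>\<gamma> + 1\<bar> * ((1 + c / h) powr (\<gamma> + 1) + 1) \<le> 2 / \<bar>\<gamma> + 1\<bar> * (1 + 1)"
        by (intro mult_left_mono add_mono) auto
      also have "\<dots> = C * 1" by (simp add: C_def)
      also have "\<dots> \<le> C * (h powr (- \<gamma> - 1) + 1 + ln (real n))"
        using C h by (intro mult_left_mono) auto
      finally show ?thesis
        using trunc_moment_powr[of "c / h" \<gamma>] c h 3 by (auto intro: order_trans ennreal_leI)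
    qed
    then show ?thesis using C by blast
  qed
qed

lemma p_rate_ge:
  assumes "admissible n h"
  shows "1 / real n * h powr (2 * (\<beta> - 2 * \<alpha>) - 1) \<le> p_rate \<alpha> \<beta> k n h"
    and "1 / real n * (ln (real n))\<^sup>2 \<le> p_rate \<alpha> \<beta> k n h"
    and "1 / (real n)\<^sup>2 * h powr (2 * (\<beta> - 4 * \<alpha>) - 2) \<le> p_rate \<alpha> \<beta> k n h"
    and "1 / (real n)\<^sup>2 * h powr (- 6 * \<alpha> - 1) \<le> p_rate \<alpha> \<beta> k n h"
proof -
  define a1 where "a1 = 1 / real n * h powr (\<beta> - 2 * \<alpha> - 1)"
  define a2 where "a2 = 1 / real n * h powr (2 * (\<beta> - 2 * \<alpha>) - 1)"
  define a3 where "a3 = 1 / real n * (ln (real n))\<^sup>2"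
  define a4 where "a4 = 1 / (real n)\<^sup>2 * h powr (2 * (\<beta> - 4 * \<alpha>) - 2)"
  define a5 where "a5 = 1 / (real n)\<^sup>2 * h powr (- 6 * \<alpha> - 1)"
  define a6 where "a6 = 1 / (real n) ^ k * h powr (- 4 * (real k + 2) * \<alpha> - 2)"
  have p: "p_rate \<alpha> \<beta> k n h = a1 + a2 + a3 + a4 + a5 + a6"
    unfolding p_rate_def a1_def a2_def a3_def a4_def a5_def a6_def by (simp only: distrib_left)
  have nn: "0 \<le> a1" "0 \<le> a2" "0 \<le> a3" "0 \<le> a4" "0 \<le> a5" "0 \<le> a6"
    unfolding a1_def a2_def a3_def a4_def a5_def a6_def by auto
  show "1 / real n * h powr (2 * (\<beta> - 2 * \<alpha>) - 1) \<le> p_rate \<alpha> \<beta> k n h"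
    "1 / real n * (ln (real n))\<^sup>2 \<le> p_rate \<alpha> \<beta> k n h"
    "1 / (real n)\<^sup>2 * h powr (2 * (\<beta> - 4 * \<alpha>) - 2) \<le> p_rate \<alpha> \<beta> k n h"
    "1 / (real n)\<^sup>2 * h powr (- 6 * \<alpha> - 1) \<le> p_rate \<alpha> \<beta> k n h"
    using nn unfolding p a2_def[symmetric] a3_def[symmetric] a4_def[symmetric] a5_def[symmetric] by auto
qed

text \<open>For \<open>n = 1\<close> the logarithmic term of the rate vanishes.\<close>

lemma inverse_n_le_p_rate:
  "\<exists>C>0. \<forall>n h. admissible n h \<longrightarrow> 1 / real n \<le> C * p_rate \<alpha> \<beta> k n h"
proof -
  define C where "C = 1 / (ln 2)\<^sup>2 + H powr (6 * \<alpha> + 1)"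
  have C: "C > 0" unfolding C_def using H by (auto intro!: add_pos_pos)
  have "1 / real n \<le> C * p_rate \<alpha> \<beta> k n h" if adm: "admissible n h" for n h
  proof -
    have h: "0 < h" "h \<le> H" "n \<ge> 1" using adm by (auto simp: admissible_def)
    note ge = p_rate_ge[OF adm, of \<beta> k]
    have p0: "0 \<le> p_rate \<alpha> \<beta> k n h" by (rule order_trans[OF _ ge(2)]) simp
    show ?thesis
    proof (cases "n = 1")
      case True
      \<comment> \<open>With the logarithm gone, a negative power of \<open>h\<close> takes over; it
        is bounded below because \<open>h \<le> H\<close>. In the other case
        \<open>n \<ge> 2\<close> keeps the logarithm at least \<open>ln 2\<close>.\<close>
      have "1 \<le> (H / h) powr (6 * \<alpha> + 1)" using h \<alpha> by (intro ge_one_powr_ge_zero) auto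
      also have "\<dots> = H powr (6 * \<alpha> + 1) * h powr (- 6 * \<alpha> - 1)"
        using h H powr_minus_divide[of h "6 * \<alpha> + 1"] by (simp add: powr_divide)
      also have "\<dots> \<le> H powr (6 * \<alpha> + 1) * p_rate \<alpha> \<beta> k n h"
        using ge(4) True by (intro mult_left_mono) auto
      also have "\<dots> \<le> C * p_rate \<alpha> \<beta> k n h"
        unfolding C_def by (intro mult_right_mono p0) auto
      finally show ?thesis using True by simp
    next
      case False
      then have "ln 2 \<le> ln (real n)" using h by simp
      then have "(ln 2)\<^sup>2 \<le> (ln (real n))\<^sup>2" by (intro power_mono) auto
      then have "1 / real n * (ln 2)\<^sup>2 \<le> 1 / real n * (ln (real n))\<^sup>2"
        by (intro mult_left_mono) auto
      also note ge(2)
      finally have "1 / real n \<le> 1 / (ln 2)\<^sup>2 * p_rate \<alpha> \<beta> k n h" by (simp add: field_simps)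
      also have "\<dots> \<le> C * p_rate \<alpha> \<beta> k n h"
        unfolding C_def by (intro mult_right_mono p0) auto
      finally show ?thesis .
    qed
  qed
  then show ?thesis using C by blast
qed

text \<open>The moment produces at most a first power of the logarithm, which
  \<open>1 + (ln (real n))\<^sup>2\<close> absorbs; the constants are covered by the bound of
  \<open>1 / real n\<close> by the rate.\<close>

lemma linear_term_rate:
  "\<exists>C>0. \<forall>n h. admissible n h \<longrightarrow> ennreal (1 / real n) * trunc_moment (4 * \<alpha> - 2 * \<beta>) (c / h)
    \<le> ennreal (C * p_rate \<alpha> \<beta> k n h)"
proof -
  obtain C1 where C1: "C1 > 0" "\<And>n h. admissible n h \<Longrightarrow> trunc_moment (4 * \<alpha> - 2 * \<beta>) (c / h)
      \<le> ennreal (C1 * (h powr (- (4 * \<alpha> - 2 * \<beta>) - 1) + 1 + ln (real n)))"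
    using trunc_moment_any_exponent by blast
  obtain C2 where C2: "C2 > 0" "\<And>n h. admissible n h \<Longrightarrow> 1 / real n \<le> C2 * p_rate \<alpha> \<beta> k n h"
    using inverse_n_le_p_rate by blast
  define C where "C = C1 * (2 + 2 * C2)"
  have "ennreal (1 / real n) * trunc_moment (4 * \<alpha> - 2 * \<beta>) (c / h) \<le> ennreal (C * p_rate \<alpha> \<beta> k n h)"
    if adm: "admissible n h" for n h
  proof -
    note ge = p_rate_ge[OF adm, of \<beta> k]
    have n: "n \<ge> 1" using adm by (simp add: admissible_def)
    let ?l = "ln (real n)"
    have l: "?l \<le> 1 + ?l\<^sup>2"
    proof -
      have "0 \<le> ?l" using n by simp
      moreover have "(?l - 1)\<^sup>2 = ?l\<^sup>2 - 2 * ?l + 1" by (simp add: power2_diff)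
      ultimately show ?thesis using zero_le_power2[of "?l - 1"] by linarith
    qed
    have eq: "- (4 * \<alpha> - 2 * \<beta>) - 1 = 2 * (\<beta> - 2 * \<alpha>) - 1" by simp
    have "ennreal (1 / real n) * trunc_moment (4 * \<alpha> - 2 * \<beta>) (c / h)
        \<le> ennreal (1 / real n) * ennreal (C1 * (h powr (2 * (\<beta> - 2 * \<alpha>) - 1) + 1 + ?l))"
      using C1(2)[OF adm] unfolding eq by (intro mult_left_mono) auto
    also have "\<dots> = ennreal (1 / real n * (C1 * (h powr (2 * (\<beta> - 2 * \<alpha>) - 1) + 1 + ?l)))"
      by (subst ennreal_mult') auto
    also have "\<dots> \<le> ennreal (C * p_rate \<alpha> \<beta> k n h)"
    proof (intro ennreal_leI)
      have "1 / real n * (C1 * (h powr (2 * (\<beta> - 2 * \<alpha>) - 1) + 1 + ?l))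
          \<le> 1 / real n * (C1 * (h powr (2 * (\<beta> - 2 * \<alpha>) - 1) + 2 + ?l\<^sup>2))"
        using l C1(1) by (intro mult_left_mono) auto
      also have "\<dots> = C1 * (1 / real n * h powr (2 * (\<beta> - 2 * \<alpha>) - 1) + 2 * (1 / real n) + 1 / real n * ?l\<^sup>2)"
        by (simp add: algebra_simps)
      also have "\<dots> \<le> C1 * (p_rate \<alpha> \<beta> k n h + 2 * (C2 * p_rate \<alpha> \<beta> k n h) + p_rate \<alpha> \<beta> k n h)"
        using ge C2(2)[OF adm] C1(1) by (intro mult_left_mono add_mono) auto
      also have "\<dots> = C * p_rate \<alpha> \<beta> k n h" by (simp add: C_def algebra_simps)
      finally show "1 / real n * (C1 * (h powr (2 * (\<beta> - 2 * \<alpha>) - 1) + 1 + ?l)) \<le> C * p_rate \<alpha> \<beta> k n h" .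
    qed
    finally show ?thesis .
  qed
  moreover have "C > 0" unfolding C_def using C1 C2 by simp
  ultimately show ?thesis by blast
qed

text \<open>Squaring the moment creates a squared logarithm. It carries the factor 1/n^2 \<le> 1/n
  and so fits under the logarithmic term of the rate, as do the constants.\<close>

lemma quadratic_term_rate:
  "\<exists>C>0. \<forall>n h. admissible n h \<longrightarrow> ennreal (1 / (real n)\<^sup>2) * (trunc_moment (4 * \<alpha> - \<beta>) (c / h))\<^sup>2
    \<le> ennreal (C * p_rate \<alpha> \<beta> k n h)"
proof -
  obtain C1 where C1: "C1 > 0" "\<And>n h. admissible n h \<Longrightarrow> trunc_moment (4 * \<alpha> - \<beta>) (c / h)
      \<le> ennreal (C1 * (h powr (- (4 * \<alpha> - \<beta>) - 1) + 1 + ln (real n)))"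
    using trunc_moment_any_exponent by blast
  obtain C2 where C2: "C2 > 0" "\<And>n h. admissible n h \<Longrightarrow> 1 / real n \<le> C2 * p_rate \<alpha> \<beta> k n h"
    using inverse_n_le_p_rate by blast
  define C where "C = 3 * C1\<^sup>2 * (2 + C2)"
  have "ennreal (1 / (real n)\<^sup>2) * (trunc_moment (4 * \<alpha> - \<beta>) (c / h))\<^sup>2 \<le> ennreal (C * p_rate \<alpha> \<beta> k n h)"
    if adm: "admissible n h" for n h
  proof -
    note ge = p_rate_ge[OF adm, of \<beta> k]
    have n: "n \<ge> 1" using adm by (simp add: admissible_def)
    let ?l = "ln (real n)" and ?h = "h powr (\<beta> - 4 * \<alpha> - 1)"
    have eq: "- (4 * \<alpha> - \<beta>) - 1 = \<beta> - 4 * \<alpha> - 1" by simp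
    have l0: "?l \<ge> 0" using n by simp
    have n2: "1 / (real n)\<^sup>2 \<le> 1 / real n" using n by (simp add: field_simps power2_eq_square)
    have "ennreal (1 / (real n)\<^sup>2) * (trunc_moment (4 * \<alpha> - \<beta>) (c / h))\<^sup>2
        \<le> ennreal (1 / (real n)\<^sup>2) * (ennreal (C1 * (?h + 1 + ?l)))\<^sup>2"
      using C1(2)[OF adm] unfolding eq by (intro mult_left_mono power_mono) auto
    also have "\<dots> = ennreal (1 / (real n)\<^sup>2 * (C1 * (?h + 1 + ?l))\<^sup>2)"
    proof -
      have "0 \<le> C1 * (?h + 1 + ?l)" using C1(1) l0 by simp
      then show ?thesis by (simp only: ennreal_power) (rule ennreal_mult'[symmetric], simp)
    qed
    also have "\<dots> \<le> ennreal (C * p_rate \<alpha> \<beta> k n h)"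
    proof (intro ennreal_leI)
      have sq: "(a + b + d)\<^sup>2 \<le> 3 * (a\<^sup>2 + b\<^sup>2 + d\<^sup>2)" for a b d :: real
        using zero_le_power2[of "a - b"] zero_le_power2[of "a - d"] zero_le_power2[of "b - d"]
        by (simp add: power2_eq_square algebra_simps)
      have "1 / (real n)\<^sup>2 * (C1 * (?h + 1 + ?l))\<^sup>2 = C1\<^sup>2 * (1 / (real n)\<^sup>2 * (?h + 1 + ?l)\<^sup>2)"
        by (simp add: power_mult_distrib)
      also have "\<dots> \<le> C1\<^sup>2 * (1 / (real n)\<^sup>2 * (3 * (?h\<^sup>2 + 1\<^sup>2 + ?l\<^sup>2)))"
        by (intro mult_left_mono sq) auto
      also have "?h\<^sup>2 = h powr (2 * (\<beta> - 4 * \<alpha>) - 2)"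
        unfolding power2_eq_square powr_add[symmetric] by (rule arg_cong[of _ _ "(powr) h"]) simp
      also have "C1\<^sup>2 * (1 / (real n)\<^sup>2 * (3 * (h powr (2 * (\<beta> - 4 * \<alpha>) - 2) + 1\<^sup>2 + ?l\<^sup>2)))
          = 3 * C1\<^sup>2 * (1 / (real n)\<^sup>2 * h powr (2 * (\<beta> - 4 * \<alpha>) - 2) + 1 / (real n)\<^sup>2 + 1 / (real n)\<^sup>2 * ?l\<^sup>2)"
        by (simp add: algebra_simps)
      also have "\<dots> \<le> 3 * C1\<^sup>2 * (1 / (real n)\<^sup>2 * h powr (2 * (\<beta> - 4 * \<alpha>) - 2) + 1 / real n + 1 / real n * ?l\<^sup>2)"
        using n2 by (intro mult_left_mono add_mono mult_right_mono) auto
      also have "\<dots> \<le> 3 * C1\<^sup>2 * (p_rate \<alpha> \<beta> k n h + C2 * p_rate \<alpha> \<beta> k n h + p_rate \<alpha> \<beta> k n h)"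
        using ge C2(2)[OF adm] by (intro mult_left_mono add_mono) auto
      also have "\<dots> = C * p_rate \<alpha> \<beta> k n h" by (simp add: C_def algebra_simps)
      finally show "1 / (real n)\<^sup>2 * (C1 * (?h + 1 + ?l))\<^sup>2 \<le> C * p_rate \<alpha> \<beta> k n h" .
    qed
    finally show ?thesis .
  qed
  moreover have "C > 0" unfolding C_def using C1 C2 by simp
  ultimately show ?thesis by blast
qed

text \<open>The term is of order n^(-2) h^(-6\<alpha>-2), which is n^(-2) h^(2(\<beta>-4\<alpha>)-2)
  times h^(2\<alpha>-2\<beta>); for \<beta> \<le> \<alpha> the last factor is bounded on
  \<open>h \<le> H\<close>.\<close>

lemma rough_noise_term_rate:
  assumes \<beta>: "\<beta> \<le> \<alpha>"
  shows "\<exists>C>0. \<forall>n h. admissible n h \<longrightarrow> ennreal (1 / (real n)\<^sup>2) * (trunc_moment (3 * \<alpha>) (c / h))\<^sup>2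
    \<le> ennreal (C * p_rate \<alpha> \<beta> k n h)"
proof -
  obtain C1 where C1: "C1 > 0" "\<And>n h. admissible n h \<Longrightarrow> trunc_moment (3 * \<alpha>) (c / h)
      \<le> ennreal (C1 * h powr (- (3 * \<alpha>) - 1))"
    using trunc_moment_pos_exponent[of "3 * \<alpha>"] \<alpha> by auto
  define C where "C = C1\<^sup>2 * H powr (2 * \<alpha> - 2 * \<beta>)"
  have "ennreal (1 / (real n)\<^sup>2) * (trunc_moment (3 * \<alpha>) (c / h))\<^sup>2 \<le> ennreal (C * p_rate \<alpha> \<beta> k n h)"
    if adm: "admissible n h" for n h
  proof -
    have h: "0 < h" "h \<le> H" using adm by (auto simp: admissible_def)
    note ge = p_rate_ge[OF adm, of \<beta> k]
    have "ennreal (1 / (real n)\<^sup>2) * (trunc_moment (3 * \<alpha>) (c / h))\<^sup>2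
        \<le> ennreal (1 / (real n)\<^sup>2) * (ennreal (C1 * h powr (- (3 * \<alpha>) - 1)))\<^sup>2"
      using C1(2)[OF adm] by (intro mult_left_mono power_mono) auto
    also have "\<dots> = ennreal (1 / (real n)\<^sup>2 * (C1 * h powr (- (3 * \<alpha>) - 1))\<^sup>2)"
      using C1(1) by (simp add: ennreal_power ennreal_mult'[symmetric] less_imp_le del: ennreal_mult')
    also have "\<dots> \<le> ennreal (C * p_rate \<alpha> \<beta> k n h)"
    proof (intro ennreal_leI)
      have "1 / (real n)\<^sup>2 * (C1 * h powr (- (3 * \<alpha>) - 1))\<^sup>2
          = C1\<^sup>2 * (1 / (real n)\<^sup>2 * h powr (2 * (\<beta> - 4 * \<alpha>) - 2)) * h powr (2 * \<alpha> - 2 * \<beta>)"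
      proof -
        have "(h powr (- (3 * \<alpha>) - 1))\<^sup>2 = h powr (2 * (\<beta> - 4 * \<alpha>) - 2) * h powr (2 * \<alpha> - 2 * \<beta>)"
          by (simp add: power2_eq_square powr_add[symmetric])
        then show ?thesis by (simp add: power_mult_distrib)
      qed
      also have "\<dots> \<le> C1\<^sup>2 * p_rate \<alpha> \<beta> k n h * H powr (2 * \<alpha> - 2 * \<beta>)"
        using ge(3) h \<beta> order_trans[OF _ ge(2)]
        by (intro mult_mono mult_left_mono powr_mono2) auto
      finally show "1 / (real n)\<^sup>2 * (C1 * h powr (- (3 * \<alpha>) - 1))\<^sup>2 \<le> C * p_rate \<alpha> \<beta> k n h"
        by (simp add: C_def mult_ac)
    qed
    finally show ?thesis .
  qed
  moreover have "C > 0" unfolding C_def using C1 H by simp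
  ultimately show ?thesis by blast
qed

lemma smooth_noise_term_rate:
  "\<exists>C>0. \<forall>n h. admissible n h \<longrightarrow> ennreal (1 / (real n)\<^sup>2) * trunc_moment (6 * \<alpha>) (c / h)
    \<le> ennreal (C * p_rate \<alpha> \<beta> k n h)"
proof -
  obtain C1 where C1: "C1 > 0" "\<And>n h. admissible n h \<Longrightarrow> trunc_moment (6 * \<alpha>) (c / h)
      \<le> ennreal (C1 * h powr (- (6 * \<alpha>) - 1))"
    using trunc_moment_pos_exponent[of "6 * \<alpha>"] \<alpha> by auto
  have "ennreal (1 / (real n)\<^sup>2) * trunc_moment (6 * \<alpha>) (c / h) \<le> ennreal (C1 * p_rate \<alpha> \<beta> k n h)"
    if adm: "admissible n h" for n h
  proof -
    note ge = p_rate_ge[OF adm, of \<beta> k]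
    have "ennreal (1 / (real n)\<^sup>2) * trunc_moment (6 * \<alpha>) (c / h)
        \<le> ennreal (1 / (real n)\<^sup>2) * ennreal (C1 * h powr (- 6 * \<alpha> - 1))"
      using C1(2)[OF adm] by (intro mult_left_mono) auto
    also have "\<dots> = ennreal (C1 * (1 / (real n)\<^sup>2 * h powr (- 6 * \<alpha> - 1)))"
      by (subst ennreal_mult'[symmetric]) (auto simp: mult_ac)
    also have "\<dots> \<le> ennreal (C1 * p_rate \<alpha> \<beta> k n h)"
      using ge(4) C1(1) by (intro ennreal_leI mult_left_mono) auto
    finally show ?thesis .
  qed
  then show ?thesis using C1(1) by blast
qed

text \<open>Here \<open>n h\<^sup>4\<^sup>\<alpha>\<close> bounded below and \<open>\<alpha> > 1/2\<close> give \<open>n h\<^sup>2\<close> bounded below.\<close>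

lemma fluctuation_noise_term_rate:
  "\<exists>C>0. \<forall>n h. admissible n h \<longrightarrow>
    ennreal (1 / ((real n)\<^sup>2 * sqrt (real n))) * (trunc_moment (3 * \<alpha>) (c / h))\<^sup>2
    \<le> ennreal (C * p_rate \<alpha> \<beta> k n h)"
proof -
  obtain C1 where C1: "C1 > 0" "\<And>n h. admissible n h \<Longrightarrow> trunc_moment (3 * \<alpha>) (c / h)
      \<le> ennreal (C1 * h powr (- (3 * \<alpha>) - 1))"
    using trunc_moment_pos_exponent[of "3 * \<alpha>"] \<alpha> by auto
  define C2 where "C2 = sqrt A * H powr (2 * \<alpha> - 1) / c powr (2 * \<alpha>)"
  define C where "C = C1\<^sup>2 * C2"
  have "ennreal (1 / ((real n)\<^sup>2 * sqrt (real n))) * (trunc_moment (3 * \<alpha>) (c / h))\<^sup>2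
      \<le> ennreal (C * p_rate \<alpha> \<beta> k n h)"
    if adm: "admissible n h" for n h
  proof -
    have h: "0 < h" "h \<le> H" "n \<ge> 1" "(1 + c / h) powr (4 * \<alpha>) \<le> A * real n"
      using adm by (auto simp: admissible_def)
    note ge = p_rate_ge[OF adm, of \<beta> k]
    \<comment> \<open>The squared moment has one factor 1/h more than the available term of the
      rate; it is traded for \<open>sqrt (real n)\<close>. Admissibility gives h^(-2\<alpha>) up to
      a constant, and multiplying by h^(2\<alpha>-1), bounded since \<alpha> > 1/2, leaves
      1/h.\<close>
    have key: "1 / h \<le> C2 * sqrt (real n)"
    proof -
      have "((c / h) powr (2 * \<alpha>))\<^sup>2 = (c / h) powr (4 * \<alpha>)"
        by (simp add: power2_eq_square powr_add[symmetric])
      also have "\<dots> \<le> (1 + c / h) powr (4 * \<alpha>)" using c h \<alpha> by (intro powr_mono2) auto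
      also note h(4)
      finally have "(c / h) powr (2 * \<alpha>) \<le> sqrt (A * real n)" by (rule real_le_rsqrt)
      then have "c powr (2 * \<alpha>) / h powr (2 * \<alpha>) \<le> sqrt A * sqrt (real n)"
        using c h by (simp add: powr_divide real_sqrt_mult)
      then have "c powr (2 * \<alpha>) / h powr (2 * \<alpha>) * h powr (2 * \<alpha> - 1) \<le> sqrt A * sqrt (real n) * H powr (2 * \<alpha> - 1)"
        using h \<alpha> A by (intro mult_mono powr_mono2) auto
      also have "c powr (2 * \<alpha>) / h powr (2 * \<alpha>) * h powr (2 * \<alpha> - 1) = c powr (2 * \<alpha>) * (1 / h)"
        using h by (simp add: powr_diff)
      finally show ?thesis using c by (simp add: C2_def field_simps)
    qed
    have "ennreal (1 / ((real n)\<^sup>2 * sqrt (real n))) * (trunc_moment (3 * \<alpha>) (c / h))\<^sup>2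
        \<le> ennreal (1 / ((real n)\<^sup>2 * sqrt (real n))) * (ennreal (C1 * h powr (- (3 * \<alpha>) - 1)))\<^sup>2"
      using C1(2)[OF adm] by (intro mult_left_mono power_mono) auto
    also have "\<dots> = ennreal (1 / ((real n)\<^sup>2 * sqrt (real n)) * (C1 * h powr (- (3 * \<alpha>) - 1))\<^sup>2)"
      using C1(1) by (simp add: ennreal_power ennreal_mult'[symmetric] less_imp_le del: ennreal_mult')
    also have "\<dots> \<le> ennreal (C * p_rate \<alpha> \<beta> k n h)"
    proof (intro ennreal_leI)
      have sq: "(h powr (- (3 * \<alpha>) - 1))\<^sup>2 = h powr (- 6 * \<alpha> - 1) * (1 / h)"
      proof -
        have "(h powr (- (3 * \<alpha>) - 1))\<^sup>2 = h powr (- 6 * \<alpha> - 1 + - 1)"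
          unfolding power2_eq_square powr_add[symmetric] by (rule arg_cong[of _ _ "(powr) h"]) simp
        also have "\<dots> = h powr (- 6 * \<alpha> - 1) * h powr - 1" by (rule powr_add)
        finally show ?thesis using h by (simp add: powr_minus_divide)
      qed
      have "1 / ((real n)\<^sup>2 * sqrt (real n)) * (C1 * h powr (- (3 * \<alpha>) - 1))\<^sup>2
          = C1\<^sup>2 * (1 / ((real n)\<^sup>2 * sqrt (real n)) * h powr (- 6 * \<alpha> - 1)) * (1 / h)"
        by (simp add: power_mult_distrib sq)
      also have "\<dots> \<le> C1\<^sup>2 * (1 / ((real n)\<^sup>2 * sqrt (real n)) * h powr (- 6 * \<alpha> - 1)) * (C2 * sqrt (real n))"
        using key by (intro mult_left_mono) auto
      also have "\<dots> = C * (1 / (real n)\<^sup>2 * h powr (- 6 * \<alpha> - 1))"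
        using h by (simp add: C_def)
      also have "\<dots> \<le> C * p_rate \<alpha> \<beta> k n h"
        using ge(4) A by (intro mult_left_mono) (auto simp: C_def C2_def)
      finally show "1 / ((real n)\<^sup>2 * sqrt (real n)) * (C1 * h powr (- (3 * \<alpha>) - 1))\<^sup>2
          \<le> C * p_rate \<alpha> \<beta> k n h" .
    qed
    finally show ?thesis .
  qed
  moreover have "C > 0" unfolding C_def C2_def using C1 A H c by simp
  ultimately show ?thesis by blast
qed

lemma risk_bound_le_p_rate:
  "\<exists>C>0. \<forall>n h. admissible n h \<longrightarrow> risk_bound \<alpha> \<beta> n (c / h) \<le> ennreal (C * p_rate \<alpha> \<beta> k n h)"
proof -
  let ?p = "\<lambda>n h. p_rate \<alpha> \<beta> k n h"
  obtain C1 where C1: "C1 > 0" "\<And>n h. admissible n h \<Longrightarrow>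
      ennreal (1 / real n) * trunc_moment (4 * \<alpha> - 2 * \<beta>) (c / h) \<le> ennreal (C1 * ?p n h)"
    using linear_term_rate by blast
  obtain C2 where C2: "C2 > 0" "\<And>n h. admissible n h \<Longrightarrow>
      ennreal (1 / (real n)\<^sup>2) * (trunc_moment (4 * \<alpha> - \<beta>) (c / h))\<^sup>2 \<le> ennreal (C2 * ?p n h)"
    using quadratic_term_rate by blast
  obtain C4 where C4: "C4 > 0" "\<And>n h. admissible n h \<Longrightarrow>
      ennreal (1 / (real n)\<^sup>2) * trunc_moment (6 * \<alpha>) (c / h) \<le> ennreal (C4 * ?p n h)"
    using smooth_noise_term_rate by blast
  obtain C5 where C5: "C5 > 0" "\<And>n h. admissible n h \<Longrightarrow>
      ennreal (1 / ((real n)\<^sup>2 * sqrt (real n))) * (trunc_moment (3 * \<alpha>) (c / h))\<^sup>2 \<le> ennreal (C5 * ?p n h)"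
    using fluctuation_noise_term_rate by blast
  have p0: "0 \<le> ?p n h" if "admissible n h" for n h
    by (rule order_trans[OF _ p_rate_ge(2)[OF that]]) simp
  obtain C3 where C3: "C3 > 0" "\<And>n h. admissible n h \<Longrightarrow>
      noise_rate \<alpha> \<beta> n (c / h) \<le> ennreal (C3 * ?p n h)"
  proof (cases "\<beta> \<le> \<alpha>")
    case True
    with rough_noise_term_rate[OF True, of k] that show thesis by (auto simp: noise_rate_def)
  next
    case False
    have "ennreal (1 / (real n)\<^sup>2) * trunc_moment (6 * \<alpha>) (c / h)
         + ennreal (1 / ((real n)\<^sup>2 * sqrt (real n))) * (trunc_moment (3 * \<alpha>) (c / h))\<^sup>2
      \<le> ennreal ((C4 + C5) * ?p n h)" if adm: "admissible n h" for n h
      using add_mono[OF C4(2)[OF adm] C5(2)[OF adm]] C4(1) C5(1) p0[OF adm]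
      by (simp add: distrib_right ennreal_plus)
    then show thesis using False C4(1) C5(1) by (intro that[of "C4 + C5"]) (auto simp: noise_rate_def)
  qed
  have "risk_bound \<alpha> \<beta> n (c / h) \<le> ennreal ((C1 + C2 + C3) * ?p n h)" if adm: "admissible n h" for n h
  proof -
    have "risk_bound \<alpha> \<beta> n (c / h) \<le> ennreal (C1 * ?p n h) + ennreal (C2 * ?p n h) + ennreal (C3 * ?p n h)"
      unfolding risk_bound_def using C1(2)[OF adm] C2(2)[OF adm] C3(2)[OF adm] by (intro add_mono)
    also have "\<dots> = ennreal ((C1 + C2 + C3) * ?p n h)"
      using C1(1) C2(1) C3(1) p0[OF adm] by (simp add: distrib_right ennreal_plus)
    finally show ?thesis .
  qed
  moreover have "C1 + C2 + C3 > 0" using C1(1) C2(1) C3(1) by simp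
  ultimately show ?thesis by blast
qed

end

section \<open>The replicated sample\<close>

lemma finite_pair_set[simp]: "finite (pair_set m)"
  by (rule finite_subset[of _ "{1..m} \<times> {1..m}"]) (auto simp: pair_set_def)

lemma card_pair_set_le: "card (pair_set m) \<le> m * m"
proof -
  have "card (pair_set m) \<le> card ({1..m} \<times> {1..m})"
    by (rule card_mono) (auto simp: pair_set_def)
  then show ?thesis by simp
qed

lemma card_pair_set: "real (card (pair_set m)) = real m * (real m - 1) / 2"
proof (induction m)
  case 0
  have "pair_set 0 = {}" by (auto simp: pair_set_def)
  then show ?case by simp
next
  case (Suc m)
  have "pair_set (Suc m) = pair_set m \<union> (\<lambda>k. (k, Suc m)) ` {1..m}"
    by (auto simp: pair_set_def le_Suc_eq)
  moreover have "card ((\<lambda>k. (k, Suc m)) ` {1..m}) = m"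
    by (subst card_image) (auto simp: inj_on_def)
  moreover have "pair_set m \<inter> (\<lambda>k. (k, Suc m)) ` {1..m} = {}"
    by (auto simp: pair_set_def)
  ultimately have "card (pair_set (Suc m)) = card (pair_set m) + m"
    by (simp add: card_Un_disjoint)
  then show ?case using Suc by (simp add: field_simps)
qed

locale replicated_setting =
  fixes P :: "'a measure" and X :: "nat \<Rightarrow> 'a \<Rightarrow> real" and U :: "nat \<Rightarrow> nat \<Rightarrow> 'a \<Rightarrow> real"
    and n :: nat and N :: "nat \<Rightarrow> nat" and fX fU :: "real \<Rightarrow> real" and C\<^sub>1 :: real
  assumes sample: "replicated_sample P n N fX fU X U"
    and fX: "prob_density fX" and fU: "prob_density fU"
    and fU_real: "\<forall>t. fourier fU t \<in> \<real> \<and> fourier fU t \<noteq> 0"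
    and n: "n \<ge> 1" and C\<^sub>1: "C\<^sub>1 > 1"
    and N: "\<forall>j\<ge>1. 1 \<le> N j \<and> real (N j) \<le> C\<^sub>1"
    and pairs: "num_pairs n N \<ge> real n / C\<^sub>1"

sublocale replicated_setting \<subseteq> prob_space P
  using sample by (simp add: replicated_sample_def)

context replicated_setting
begin

definition \<phi> :: "real \<Rightarrow> real" where "\<phi> t = Re (fourier fU t)"

abbreviation J :: "(nat \<times> nat) set" where "J \<equiv> (SIGMA j:{1..n}. {1..N j})"

abbreviation MX :: "(nat \<Rightarrow> real) measure" where "MX \<equiv> Pi\<^sub>M {1..n} (\<lambda>_. borel)"

abbreviation MU :: "(nat \<times> nat \<Rightarrow> real) measure" where "MU \<equiv> Pi\<^sub>M J (\<lambda>_. borel)"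

text \<open>Each family is packed into a single random element of a product space, restricted to its
  index set as that space requires, so that total independence can be used as independence of two
  variables.\<close>

definition xv :: "'a \<Rightarrow> nat \<Rightarrow> real" where "xv \<omega> = (\<lambda>j\<in>{1..n}. X j \<omega>)"

definition uv :: "'a \<Rightarrow> nat \<times> nat \<Rightarrow> real" where "uv \<omega> = (\<lambda>p\<in>J. U (fst p) (snd p) \<omega>)"

lemma fourier_fU: "fourier fU t = complex_of_real (\<phi> t)"
  using fU_real by (simp add: \<phi>_def)

lemma \<phi>_pos: "\<phi> t > 0"
  unfolding \<phi>_def using fourier_density_real_pos[OF fU fU_real] .

lemma \<phi>_le_1: "\<phi> t \<le> 1"
  using fourier_density_le_1[OF fU, of t] \<phi>_pos[of t] by (simp add: fourier_fU)

lemma \<phi>_uminus: "\<phi> (- t) = \<phi> t"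
  by (simp add: \<phi>_def fourier_uminus)

lemma fX_measurable[measurable]: "fX \<in> borel_measurable borel"
  and fU_measurable[measurable]: "fU \<in> borel_measurable borel"
  using fX fU borel_measurable_integrable by (auto simp: prob_density_def)

lemma \<phi>_measurable[measurable]: "\<phi> \<in> borel_measurable borel"
proof -
  have "(\<lambda>t. Re (fourier fU t)) \<in> borel_measurable borel" by measurable
  then show ?thesis by (simp add: \<phi>_def[abs_def])
qed

lemma N_bounds: "j \<in> {1..n} \<Longrightarrow> 1 \<le> N j" "j \<in> {1..n} \<Longrightarrow> real (N j) \<le> C\<^sub>1"
  using N by auto

lemma total_obs_bounds: "real n \<le> total_obs n N"
proof -
  have "(\<Sum>j=1..n. 1) \<le> (\<Sum>j=1..n. real (N j))"
    using N_bounds by (intro sum_mono) auto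
  then show ?thesis by (simp add: total_obs_def)
qed

lemma total_obs_pos: "total_obs n N > 0"
  using total_obs_bounds n by simp

lemma total_obs_card: "total_obs n N = real (card J)"
  by (simp add: total_obs_def)

lemma num_pairs_pos: "num_pairs n N > 0"
  using pairs n C\<^sub>1 by (smt (verit) divide_pos_pos of_nat_0_less_iff less_le_trans zero_less_one)

lemma num_pairs_card: "num_pairs n N = (\<Sum>j=1..n. real (card (pair_set (N j))))"
  unfolding num_pairs_def card_pair_set by (simp add: sum_divide_distrib)

lemma card_pair_set_bound: "j \<in> {1..n} \<Longrightarrow> real (card (pair_set (N j))) \<le> C\<^sub>1\<^sup>2"
proof -
  assume j: "j \<in> {1..n}"
  have "real (card (pair_set (N j))) \<le> real (N j * N j)"
    using card_pair_set_le of_nat_le_iff by blast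
  also have "\<dots> \<le> C\<^sub>1 * C\<^sub>1"
    using N_bounds[OF j] by (simp add: mult_mono)
  finally show ?thesis by (simp add: power2_eq_square)
qed

section \<open>Characteristic functions and independence within the sample\<close>

lemma expectation_iexp_density:
  assumes V: "distributed P lborel V (\<lambda>x. ennreal (f x))" and f: "prob_density f"
  shows "expectation (\<lambda>\<omega>. iexp (t * V \<omega>)) = fourier f t"
proof -
  have [measurable]: "f \<in> borel_measurable borel" and nn: "\<And>x. 0 \<le> f x"
    using f borel_measurable_integrable by (auto simp: prob_density_def)
  have d: "distr P lborel V = density lborel (\<lambda>x. ennreal (f x))" and V_meas: "V \<in> measurable P lborel"
    using V unfolding distributed_def by blast+
  have "expectation (\<lambda>\<omega>. iexp (t * V \<omega>)) = (CLINT x|distr P lborel V. iexp (t * x))"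
    by (subst integral_distr[OF V_meas]) auto
  also have "\<dots> = fourier f t"
    unfolding d fourier_def using nn
    by (subst integral_density) (auto simp: scaleR_conv_of_real mult.commute)
  finally show ?thesis .
qed

lemma X_measurable: "j \<in> {1..n} \<Longrightarrow> X j \<in> borel_measurable P"
  using sample by (auto simp: replicated_sample_def distributed_def)

lemma U_measurable: "(j, k) \<in> J \<Longrightarrow> U j k \<in> borel_measurable P"
  using sample by (auto simp: replicated_sample_def distributed_def)

lemma xv_measurable[measurable]: "xv \<in> measurable P MX"
  unfolding xv_def by (intro measurable_restrict X_measurable)

lemma uv_measurable[measurable]: "uv \<in> measurable P MU"
  unfolding uv_def by (intro measurable_restrict U_measurable) auto

lemma char_X: "j \<in> {1..n} \<Longrightarrow> expectation (\<lambda>\<omega>. iexp (t * X j \<omega>)) = fourier fX t"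
  using sample by (intro expectation_iexp_density fX) (auto simp: replicated_sample_def)

lemma char_U: "(j, k) \<in> J \<Longrightarrow> expectation (\<lambda>\<omega>. iexp (t * U j k \<omega>)) = complex_of_real (\<phi> t)"
  unfolding fourier_fU[symmetric]
  using sample by (intro expectation_iexp_density fU) (auto simp: replicated_sample_def)

lemma indep_all: "indep_vars (\<lambda>_. borel) (case_sum X (\<lambda>(j, k). U j k)) ({1..n} <+> J)"
  using sample by (simp add: replicated_sample_def)

text \<open>One-element blocks on the left side of the sum type re-index the joint family; the
  coordinate is then read off.\<close>

lemma indep_X: "indep_vars (\<lambda>_. borel) X {1..n}"
proof -
  have "indep_vars (\<lambda>j. Pi\<^sub>M {Inl j} (\<lambda>_. borel))
      (\<lambda>j \<omega>. \<lambda>i\<in>{Inl j}. case_sum X (\<lambda>(j, k). U j k) i \<omega>) {1..n}"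
    by (rule indep_vars_restrict[OF indep_all]) (auto simp: disjoint_family_on_def)
  from indep_vars_compose2[OF this, of "\<lambda>j v. v (Inl j)" "\<lambda>_. borel"] show ?thesis
    by simp
qed

lemma indep_U: "indep_vars (\<lambda>_. borel) (\<lambda>p. U (fst p) (snd p)) J"
proof -
  have "indep_vars (\<lambda>p. Pi\<^sub>M {Inr p} (\<lambda>_. borel))
      (\<lambda>p \<omega>. \<lambda>i\<in>{Inr p}. case_sum X (\<lambda>(j, k). U j k) i \<omega>) J"
    by (rule indep_vars_restrict[OF indep_all]) (auto simp: disjoint_family_on_def)
  from indep_vars_compose2[OF this, of "\<lambda>p v. v (Inr p)" "\<lambda>_. borel"] show ?thesis
    by (simp add: case_prod_beta)
qed

text \<open>Two pairs of the same individual may share an error and are then dependent, but the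
  groups of errors of different individuals are disjoint. Sums over pairs are therefore organised by
  individual, with at most C_1^2 terms in a group.\<close>

lemma indep_groups:
  assumes "\<And>j. j \<in> {1..n} \<Longrightarrow> g j \<in> borel_measurable (Pi\<^sub>M ({j} \<times> {1..N j}) (\<lambda>_. borel))"
  shows "indep_vars (\<lambda>_. borel) (\<lambda>j \<omega>. g j (\<lambda>p\<in>{j} \<times> {1..N j}. U (fst p) (snd p) \<omega>) :: real) {1..n}"
proof -
  have "indep_vars (\<lambda>j. Pi\<^sub>M ({j} \<times> {1..N j}) (\<lambda>_. borel))
      (\<lambda>j \<omega>. \<lambda>p\<in>{j} \<times> {1..N j}. U (fst p) (snd p) \<omega>) {1..n}"
    by (rule indep_vars_restrict[OF indep_U]) (auto simp: disjoint_family_on_def)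
  from indep_vars_compose2[OF this assms] show ?thesis .
qed

text \<open>The conditioning on the errors: with \<open>uv\<close> frozen at the outer sample point,
  the inner integral runs over the \<open>X j\<close> alone.\<close>

lemma nn_integral_xv_uv:
  assumes F[measurable]: "F \<in> borel_measurable (MX \<Otimes>\<^sub>M MU)"
  shows "(\<integral>\<^sup>+\<omega>. F (xv \<omega>, uv \<omega>) \<partial>P) = (\<integral>\<^sup>+\<omega>'. \<integral>\<^sup>+\<omega>. F (xv \<omega>, uv \<omega>') \<partial>P \<partial>P)"
proof -
  let ?W = "case_sum X (\<lambda>(j, k). U j k)"
  let ?A = "Pi\<^sub>M (Inl ` {1..n}) (\<lambda>_. borel) :: (nat + nat \<times> nat \<Rightarrow> real) measure"
  let ?B = "Pi\<^sub>M (Inr ` J) (\<lambda>_. borel) :: (nat + nat \<times> nat \<Rightarrow> real) measure"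
  let ?a = "\<lambda>\<omega>. \<lambda>i\<in>Inl ` {1..n}. ?W i \<omega>" and ?b = "\<lambda>\<omega>. \<lambda>i\<in>Inr ` J. ?W i \<omega>"
  define p where "p v = (\<lambda>j\<in>{1..n}. v (Inl j))" for v :: "nat + nat \<times> nat \<Rightarrow> real"
  define q where "q v = (\<lambda>i\<in>J. v (Inr i))" for v :: "nat + nat \<times> nat \<Rightarrow> real"
  have [measurable]: "p \<in> measurable ?A MX"
    unfolding p_def by (intro measurable_restrict measurable_component_singleton) auto
  have [measurable]: "q \<in> measurable ?B MU"
    unfolding q_def by (intro measurable_restrict measurable_component_singleton) auto
  have xv: "xv \<omega> = p (?a \<omega>)" for \<omega>
    by (auto simp: xv_def p_def fun_eq_iff restrict_def)
  have uv: "uv \<omega> = q (?b \<omega>)" for \<omega>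
    by (auto simp: uv_def q_def fun_eq_iff restrict_def case_prod_beta)
  have ind: "indep_var ?A ?a ?B ?b"
    by (rule indep_var_restrict[OF indep_all]) auto
  have meas: "(\<lambda>z. F (p (fst z), q (snd z))) \<in> borel_measurable (?A \<Otimes>\<^sub>M ?B)" by measurable
  from indep_var_nn_integral[OF ind meas] show ?thesis unfolding xv uv by (simp only: fst_conv snd_conv)
qed

text \<open>The second error enters with frequency \<open>- t\<close>, and \<open>\<phi>\<close> is
  even. This is why averaged cosines of differences estimate the square of
  \<open>\<phi>\<close>.\<close>

lemma char_U_diff:
  assumes jk: "j \<in> {1..n}" "(k, l) \<in> pair_set (N j)"
  shows "expectation (\<lambda>\<omega>. iexp (t * (U j k \<omega> - U j l \<omega>))) = complex_of_real ((\<phi> t)\<^sup>2)"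
proof -
  have J: "(j, k) \<in> J" "(j, l) \<in> J" "(j, k) \<noteq> (j, l)" using jk by (auto simp: pair_set_def)
  define s where "s p = (if p = (j, k) then t else - t)" for p :: "nat \<times> nat"
  have "indep_vars (\<lambda>_. borel) (\<lambda>p. U (fst p) (snd p)) {(j, k), (j, l)}"
    by (rule indep_vars_subset[OF indep_U]) (use J in auto)
  then have ind: "indep_vars (\<lambda>_. borel) (\<lambda>p \<omega>. iexp (s p * U (fst p) (snd p) \<omega>)) {(j, k), (j, l)}"
    by (rule indep_vars_compose2[where Y = "\<lambda>p x. iexp (s p * x)"]) auto
  have int: "integrable P (\<lambda>\<omega>. iexp (s p * U (fst p) (snd p) \<omega>))" if "p \<in> {(j, k), (j, l)}" for p
  proof (rule integrable_bounded[where B = 1])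
    have [measurable]: "U (fst p) (snd p) \<in> borel_measurable P" using that J by (auto intro: U_measurable)
    show "(\<lambda>\<omega>. iexp (s p * U (fst p) (snd p) \<omega>)) \<in> borel_measurable P" by measurable
  qed simp
  have "expectation (\<lambda>\<omega>. \<Prod>p\<in>{(j, k), (j, l)}. iexp (s p * U (fst p) (snd p) \<omega>))
      = (\<Prod>p\<in>{(j, k), (j, l)}. expectation (\<lambda>\<omega>. iexp (s p * U (fst p) (snd p) \<omega>)))"
    by (rule indep_vars_lebesgue_integral[OF _ ind int]) auto
  also have "\<dots> = complex_of_real (\<phi> t) * complex_of_real (\<phi> t)"
    using J(3) char_U[OF J(1), of t] char_U[OF J(2), of "- t"] by (simp add: s_def \<phi>_uminus)
  also have "(\<lambda>\<omega>. \<Prod>p\<in>{(j, k), (j, l)}. iexp (s p * U (fst p) (snd p) \<omega>))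
      = (\<lambda>\<omega>. iexp (t * (U j k \<omega> - U j l \<omega>)))"
    using J(3) by (simp add: s_def exp_add[symmetric] algebra_simps)
  finally show ?thesis by (simp add: power2_eq_square)
qed

lemma expectation_cos_diff:
  assumes jk: "j \<in> {1..n}" "(k, l) \<in> pair_set (N j)"
  shows "expectation (\<lambda>\<omega>. cos (t * (U j k \<omega> - U j l \<omega>))) = (\<phi> t)\<^sup>2"
proof -
  have J: "(j, k) \<in> J" "(j, l) \<in> J" using jk by (auto simp: pair_set_def)
  note [measurable] = U_measurable[OF J(1)] U_measurable[OF J(2)]
  have "integrable P (\<lambda>\<omega>. iexp (t * (U j k \<omega> - U j l \<omega>)))"
    by (rule integrable_bounded[where B = 1]) auto
  from integral_Re[OF this] show ?thesis
    using char_U_diff[OF jk, of t] by (simp add: Re_exp)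
qed

lemma expectation_cos_sin:
  assumes p: "(j, k) \<in> J"
  shows "expectation (\<lambda>\<omega>. cos (t * U j k \<omega>)) = \<phi> t" "expectation (\<lambda>\<omega>. sin (t * U j k \<omega>)) = 0"
proof -
  note [measurable] = U_measurable[OF p]
  have int: "integrable P (\<lambda>\<omega>. iexp (t * U j k \<omega>))"
    by (rule integrable_bounded[where B = 1]) auto
  show "expectation (\<lambda>\<omega>. cos (t * U j k \<omega>)) = \<phi> t"
    using integral_Re[OF int] char_U[OF p, of t] by (simp add: Re_exp)
  show "expectation (\<lambda>\<omega>. sin (t * U j k \<omega>)) = 0"
    using integral_Im[OF int] char_U[OF p, of t] by (simp add: Im_exp)
qed

section \<open>Empirical transforms of the errors and their moments\<close>

definition \<psi>_hat :: "(nat \<times> nat \<Rightarrow> real) \<Rightarrow> real \<Rightarrow> real" where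
  "\<psi>_hat v t = 1 / num_pairs n N *
    (\<Sum>j=1..n. \<Sum>p\<in>pair_set (N j). cos (t * (v (j, fst p) - v (j, snd p))))"

definition D :: "(nat \<times> nat \<Rightarrow> real) \<Rightarrow> real \<Rightarrow> real" where
  "D v t = \<psi>_hat v t - (\<phi> t)\<^sup>2"

text \<open>The empirical characteristic function of the unobserved errors; it appears when the
  \<open>X j\<close> are averaged out with the errors held fixed.\<close>

definition \<phi>_tilde :: "(nat \<times> nat \<Rightarrow> real) \<Rightarrow> real \<Rightarrow> complex" where
  "\<phi>_tilde v t = 1 / total_obs n N * (\<Sum>p\<in>J. iexp (t * v p))"

lemma component_measurable: "p \<in> J \<Longrightarrow> (\<lambda>v. v p) \<in> borel_measurable MU"
  by (rule measurable_component_singleton)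

lemma \<psi>_hat_measurable[measurable]: "(\<lambda>(v, t). \<psi>_hat v t) \<in> borel_measurable (MU \<Otimes>\<^sub>M borel)"
proof -
  have "(\<lambda>z. cos (snd z * (fst z (j, fst p) - fst z (j, snd p)))) \<in> borel_measurable (MU \<Otimes>\<^sub>M borel)"
    if "j \<in> {1..n}" "p \<in> pair_set (N j)" for j p
  proof -
    have "(j, fst p) \<in> J" "(j, snd p) \<in> J" using that by (auto simp: pair_set_def)
    then have [measurable]: "(\<lambda>v. v (j, fst p)) \<in> borel_measurable MU" "(\<lambda>v. v (j, snd p)) \<in> borel_measurable MU"
      by (simp_all only: component_measurable)
    show ?thesis by measurable
  qed
  then show ?thesis
    unfolding \<psi>_hat_def case_prod_beta
    by (intro borel_measurable_times borel_measurable_const borel_measurable_sum)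
qed

lemma D_measurable[measurable]: "(\<lambda>(v, t). D v t) \<in> borel_measurable (MU \<Otimes>\<^sub>M borel)"
  unfolding D_def by measurable

lemma \<phi>_tilde_measurable[measurable]: "(\<lambda>(v, t). \<phi>_tilde v t) \<in> borel_measurable (MU \<Otimes>\<^sub>M borel)"
proof -
  have "(\<lambda>z. iexp (snd z * fst z p)) \<in> borel_measurable (MU \<Otimes>\<^sub>M borel)" if "p \<in> J" for p
  proof -
    have [measurable]: "(\<lambda>v. v p) \<in> borel_measurable MU" by (rule component_measurable[OF that])
    show ?thesis by measurable
  qed
  then show ?thesis
    unfolding \<phi>_tilde_def case_prod_beta
    by (intro borel_measurable_times borel_measurable_const borel_measurable_sum)
qed

lemma \<phi>_tilde_le_1: "cmod (\<phi>_tilde v t) \<le> 1"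
proof -
  have "cmod (\<Sum>p\<in>J. iexp (t * v p)) \<le> (\<Sum>p\<in>J. cmod (iexp (t * v p)))" by (rule norm_sum)
  also have "\<dots> = total_obs n N" by (simp add: total_obs_card)
  finally show ?thesis
    unfolding \<phi>_tilde_def using total_obs_pos by (simp add: norm_mult norm_divide)
qed

lemma abs_\<psi>_hat_le_1: "\<bar>\<psi>_hat v t\<bar> \<le> 1"
proof -
  have "\<bar>\<Sum>j=1..n. \<Sum>p\<in>pair_set (N j). cos (t * (v (j, fst p) - v (j, snd p)))\<bar>
      \<le> (\<Sum>j=1..n. \<Sum>p\<in>pair_set (N j). 1)"
    by (intro order_trans[OF sum_abs] sum_mono) auto
  also have "\<dots> = num_pairs n N" by (simp add: num_pairs_card)
  finally show ?thesis
    unfolding \<psi>_hat_def using num_pairs_pos by (simp add: abs_mult)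
qed

lemma uv_apply: "p \<in> J \<Longrightarrow> uv \<omega> p = U (fst p) (snd p) \<omega>"
  by (simp only: uv_def restrict_apply')

lemma D_uv:
  "D (uv \<omega>) t = 1 / num_pairs n N *
    (\<Sum>j=1..n. \<Sum>p\<in>pair_set (N j). cos (t * (U j (fst p) \<omega> - U j (snd p) \<omega>)) - (\<phi> t)\<^sup>2)"
proof -
  have "(\<Sum>j=1..n. \<Sum>p\<in>pair_set (N j). cos (t * (uv \<omega> (j, fst p) - uv \<omega> (j, snd p))))
      = (\<Sum>j=1..n. \<Sum>p\<in>pair_set (N j). cos (t * (U j (fst p) \<omega> - U j (snd p) \<omega>)))"
  proof (intro sum.cong refl)
    fix j p assume "j \<in> {1..n}" "p \<in> pair_set (N j)"
    then have "(j, fst p) \<in> J" "(j, snd p) \<in> J" by (auto simp: pair_set_def)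
    then show "cos (t * (uv \<omega> (j, fst p) - uv \<omega> (j, snd p))) = cos (t * (U j (fst p) \<omega> - U j (snd p) \<omega>))"
      by (simp only: uv_apply fst_conv snd_conv)
  qed
  moreover have "(\<Sum>j=1..n. \<Sum>p\<in>pair_set (N j). (\<phi> t)\<^sup>2) = num_pairs n N * (\<phi> t)\<^sup>2"
    by (simp add: num_pairs_card sum_distrib_right)
  ultimately show ?thesis
    unfolding D_def \<psi>_hat_def using num_pairs_pos
    by (simp add: sum_subtractf right_diff_distrib)
qed

text \<open>Each individual contributes a centred sum bounded by
  \<open>2 * C\<^sub>1\<^sup>2\<close>, to which the moment bound for independent sums applies;
  replacing division by the number of pairs with division by \<open>n\<close> costs a factor at most
  \<open>C\<^sub>1\<close>, by the lower bound on the number of pairs.\<close>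

lemma D_moment:
  "(\<integral>\<^sup>+\<omega>. ennreal ((\<bar>D (uv \<omega>) t\<bar> * sqrt (real n)) ^ (2 * m)) \<partial>P)
    \<le> ennreal (C\<^sub>1 ^ (2 * m) * (2 * fact (2 * m) * exp ((2 * C\<^sub>1\<^sup>2)\<^sup>2 / 2)))"
proof -
  define g where "g j v = (\<Sum>p\<in>pair_set (N j). cos (t * (v (j, fst p) - v (j, snd p))) - (\<phi> t)\<^sup>2)"
    for j and v :: "nat \<times> nat \<Rightarrow> real"
  define Y where "Y j \<omega> = (\<Sum>p\<in>pair_set (N j). cos (t * (U j (fst p) \<omega> - U j (snd p) \<omega>)) - (\<phi> t)\<^sup>2)" for j \<omega>
  have gY: "g j (\<lambda>p\<in>{j} \<times> {1..N j}. U (fst p) (snd p) \<omega>) = Y j \<omega>" for j \<omega>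
    unfolding g_def Y_def by (intro sum.cong refl) (auto simp: pair_set_def)
  have "g j \<in> borel_measurable (Pi\<^sub>M ({j} \<times> {1..N j}) (\<lambda>_. borel))" if "j \<in> {1..n}" for j
    unfolding g_def
  proof (intro borel_measurable_sum)
    fix p assume "p \<in> pair_set (N j)"
    then have [measurable]: "(\<lambda>v. v (j, fst p)) \<in> borel_measurable (Pi\<^sub>M ({j} \<times> {1..N j}) (\<lambda>_. borel))"
      "(\<lambda>v. v (j, snd p)) \<in> borel_measurable (Pi\<^sub>M ({j} \<times> {1..N j}) (\<lambda>_. borel))"
      by (auto intro!: measurable_component_singleton simp: pair_set_def)
    show "(\<lambda>v. cos (t * (v (j, fst p) - v (j, snd p))) - (\<phi> t)\<^sup>2)
        \<in> borel_measurable (Pi\<^sub>M ({j} \<times> {1..N j}) (\<lambda>_. borel))" by measurable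
  qed
  from indep_groups[OF this] have ind: "indep_vars (\<lambda>_. borel) Y {1..n}"
    unfolding gY by (simp add: Y_def[abs_def])
  have bounded: "\<bar>Y j \<omega>\<bar> \<le> 2 * C\<^sub>1\<^sup>2" if "j \<in> {1..n}" for j \<omega>
  proof -
    have 1: "\<bar>cos x - (\<phi> t)\<^sup>2\<bar> \<le> 2" for x
    proof -
      have "(\<phi> t)\<^sup>2 \<le> 1" using \<phi>_pos[of t] \<phi>_le_1[of t] by (simp add: power_le_one)
      moreover have "0 \<le> (\<phi> t)\<^sup>2" by simp
      ultimately show ?thesis using cos_le_one[of x] cos_ge_minus_one[of x] by linarith
    qed
    have "\<bar>Y j \<omega>\<bar> \<le> (\<Sum>p\<in>pair_set (N j). 2)"
      unfolding Y_def by (intro order_trans[OF sum_abs] sum_mono 1)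
    also have "\<dots> \<le> 2 * C\<^sub>1\<^sup>2" using card_pair_set_bound[OF that] by simp
    finally show ?thesis .
  qed
  have mean: "expectation (Y j) = 0" if j: "j \<in> {1..n}" for j
  proof -
    have int: "integrable P (\<lambda>\<omega>. cos (t * (U j (fst p) \<omega> - U j (snd p) \<omega>)))" if "p \<in> pair_set (N j)" for p
    proof -
      have "(j, fst p) \<in> J" "(j, snd p) \<in> J" using j that by (auto simp: pair_set_def)
      note [measurable] = this[THEN U_measurable]
      show ?thesis by (rule integrable_bounded[where B = 1]) auto
    qed
    have "expectation (Y j) = (\<Sum>p\<in>pair_set (N j). expectation (\<lambda>\<omega>. cos (t * (U j (fst p) \<omega> - U j (snd p) \<omega>)) - (\<phi> t)\<^sup>2))"
      unfolding Y_def by (intro Bochner_Integration.integral_sum Bochner_Integration.integrable_diff int) auto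
    also have "\<dots> = 0"
      using int expectation_cos_diff[OF j] by (intro sum.neutral ballI) (simp add: prob_space)
    finally show ?thesis .
  qed
  have "(\<integral>\<^sup>+\<omega>. ennreal (((\<Sum>j=1..n. Y j \<omega>) / sqrt n) ^ (2 * m)) \<partial>P)
      \<le> ennreal (2 * fact (2 * m) * exp ((2 * C\<^sub>1\<^sup>2)\<^sup>2 / 2))"
    using n by (intro even_moment_indep_sum_le ind bounded mean) auto
  then have le: "ennreal (C\<^sub>1 ^ (2 * m)) * (\<integral>\<^sup>+\<omega>. ennreal (((\<Sum>j=1..n. Y j \<omega>) / sqrt n) ^ (2 * m)) \<partial>P)
      \<le> ennreal (C\<^sub>1 ^ (2 * m)) * ennreal (2 * fact (2 * m) * exp ((2 * C\<^sub>1\<^sup>2)\<^sup>2 / 2))"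
    by (intro mult_left_mono) auto
  have Y_meas[measurable]: "Y j \<in> borel_measurable P" if "j \<in> {1..n}" for j
    using ind that by (auto simp: indep_vars_def)
  have "(\<integral>\<^sup>+\<omega>. ennreal ((\<bar>D (uv \<omega>) t\<bar> * sqrt (real n)) ^ (2 * m)) \<partial>P)
      \<le> (\<integral>\<^sup>+\<omega>. ennreal (C\<^sub>1 ^ (2 * m)) * ennreal (((\<Sum>j=1..n. Y j \<omega>) / sqrt n) ^ (2 * m)) \<partial>P)"
  proof (intro nn_integral_mono)
    fix \<omega>
    let ?S = "\<Sum>j=1..n. Y j \<omega>"
    have np: "real n / num_pairs n N \<le> C\<^sub>1" "0 \<le> real n / num_pairs n N"
      using pairs num_pairs_pos C\<^sub>1 by (simp_all add: field_simps)
    have "\<bar>D (uv \<omega>) t\<bar> * sqrt (real n) = real n / num_pairs n N * (\<bar>?S\<bar> / sqrt n)"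
      unfolding D_uv Y_def[symmetric] using num_pairs_pos n
      by (simp add: abs_mult field_simps)
    also have "\<dots> \<le> C\<^sub>1 * (\<bar>?S\<bar> / sqrt n)" using np by (intro mult_right_mono) auto
    finally have "(\<bar>D (uv \<omega>) t\<bar> * sqrt (real n)) ^ (2 * m) \<le> (C\<^sub>1 * (\<bar>?S\<bar> / sqrt n)) ^ (2 * m)"
      by (intro power_mono) auto
    also have "\<dots> = C\<^sub>1 ^ (2 * m) * (?S / sqrt n) ^ (2 * m)"
      by (simp add: power_mult_distrib power_divide power_even_abs)
    finally show "ennreal ((\<bar>D (uv \<omega>) t\<bar> * sqrt (real n)) ^ (2 * m))
      \<le> ennreal (C\<^sub>1 ^ (2 * m)) * ennreal ((?S / sqrt n) ^ (2 * m))"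
      using C\<^sub>1 by (simp add: ennreal_leI flip: ennreal_mult')
  qed
  also have "\<dots> = ennreal (C\<^sub>1 ^ (2 * m)) * (\<integral>\<^sup>+\<omega>. ennreal (((\<Sum>j=1..n. Y j \<omega>) / sqrt n) ^ (2 * m)) \<partial>P)"
    by (rule nn_integral_cmult) measurable
  also note le
  also have "ennreal (C\<^sub>1 ^ (2 * m)) * ennreal (2 * fact (2 * m) * exp ((2 * C\<^sub>1\<^sup>2)\<^sup>2 / 2))
      = ennreal (C\<^sub>1 ^ (2 * m) * (2 * fact (2 * m) * exp ((2 * C\<^sub>1\<^sup>2)\<^sup>2 / 2)))"
    using C\<^sub>1 by (subst ennreal_mult') auto
  finally show ?thesis .
qed

text \<open>A general bounded \<open>f\<close> serves cosine and sine together, the real and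
  imaginary parts of the empirical characteristic function. Grouping by individual leaves
  \<open>n\<close> summands, matching the normalisation by \<open>sqrt n\<close> although
  \<open>J\<close> may have more elements.\<close>

lemma trig_sum_moment:
  assumes [measurable]: "f \<in> borel_measurable borel" and f: "\<And>x. \<bar>f x\<bar> \<le> 1"
    and \<mu>: "\<bar>\<mu>\<bar> \<le> 1" "\<And>p. p \<in> J \<Longrightarrow> expectation (\<lambda>\<omega>. f (t * U (fst p) (snd p) \<omega>)) = \<mu>"
  shows "(\<integral>\<^sup>+\<omega>. ennreal (((\<Sum>p\<in>J. f (t * U (fst p) (snd p) \<omega>) - \<mu>) / sqrt n) ^ (2 * m)) \<partial>P)
    \<le> ennreal (2 * fact (2 * m) * exp ((2 * C\<^sub>1)\<^sup>2 / 2))"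
proof -
  define g where "g j v = (\<Sum>k=1..N j. f (t * v (j, k)) - \<mu>)" for j and v :: "nat \<times> nat \<Rightarrow> real"
  define Y where "Y j \<omega> = (\<Sum>k=1..N j. f (t * U j k \<omega>) - \<mu>)" for j \<omega>
  have gY: "g j (\<lambda>p\<in>{j} \<times> {1..N j}. U (fst p) (snd p) \<omega>) = Y j \<omega>" for j \<omega>
    unfolding g_def Y_def by (intro sum.cong refl) auto
  have "g j \<in> borel_measurable (Pi\<^sub>M ({j} \<times> {1..N j}) (\<lambda>_. borel))" if "j \<in> {1..n}" for j
    unfolding g_def
  proof (intro borel_measurable_sum)
    fix k assume "k \<in> {1..N j}"
    then have [measurable]: "(\<lambda>v. v (j, k)) \<in> borel_measurable (Pi\<^sub>M ({j} \<times> {1..N j}) (\<lambda>_. borel))"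
      by (auto intro!: measurable_component_singleton)
    show "(\<lambda>v. f (t * v (j, k)) - \<mu>) \<in> borel_measurable (Pi\<^sub>M ({j} \<times> {1..N j}) (\<lambda>_. borel))"
      by measurable
  qed
  from indep_groups[OF this] have ind: "indep_vars (\<lambda>_. borel) Y {1..n}"
    unfolding gY by (simp add: Y_def[abs_def])
  have bounded: "\<bar>Y j \<omega>\<bar> \<le> 2 * C\<^sub>1" if "j \<in> {1..n}" for j \<omega>
  proof -
    have "\<bar>f x - \<mu>\<bar> \<le> 2" for x using f[of x] \<mu>(1) by linarith
    then have "\<bar>Y j \<omega>\<bar> \<le> (\<Sum>k=1..N j. 2)"
      unfolding Y_def by (intro order_trans[OF sum_abs] sum_mono)
    also have "\<dots> \<le> 2 * C\<^sub>1" using N_bounds(2)[OF that] by simp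
    finally show ?thesis .
  qed
  have mean: "expectation (Y j) = 0" if j: "j \<in> {1..n}" for j
  proof -
    have int: "integrable P (\<lambda>\<omega>. f (t * U j k \<omega>))" if "k \<in> {1..N j}" for k
    proof -
      have "(j, k) \<in> J" using j that by auto
      note [measurable] = this[THEN U_measurable]
      show ?thesis using f by (intro integrable_bounded[where B = 1]) auto
    qed
    have "expectation (Y j) = (\<Sum>k=1..N j. expectation (\<lambda>\<omega>. f (t * U j k \<omega>) - \<mu>))"
      unfolding Y_def by (intro Bochner_Integration.integral_sum Bochner_Integration.integrable_diff int) auto
    also have "\<dots> = 0"
    proof (intro sum.neutral ballI)
      fix k assume k: "k \<in> {1..N j}"
      then have "expectation (\<lambda>\<omega>. f (t * U j k \<omega>)) = \<mu>" using \<mu>(2)[of "(j, k)"] j by auto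
      then show "expectation (\<lambda>\<omega>. f (t * U j k \<omega>) - \<mu>) = 0"
        using int[OF k] by (simp add: prob_space)
    qed
    finally show ?thesis .
  qed
  have "(\<Sum>p\<in>J. f (t * U (fst p) (snd p) \<omega>) - \<mu>) = (\<Sum>j=1..n. Y j \<omega>)" for \<omega>
    unfolding Y_def by (subst sum.Sigma) (auto simp: case_prod_beta)
  then show ?thesis
    using n by (simp only:, intro even_moment_indep_sum_le ind bounded mean) auto
qed

text \<open>Real and imaginary parts are treated separately; the factor 4 is 2 from squaring a sum
  of two squares times two parts. Fourth moments are taken because products of up to three random
  factors will be bounded by sums of fourth powers.\<close>

lemma \<phi>_tilde_moment:
  "(\<integral>\<^sup>+\<omega>. ennreal ((cmod (\<phi>_tilde (uv \<omega>) t - \<phi> t) * sqrt n) ^ 4) \<partial>P)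
    \<le> ennreal (4 * (2 * fact 4 * exp ((2 * C\<^sub>1)\<^sup>2 / 2)))"
proof -
  let ?S = "\<lambda>f \<mu> \<omega>. (\<Sum>p\<in>J. f (t * U (fst p) (snd p) \<omega>) - \<mu>) / sqrt n"
  let ?B = "2 * fact 4 * exp ((2 * C\<^sub>1)\<^sup>2 / 2)"
  have \<phi>1: "\<bar>\<phi> t\<bar> \<le> 1" using \<phi>_pos[of t] \<phi>_le_1[of t] by simp
  have c: "(\<integral>\<^sup>+\<omega>. ennreal (?S cos (\<phi> t) \<omega> ^ (2 * 2)) \<partial>P) \<le> ennreal (2 * fact (2 * 2) * exp ((2 * C\<^sub>1)\<^sup>2 / 2))"
    using expectation_cos_sin(1) \<phi>1 by (intro trig_sum_moment) auto
  have s: "(\<integral>\<^sup>+\<omega>. ennreal (?S sin 0 \<omega> ^ (2 * 2)) \<partial>P) \<le> ennreal (2 * fact (2 * 2) * exp ((2 * C\<^sub>1)\<^sup>2 / 2))"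
    using expectation_cos_sin(2) by (intro trig_sum_moment) auto
  have meas[measurable]: "?S f \<mu> \<in> borel_measurable P" if "f \<in> borel_measurable borel" for f \<mu>
  proof -
    have "(\<lambda>\<omega>. f (t * U (fst p) (snd p) \<omega>)) \<in> borel_measurable P" if "p \<in> J" for p
    proof -
      have [measurable]: "U (fst p) (snd p) \<in> borel_measurable P" using that by (intro U_measurable) auto
      show ?thesis using \<open>f \<in> borel_measurable borel\<close> by measurable
    qed
    then show ?thesis by (intro borel_measurable_divide borel_measurable_sum borel_measurable_diff) auto
  qed
  have "(\<integral>\<^sup>+\<omega>. ennreal ((cmod (\<phi>_tilde (uv \<omega>) t - \<phi> t) * sqrt n) ^ 4) \<partial>P)
      \<le> (\<integral>\<^sup>+\<omega>. 2 * (ennreal (?S cos (\<phi> t) \<omega> ^ 4) + ennreal (?S sin 0 \<omega> ^ 4)) \<partial>P)"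
  proof (intro nn_integral_mono)
    fix \<omega>
    let ?z = "\<phi>_tilde (uv \<omega>) t - \<phi> t"
    have sum_uv: "(\<Sum>p\<in>J. iexp (t * uv \<omega> p)) = (\<Sum>p\<in>J. iexp (t * U (fst p) (snd p) \<omega>))"
      by (intro sum.cong refl) (simp only: uv_apply)
    have Mn: "real n / total_obs n N \<le> 1" "0 \<le> real n / total_obs n N"
      using total_obs_bounds total_obs_pos by auto
    have scale: "real n / total_obs n N * (a / sqrt n) = a / total_obs n N * sqrt n" for a
    proof -
      have "real n / total_obs n N * (a / sqrt n) = a / total_obs n N * (real n / sqrt n)" by simp
      then show ?thesis by (simp only: real_div_sqrt of_nat_0_le_iff)
    qed
    have Jsum: "(\<Sum>p\<in>J. \<phi> t) = total_obs n N * \<phi> t" by (simp add: total_obs_card)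
    have "Re ?z * sqrt n = real n / total_obs n N * ?S cos (\<phi> t) \<omega>"
      unfolding \<phi>_tilde_def sum_uv sum_subtractf Jsum scale using total_obs_pos
      by (simp add: Re_exp diff_divide_distrib)
    then have "\<bar>Re ?z * sqrt n\<bar> = real n / total_obs n N * \<bar>?S cos (\<phi> t) \<omega>\<bar>"
      using Mn by (simp only: abs_mult abs_of_nonneg)
    also have "\<dots> \<le> 1 * \<bar>?S cos (\<phi> t) \<omega>\<bar>" using Mn by (intro mult_right_mono) auto
    finally have re: "\<bar>Re ?z * sqrt n\<bar> ^ 4 \<le> \<bar>?S cos (\<phi> t) \<omega>\<bar> ^ 4" by (intro power_mono) auto
    have "Im ?z * sqrt n = real n / total_obs n N * ?S sin 0 \<omega>"
      unfolding \<phi>_tilde_def sum_uv sum_subtractf scale using total_obs_pos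
      by (simp add: Im_exp)
    then have "\<bar>Im ?z * sqrt n\<bar> = real n / total_obs n N * \<bar>?S sin 0 \<omega>\<bar>"
      using Mn by (simp only: abs_mult abs_of_nonneg)
    also have "\<dots> \<le> 1 * \<bar>?S sin 0 \<omega>\<bar>" using Mn by (intro mult_right_mono) auto
    finally have im: "\<bar>Im ?z * sqrt n\<bar> ^ 4 \<le> \<bar>?S sin 0 \<omega>\<bar> ^ 4" by (intro power_mono) auto
    have "(cmod ?z * sqrt n) ^ 4 = ((Re ?z * sqrt n)\<^sup>2 + (Im ?z * sqrt n)\<^sup>2)\<^sup>2"
    proof -
      have "(cmod ?z * sqrt n) ^ 4 = ((cmod ?z)\<^sup>2 * (sqrt n)\<^sup>2)\<^sup>2"
        by (simp only: power_mult_distrib power_mult[symmetric]) simp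
      then show ?thesis by (simp only: cmod_power2 power_mult_distrib distrib_right)
    qed
    also have "\<dots> \<le> 2 * (\<bar>Re ?z * sqrt n\<bar> ^ 4 + \<bar>Im ?z * sqrt n\<bar> ^ 4)"
    proof -
      have "(x + y)\<^sup>2 \<le> 2 * (x\<^sup>2 + y\<^sup>2)" for x y :: real
        using zero_le_power2[of "x - y"] by (simp add: power2_sum power2_diff)
      from this[of "(Re ?z * sqrt n)\<^sup>2" "(Im ?z * sqrt n)\<^sup>2"] show ?thesis
        by (simp only: power_mult[symmetric] power_even_abs_numeral even_numeral) simp
    qed
    also have "\<dots> \<le> 2 * (\<bar>?S cos (\<phi> t) \<omega>\<bar> ^ 4 + \<bar>?S sin 0 \<omega>\<bar> ^ 4)"
      by (intro mult_left_mono add_mono re im) simp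
    finally have "(cmod ?z * sqrt n) ^ 4 \<le> 2 * (?S cos (\<phi> t) \<omega> ^ 4 + ?S sin 0 \<omega> ^ 4)"
      by (simp only: power_even_abs_numeral even_numeral)
    then have "ennreal ((cmod ?z * sqrt n) ^ 4) \<le> ennreal (2 * (?S cos (\<phi> t) \<omega> ^ 4 + ?S sin 0 \<omega> ^ 4))"
      by (rule ennreal_leI)
    also have "\<dots> = 2 * (ennreal (?S cos (\<phi> t) \<omega> ^ 4) + ennreal (?S sin 0 \<omega> ^ 4))"
      by (simp add: ennreal_mult' ennreal_plus)
    finally show "ennreal ((cmod ?z * sqrt n) ^ 4)
      \<le> 2 * (ennreal (?S cos (\<phi> t) \<omega> ^ 4) + ennreal (?S sin 0 \<omega> ^ 4))" .
  qed
  also have "\<dots> = 2 * ((\<integral>\<^sup>+\<omega>. ennreal (?S cos (\<phi> t) \<omega> ^ 4) \<partial>P) + (\<integral>\<^sup>+\<omega>. ennreal (?S sin 0 \<omega> ^ 4) \<partial>P))"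
    using meas[of cos "\<phi> t"] meas[of sin 0]
    by (subst nn_integral_cmult, measurable) (subst nn_integral_add, auto)
  also have "\<dots> \<le> 2 * (ennreal ?B + ennreal ?B)"
    using c s by (intro mult_left_mono add_mono) auto
  also have "\<dots> = ennreal (4 * ?B)"
  proof -
    have "2 * (ennreal b + ennreal b) = ennreal (4 * b)" if "b \<ge> 0" for b
      using that by (simp add: ennreal_plus[symmetric] ennreal_mult' del: ennreal_plus)
    then show ?thesis by simp
  qed
  finally show ?thesis .
qed

text \<open>Integrating \<open>D\<close> against \<open>w\<close> gives a scaled sum of centred
  values \<open>H (U j k \<omega> - U j l \<omega>)\<close>, with \<open>H\<close> the cosine
  transform of \<open>w\<close>. Independence across individuals removes the cross terms, and the
  second moment of \<open>H\<close> is a quadratic form in the characteristic function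
  \<open>(\<phi> t)\<^sup>2\<close> of a difference. In \<open>C\<^sub>1 ^ 6\<close>, four powers
  come from the squared number of pairs per individual and two from
  \<open>n / num_pairs n N\<close>.\<close>

lemma linear_functional_second_moment:
  fixes w :: "real \<Rightarrow> real"
  assumes w: "integrable lborel w"
  shows "(\<integral>\<^sup>+\<omega>. ennreal ((LINT t|lborel. w t * D (uv \<omega>) t)\<^sup>2) \<partial>P)
    \<le> ennreal (C\<^sub>1 ^ 6 / n) * (\<integral>\<^sup>+s. \<integral>\<^sup>+t. ennreal (\<bar>w s\<bar> * \<bar>w t\<bar> *
        ((\<phi> (s + t))\<^sup>2 + (\<phi> (s - t))\<^sup>2)) \<partial>lborel \<partial>lborel)"
    (is "_ \<le> ennreal (C\<^sub>1 ^ 6 / n) * ?Q")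
proof (cases "?Q = \<infinity>")
  \<comment> \<open>The coefficient is positive, so an infinite form makes the bound trivial;
    otherwise the form is a real number \<open>q\<close> and real arithmetic applies.\<close>
  case True
  have "ennreal (C\<^sub>1 ^ 6 / n) * ?Q = \<infinity>"
    unfolding True using C\<^sub>1 n by (simp add: ennreal_mult_top)
  then show ?thesis by simp
next
  case False
  define q where "q = enn2real ?Q"
  have q: "?Q = ennreal q" "q \<ge> 0" using False by (simp_all add: q_def less_top)
  note [measurable] = borel_measurable_integrable[OF w]
  let ?a = "\<lambda>t. complex_of_real (w t)"
  have a: "integrable lborel ?a" using w by simp
  define H where "H v = (LINT t|lborel. w t * cos (t * v))" for v
  define h0 where "h0 = (LINT t|lborel. w t * (\<phi> t)\<^sup>2)"
  have H_meas[measurable]: "H \<in> borel_measurable borel" unfolding H_def by measurable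
  have H_eq: "H v = (LINT t|lborel. Re (?a t * iexp (t * v)))" for v
    unfolding H_def by (simp add: Re_exp)
  have int_cos: "integrable lborel (\<lambda>t. w t * cos (t * v))" for v
    by (rule Bochner_Integration.integrable_bound[OF w])
      (auto intro!: AE_I2 simp: abs_mult mult_left_le)
  have int_\<phi>: "integrable lborel (\<lambda>t. w t * (\<phi> t)\<^sup>2)"
  proof (rule Bochner_Integration.integrable_bound[OF w])
    show "AE t in lborel. norm (w t * (\<phi> t)\<^sup>2) \<le> norm (w t)"
      using \<phi>_pos \<phi>_le_1 by (intro AE_I2) (simp add: abs_mult mult_left_le power_le_one less_imp_le)
  qed measurable
  define B where "B = (LINT t|lborel. \<bar>w t\<bar>)"
  have H_le: "\<bar>H v\<bar> \<le> B" for v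
  proof -
    have "norm (H v) \<le> (LINT t|lborel. norm (w t * cos (t * v)))" unfolding H_def by (rule integral_norm_bound)
    also have "\<dots> \<le> B" unfolding B_def
      by (intro integral_mono integrable_norm int_cos integrable_abs w) (auto simp: abs_mult mult_left_le)
    finally show ?thesis by simp
  qed
  let ?V = "\<lambda>j p \<omega>. U j (fst p) \<omega> - U j (snd p) \<omega>"
  have V_meas: "?V j p \<in> borel_measurable P" if "j \<in> {1..n}" "p \<in> pair_set (N j)" for j p
  proof -
    have "(j, fst p) \<in> J" "(j, snd p) \<in> J" using that by (auto simp: pair_set_def)
    note [measurable] = this[THEN U_measurable]
    show ?thesis by measurable
  qed
  have EH: "expectation (\<lambda>\<omega>. H (?V j p \<omega>)) = h0" if "j \<in> {1..n}" "p \<in> pair_set (N j)" for j p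
    unfolding H_eq h0_def
    using expectation_integral_Re_iexp[OF V_meas[OF that] a] char_U_diff[of j "fst p" "snd p"] that
    by simp
  have EH2: "expectation (\<lambda>\<omega>. (H (?V j p \<omega>))\<^sup>2) \<le> q" if jp: "j \<in> {1..n}" "p \<in> pair_set (N j)" for j p
  proof -
    \<comment> \<open>The unit index set specialises the bound for families to a single difference
      of errors.\<close>
    have "ennreal (\<Sum>i\<in>{()}. expectation (\<lambda>\<omega>. (LINT t|lborel. Re (?a t * iexp (t * ?V j p \<omega>)))\<^sup>2))
      \<le> (\<integral>\<^sup>+s. \<integral>\<^sup>+t. ennreal (cmod (?a s) * cmod (?a t) *
        (cmod (\<Sum>i\<in>{()}. expectation (\<lambda>\<omega>. iexp ((s + t) * ?V j p \<omega>)))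
         + cmod (\<Sum>i\<in>{()}. expectation (\<lambda>\<omega>. iexp ((s - t) * ?V j p \<omega>))))) \<partial>lborel \<partial>lborel)"
      by (rule expectation_fourier_square_le[OF _ _ a]) (simp_all only: V_meas[OF jp] finite.intros)
    also have "\<dots> = ?Q"
    proof -
      have "expectation (\<lambda>\<omega>. iexp (r * ?V j p \<omega>)) = complex_of_real ((\<phi> r)\<^sup>2)" for r
        using jp by (intro char_U_diff) auto
      then show ?thesis by (simp only:) (simp add: norm_power)
    qed
    finally show ?thesis using q by (simp add: H_eq)
  qed
  define g where "g j v = (\<Sum>p\<in>pair_set (N j). H (v (j, fst p) - v (j, snd p)) - h0)"
    for j and v :: "nat \<times> nat \<Rightarrow> real"
  define Y where "Y j \<omega> = (\<Sum>p\<in>pair_set (N j). H (?V j p \<omega>) - h0)" for j \<omega>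
  have gY: "g j (\<lambda>p\<in>{j} \<times> {1..N j}. U (fst p) (snd p) \<omega>) = Y j \<omega>" for j \<omega>
    unfolding g_def Y_def by (intro sum.cong refl) (auto simp: pair_set_def)
  have "g j \<in> borel_measurable (Pi\<^sub>M ({j} \<times> {1..N j}) (\<lambda>_. borel))" if "j \<in> {1..n}" for j
    unfolding g_def
  proof (intro borel_measurable_sum)
    fix p assume "p \<in> pair_set (N j)"
    then have [measurable]: "(\<lambda>v. v (j, fst p)) \<in> borel_measurable (Pi\<^sub>M ({j} \<times> {1..N j}) (\<lambda>_. borel))"
      "(\<lambda>v. v (j, snd p)) \<in> borel_measurable (Pi\<^sub>M ({j} \<times> {1..N j}) (\<lambda>_. borel))"
      by (auto intro!: measurable_component_singleton simp: pair_set_def)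
    show "(\<lambda>v. H (v (j, fst p) - v (j, snd p)) - h0)
        \<in> borel_measurable (Pi\<^sub>M ({j} \<times> {1..N j}) (\<lambda>_. borel))" by measurable
  qed
  from indep_groups[OF this] have ind: "indep_vars (\<lambda>_. borel) Y {1..n}"
    unfolding gY by (simp add: Y_def[abs_def])
  have h0_le: "\<bar>h0\<bar> \<le> B"
  proof -
    have "norm h0 \<le> (LINT t|lborel. norm (w t * (\<phi> t)\<^sup>2))" unfolding h0_def by (rule integral_norm_bound)
    also have "\<dots> \<le> B" unfolding B_def using \<phi>_pos \<phi>_le_1
      by (intro integral_mono integrable_norm int_\<phi> integrable_abs w)
        (auto simp: abs_mult mult_left_le power_le_one less_imp_le)
    finally show ?thesis by simp
  qed
  have Hh: "\<bar>H x - h0\<bar> \<le> 2 * B" for x using H_le[of x] h0_le by linarith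
  have bounded: "\<bar>Y j \<omega>\<bar> \<le> C\<^sub>1\<^sup>2 * (2 * B)" if "j \<in> {1..n}" for j \<omega>
  proof -
    have "\<bar>Y j \<omega>\<bar> \<le> (\<Sum>p\<in>pair_set (N j). 2 * B)"
      unfolding Y_def by (intro order_trans[OF sum_abs] sum_mono Hh)
    also have "\<dots> \<le> C\<^sub>1\<^sup>2 * (2 * B)"
      using card_pair_set_bound[OF that] order_trans[OF abs_ge_zero Hh]
      by (simp add: mult_right_mono)
    finally show ?thesis .
  qed
  have int_H: "integrable P (\<lambda>\<omega>. H (?V j p \<omega>))" if "j \<in> {1..n}" "p \<in> pair_set (N j)" for j p
    using V_meas[OF that] H_le by (intro integrable_bounded[where B = B]) auto
  have int_H2: "integrable P (\<lambda>\<omega>. (H (?V j p \<omega>) - h0)\<^sup>2)" "integrable P (\<lambda>\<omega>. (H (?V j p \<omega>))\<^sup>2)"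
    if "j \<in> {1..n}" "p \<in> pair_set (N j)" for j p
  proof -
    note [measurable] = V_meas[OF that]
    have "(H x - h0)\<^sup>2 \<le> (2 * B)\<^sup>2" for x using Hh[of x] by (metis abs_ge_zero power2_abs power_mono)
    then show "integrable P (\<lambda>\<omega>. (H (?V j p \<omega>) - h0)\<^sup>2)"
      by (intro integrable_bounded[where B = "(2 * B)\<^sup>2"]) auto
    have "(H x)\<^sup>2 \<le> B\<^sup>2" for x using H_le[of x] by (metis abs_ge_zero power2_abs power_mono)
    then show "integrable P (\<lambda>\<omega>. (H (?V j p \<omega>))\<^sup>2)"
      by (intro integrable_bounded[where B = "B\<^sup>2"]) auto
  qed
  have mean: "expectation (Y j) = 0" if j: "j \<in> {1..n}" for j
  proof -
    have "expectation (Y j) = (\<Sum>p\<in>pair_set (N j). expectation (\<lambda>\<omega>. H (?V j p \<omega>) - h0))"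
      unfolding Y_def
      by (intro Bochner_Integration.integral_sum Bochner_Integration.integrable_diff int_H j) auto
    also have "\<dots> = 0"
      using int_H[OF j] EH[OF j] by (intro sum.neutral ballI) (simp add: prob_space)
    finally show ?thesis .
  qed
  have EY2: "expectation (\<lambda>\<omega>. (Y j \<omega>)\<^sup>2) \<le> C\<^sub>1 ^ 4 * q" if j: "j \<in> {1..n}" for j
  proof -
    let ?c = "real (card (pair_set (N j)))"
    \<comment> \<open>Pairs of one individual need not be independent, so Cauchy-Schwarz is used
      here, at the price of their number \<open>?c\<close>.\<close>
    have "expectation (\<lambda>\<omega>. (Y j \<omega>)\<^sup>2) \<le> expectation (\<lambda>\<omega>. ?c * (\<Sum>p\<in>pair_set (N j). (H (?V j p \<omega>) - h0)\<^sup>2))"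
    proof (rule integral_mono)
      have "Y j \<in> borel_measurable P" using ind j by (auto simp: indep_vars_def)
      moreover have "(Y j \<omega>)\<^sup>2 \<le> (C\<^sub>1\<^sup>2 * (2 * B))\<^sup>2" for \<omega>
        using bounded[OF j, of \<omega>] by (metis abs_ge_zero power2_abs power_mono)
      ultimately show "integrable P (\<lambda>\<omega>. (Y j \<omega>)\<^sup>2)"
        by (intro integrable_bounded[where B = "(C\<^sub>1\<^sup>2 * (2 * B))\<^sup>2"]) auto
      show "integrable P (\<lambda>\<omega>. ?c * (\<Sum>p\<in>pair_set (N j). (H (?V j p \<omega>) - h0)\<^sup>2))"
        using int_H2(1)[OF j] by (intro integrable_mult_right Bochner_Integration.integrable_sum) auto
      show "(Y j \<omega>)\<^sup>2 \<le> ?c * (\<Sum>p\<in>pair_set (N j). (H (?V j p \<omega>) - h0)\<^sup>2)" for \<omega>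
        unfolding Y_def
        using sum_squared_le_sum_of_squares[of "\<lambda>p. H (?V j p \<omega>) - h0" "pair_set (N j)"]
        by (simp add: mult.commute)
    qed
    also have "\<dots> = ?c * (\<Sum>p\<in>pair_set (N j). expectation (\<lambda>\<omega>. (H (?V j p \<omega>) - h0)\<^sup>2))"
      using int_H2(1)[OF j] by simp
    also have "\<dots> \<le> ?c * (\<Sum>p\<in>pair_set (N j). q)"
    proof (intro mult_left_mono sum_mono)
      fix p assume p: "p \<in> pair_set (N j)"
      have "expectation (\<lambda>\<omega>. (H (?V j p \<omega>) - h0)\<^sup>2) = expectation (\<lambda>\<omega>. (H (?V j p \<omega>))\<^sup>2) - h0\<^sup>2"
        using variance_eq[OF int_H[OF j p] int_H2(2)[OF j p]] by (simp add: EH[OF j p])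
      also have "\<dots> \<le> q" using EH2[OF j p] zero_le_power2[of h0] by linarith
      finally show "expectation (\<lambda>\<omega>. (H (?V j p \<omega>) - h0)\<^sup>2) \<le> q" .
    qed auto
    also have "\<dots> = (?c * ?c) * q" by simp
    also have "\<dots> \<le> (C\<^sub>1\<^sup>2 * C\<^sub>1\<^sup>2) * q"
      using card_pair_set_bound[OF j] q by (intro mult_right_mono mult_mono) auto
    finally show ?thesis by (simp add: power2_eq_square eval_nat_numeral mult_ac)
  qed
  have lin: "(LINT t|lborel. w t * D (uv \<omega>) t) = 1 / num_pairs n N * (\<Sum>j=1..n. Y j \<omega>)" for \<omega>
  proof -
    have "(LINT t|lborel. w t * D (uv \<omega>) t) = (LINT t|lborel. 1 / num_pairs n N *
        (\<Sum>j=1..n. \<Sum>p\<in>pair_set (N j). w t * cos (t * ?V j p \<omega>) - w t * (\<phi> t)\<^sup>2))"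
      unfolding D_uv right_diff_distrib[symmetric] sum_distrib_left[symmetric] by (simp only: mult.left_commute)
    also have "\<dots> = 1 / num_pairs n N * (\<Sum>j=1..n. \<Sum>p\<in>pair_set (N j).
        (LINT t|lborel. w t * cos (t * ?V j p \<omega>) - w t * (\<phi> t)\<^sup>2))"
      using int_cos int_\<phi>
      by (simp only: integral_mult_right_zero Bochner_Integration.integral_sum Bochner_Integration.integrable_sum
          Bochner_Integration.integrable_diff)
    also have "\<dots> = 1 / num_pairs n N * (\<Sum>j=1..n. Y j \<omega>)"
      unfolding Y_def H_def h0_def using int_cos int_\<phi>
      by (simp only: Bochner_Integration.integral_diff)
    finally show ?thesis .
  qed
  let ?S = "\<lambda>\<omega>. \<Sum>j=1..n. Y j \<omega>"
  have [measurable]: "Y j \<in> borel_measurable P" if "j \<in> {1..n}" for j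
    using ind that by (auto simp: indep_vars_def)
  have S_int: "integrable P (\<lambda>\<omega>. (1 / num_pairs n N * ?S \<omega>)\<^sup>2)"
  proof (rule integrable_bounded)
    fix \<omega>
    have "\<bar>1 / num_pairs n N * ?S \<omega>\<bar> \<le> 1 / num_pairs n N * (\<Sum>j=1..n. C\<^sub>1\<^sup>2 * (2 * B))"
      unfolding abs_mult using num_pairs_pos bounded
      by (intro mult_mono order_trans[OF sum_abs] sum_mono) (auto intro!: sum_nonneg)
    then show "norm ((1 / num_pairs n N * ?S \<omega>)\<^sup>2) \<le> (1 / num_pairs n N * (\<Sum>j=1..n. C\<^sub>1\<^sup>2 * (2 * B)))\<^sup>2"
      by (metis abs_ge_zero power2_abs power_mono real_norm_def abs_power2)
  qed measurable
  have "(\<integral>\<^sup>+\<omega>. ennreal ((LINT t|lborel. w t * D (uv \<omega>) t)\<^sup>2) \<partial>P)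
      = ennreal (expectation (\<lambda>\<omega>. (1 / num_pairs n N * ?S \<omega>)\<^sup>2))"
    unfolding lin by (rule nn_integral_eq_integral[OF S_int]) auto
  also have "expectation (\<lambda>\<omega>. (1 / num_pairs n N * ?S \<omega>)\<^sup>2) = (1 / num_pairs n N)\<^sup>2 * expectation (\<lambda>\<omega>. (?S \<omega>)\<^sup>2)"
    by (simp add: power_mult_distrib power_divide)
  also have "ennreal \<dots> \<le> ennreal (C\<^sub>1 ^ 6 / n * q)"
  proof (intro ennreal_leI)
    have "expectation (\<lambda>\<omega>. (?S \<omega>)\<^sup>2)
        \<le> (\<Sum>j=1..n. expectation (Y j))\<^sup>2 + (\<Sum>j=1..n. expectation (\<lambda>\<omega>. (Y j \<omega>)\<^sup>2))"
      by (rule expectation_square_indep_sum_le[OF _ ind bounded]) auto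
    also have "\<dots> \<le> (\<Sum>j=1..n. C\<^sub>1 ^ 4 * q)"
    proof -
      have "(\<Sum>j=1..n. expectation (Y j)) = 0" by (intro sum.neutral ballI mean)
      moreover have "(\<Sum>j=1..n. expectation (\<lambda>\<omega>. (Y j \<omega>)\<^sup>2)) \<le> (\<Sum>j=1..n. C\<^sub>1 ^ 4 * q)"
        by (intro sum_mono EY2)
      ultimately show ?thesis by simp
    qed
    finally have S: "expectation (\<lambda>\<omega>. (?S \<omega>)\<^sup>2) \<le> n * (C\<^sub>1 ^ 4 * q)" by simp
    have "1 / num_pairs n N \<le> C\<^sub>1 / n"
      using pairs num_pairs_pos C\<^sub>1 n by (simp add: field_simps)
    then have "(1 / num_pairs n N)\<^sup>2 \<le> (C\<^sub>1 / n)\<^sup>2" using num_pairs_pos by (intro power_mono) auto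
    then have "(1 / num_pairs n N)\<^sup>2 * expectation (\<lambda>\<omega>. (?S \<omega>)\<^sup>2) \<le> (C\<^sub>1 / n)\<^sup>2 * (n * (C\<^sub>1 ^ 4 * q))"
      using S by (intro mult_mono) auto
    also have "\<dots> = C\<^sub>1 ^ 6 / n * q" using n by (simp add: field_simps eval_nat_numeral)
    finally show "(1 / num_pairs n N)\<^sup>2 * expectation (\<lambda>\<omega>. (?S \<omega>)\<^sup>2) \<le> C\<^sub>1 ^ 6 / n * q" .
  qed
  also have "\<dots> = ennreal (C\<^sub>1 ^ 6 / n) * ?Q"
    unfolding q(1) using C\<^sub>1 q(2) by (intro ennreal_mult) auto
  finally show ?thesis .
qed

text \<open>For frozen errors \<open>v\<close> the integral is a sum of independent functions of the
  \<open>X j\<close>. Averaging replaces each exponential in \<open>X j\<close> by the transform of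
  \<open>fX\<close>, and what remains of the sum is \<open>\<phi>_tilde v\<close>; this is the
  squared mean. In the variance part, Cauchy-Schwarz within an individual costs
  \<open>C\<^sub>1\<close>, and \<open>1 / total_obs n N\<close> is left of its square after summing
  over all observations. The weight \<open>a\<close> is arbitrary, so it may itself be built from
  \<open>v\<close>.\<close>

lemma conditional_second_moment:
  fixes a :: "real \<Rightarrow> complex" and v :: "nat \<times> nat \<Rightarrow> real"
  assumes a: "integrable lborel a"
  shows "(\<integral>\<^sup>+\<omega>. ennreal ((LINT t|lborel. Re (a t *
      (1 / total_obs n N * (\<Sum>p\<in>J. iexp (t * (xv \<omega> (fst p) + v p))))))\<^sup>2) \<partial>P)
    \<le> ennreal ((LINT t|lborel. Re (a t * (fourier fX t * \<phi>_tilde v t)))\<^sup>2)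
      + ennreal (C\<^sub>1 / total_obs n N) * (\<integral>\<^sup>+s. \<integral>\<^sup>+t. ennreal (cmod (a s) * cmod (a t) *
        (cmod (fourier fX (s + t) * \<phi>_tilde v (s + t))
         + cmod (fourier fX (s - t) * \<phi>_tilde v (s - t)))) \<partial>lborel \<partial>lborel)"
    (is "_ \<le> ennreal (?m\<^sup>2) + ennreal (C\<^sub>1 / ?M) * ?Q")
proof -
  note [measurable] = borel_measurable_integrable[OF a]
  have M: "?M > 0" by (rule total_obs_pos)
  have Re_scale: "Re (complex_of_real r * z) = r * Re z" for r z by simp
  define G where "G x = (LINT t|lborel. Re (a t * iexp (t * x)))" for x
  have G_meas[measurable]: "G \<in> borel_measurable borel" unfolding G_def by measurable
  define B where "B = (LINT t|lborel. cmod (a t))"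
  have intG: "integrable lborel (\<lambda>t. a t * iexp (t * x))" for x
    by (rule integrable_mult_bounded[OF a, where B = 1]) auto
  have G_le: "\<bar>G x\<bar> \<le> B" for x
  proof -
    have "norm (LINT t|lborel. a t * iexp (t * x)) \<le> (LINT t|lborel. norm (a t * iexp (t * x)))"
      by (rule integral_norm_bound)
    then have "cmod (LINT t|lborel. a t * iexp (t * x)) \<le> B" by (simp add: B_def norm_mult)
    then show ?thesis
      unfolding G_def integral_Re_iexp[OF a] using abs_Re_le_cmod order_trans by blast
  qed
  \<comment> \<open>The contribution of individual \<open>j\<close>, as a function of
    \<open>X j\<close> alone.\<close>
  define \<zeta> where "\<zeta> j x = 1 / ?M * (\<Sum>k=1..N j. G (x + v (j, k)))" for j x
  have \<zeta>_meas[measurable]: "\<zeta> j \<in> borel_measurable borel" for j unfolding \<zeta>_def by measurable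
  have \<zeta>_le: "\<bar>\<zeta> j x\<bar> \<le> 1 / ?M * (C\<^sub>1 * B)" if "j \<in> {1..n}" for j x
  proof -
    have B0: "B \<ge> 0" using order_trans[OF abs_ge_zero G_le] .
    have "\<bar>\<Sum>k=1..N j. G (x + v (j, k))\<bar> \<le> (\<Sum>k=1..N j. B)"
      by (intro order_trans[OF sum_abs] sum_mono G_le)
    also have "\<dots> \<le> C\<^sub>1 * B" using N_bounds(2)[OF that] B0 by (simp add: mult_right_mono)
    finally show ?thesis unfolding \<zeta>_def abs_mult using M by (simp add: divide_right_mono)
  qed
  have ind: "indep_vars (\<lambda>_. borel) (\<lambda>j \<omega>. \<zeta> j (X j \<omega>)) {1..n}"
    by (rule indep_vars_compose2[OF indep_X]) auto
  have Z: "(LINT t|lborel. Re (a t * (1 / ?M * (\<Sum>p\<in>J. iexp (t * (xv \<omega> (fst p) + v p))))))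
      = (\<Sum>j=1..n. \<zeta> j (X j \<omega>))" for \<omega>
  proof -
    have "(LINT t|lborel. Re (a t * (1 / ?M * (\<Sum>p\<in>J. iexp (t * (xv \<omega> (fst p) + v p))))))
        = (LINT t|lborel. (\<Sum>p\<in>J. 1 / ?M * Re (a t * iexp (t * (X (fst p) \<omega> + v p)))))"
    proof (rule Bochner_Integration.integral_cong[OF refl])
      fix t
      have "a t * (1 / ?M * (\<Sum>p\<in>J. iexp (t * (xv \<omega> (fst p) + v p))))
          = (\<Sum>p\<in>J. complex_of_real (1 / ?M) * (a t * iexp (t * (xv \<omega> (fst p) + v p))))"
        by (simp add: sum_distrib_left mult_ac)
      also have "\<dots> = (\<Sum>p\<in>J. complex_of_real (1 / ?M) * (a t * iexp (t * (X (fst p) \<omega> + v p))))"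
        by (intro sum.cong refl) (auto simp: xv_def)
      finally have eq: "a t * (1 / ?M * (\<Sum>p\<in>J. iexp (t * (xv \<omega> (fst p) + v p)))) = \<dots>" .
      show "Re (a t * (1 / ?M * (\<Sum>p\<in>J. iexp (t * (xv \<omega> (fst p) + v p)))))
          = (\<Sum>p\<in>J. 1 / ?M * Re (a t * iexp (t * (X (fst p) \<omega> + v p))))"
        unfolding eq Re_sum by (intro sum.cong refl) (simp only: Re_scale)
    qed
    also have "\<dots> = (\<Sum>p\<in>J. 1 / ?M * G (X (fst p) \<omega> + v p))"
      unfolding G_def using intG
      by (subst Bochner_Integration.integral_sum)
        (simp_all only: integral_mult_right_zero integrable_mult_right integrable_Re)
    also have "\<dots> = (\<Sum>j=1..n. \<Sum>k=1..N j. 1 / ?M * G (X j \<omega> + v (j, k)))"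
      by (subst sum.Sigma) (auto simp: case_prod_beta)
    finally show ?thesis by (simp add: \<zeta>_def sum_distrib_left)
  qed
  have X_meas[measurable]: "X j \<in> borel_measurable P" if "j \<in> {1..n}" for j
    using X_measurable that .
  have int_G: "integrable P (\<lambda>\<omega>. G (X j \<omega> + y))" if "j \<in> {1..n}" for j y
    using that G_le by (intro integrable_bounded[where B = B]) auto
  have G2_le: "(G x)\<^sup>2 \<le> B\<^sup>2" for x using G_le[of x] by (metis abs_ge_zero power2_abs power_mono)
  have int_G2: "integrable P (\<lambda>\<omega>. (G (X j \<omega> + y))\<^sup>2)" if "j \<in> {1..n}" for j y
    using that G2_le by (intro integrable_bounded[where B = "B\<^sup>2"]) auto
  have char_shift: "expectation (\<lambda>\<omega>. iexp (t * (X j \<omega> + y))) = fourier fX t * iexp (t * y)"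
    if "j \<in> {1..n}" for j t y
  proof -
    have "expectation (\<lambda>\<omega>. iexp (t * (X j \<omega> + y))) = expectation (\<lambda>\<omega>. iexp (t * X j \<omega>) * iexp (t * y))"
      by (simp add: exp_add[symmetric] distrib_left)
    then show ?thesis by (simp only: integral_mult_left_zero char_X[OF that])
  qed
  have mean_sum: "(\<Sum>j=1..n. expectation (\<lambda>\<omega>. \<zeta> j (X j \<omega>))) = ?m"
  proof -
    have "(\<Sum>j=1..n. expectation (\<lambda>\<omega>. \<zeta> j (X j \<omega>)))
        = (\<Sum>j=1..n. \<Sum>k=1..N j. 1 / ?M * (LINT t|lborel. Re (a t * (fourier fX t * iexp (t * v (j, k))))))"
    proof (intro sum.cong refl)
      fix j assume j: "j \<in> {1..n}"
      have "expectation (\<lambda>\<omega>. \<zeta> j (X j \<omega>)) = 1 / ?M * (\<Sum>k=1..N j. expectation (\<lambda>\<omega>. G (X j \<omega> + v (j, k))))"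
        unfolding \<zeta>_def using int_G[OF j] by simp
      also have "\<dots> = 1 / ?M * (\<Sum>k=1..N j. (LINT t|lborel. Re (a t * (fourier fX t * iexp (t * v (j, k))))))"
        unfolding G_def using j
        by (subst expectation_integral_Re_iexp) (simp_all only: char_shift a borel_measurable_add X_meas borel_measurable_const)
      finally show "expectation (\<lambda>\<omega>. \<zeta> j (X j \<omega>)) = (\<Sum>k=1..N j. 1 / ?M *
          (LINT t|lborel. Re (a t * (fourier fX t * iexp (t * v (j, k))))))"
        by (simp only: sum_distrib_left)
    qed
    also have "\<dots> = (\<Sum>p\<in>J. 1 / ?M * (LINT t|lborel. Re (a t * (fourier fX t * iexp (t * v p)))))"
      by (subst sum.Sigma) (auto simp: case_prod_beta)
    also have "\<dots> = (LINT t|lborel. (\<Sum>p\<in>J. 1 / ?M * Re (a t * (fourier fX t * iexp (t * v p)))))"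
    proof -
      have "integrable lborel (\<lambda>t. a t * (fourier fX t * iexp (t * y)))" for y
        using fourier_density_le_1[OF fX]
        by (intro integrable_mult_bounded[OF a, where B = 1]) (auto simp: norm_mult)
      then show ?thesis
        by (subst Bochner_Integration.integral_sum)
          (simp_all only: integral_mult_right_zero integrable_mult_right integrable_Re)
    qed
    also have "\<dots> = ?m"
    proof (rule Bochner_Integration.integral_cong[OF refl])
      fix t
      have "(\<Sum>p\<in>J. 1 / ?M * Re (a t * (fourier fX t * iexp (t * v p))))
          = Re (\<Sum>p\<in>J. complex_of_real (1 / ?M) * (a t * (fourier fX t * iexp (t * v p))))"
        unfolding Re_sum by (intro sum.cong refl) (simp only: Re_scale)
      also have "(\<Sum>p\<in>J. complex_of_real (1 / ?M) * (a t * (fourier fX t * iexp (t * v p))))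
          = a t * (fourier fX t * \<phi>_tilde v t)"
        unfolding \<phi>_tilde_def by (simp add: sum_distrib_left mult_ac)
      finally show "(\<Sum>p\<in>J. 1 / ?M * Re (a t * (fourier fX t * iexp (t * v p))))
          = Re (a t * (fourier fX t * \<phi>_tilde v t))" .
    qed
    finally show ?thesis .
  qed
  define q where "q = (\<Sum>p\<in>J. expectation (\<lambda>\<omega>. (G (X (fst p) \<omega> + v p))\<^sup>2))"
  have q_le: "ennreal q \<le> ennreal ?M * ?Q"
  proof -
    \<comment> \<open>The sum over all observations stays inside the modulus: the shifted
      characteristic functions average to the transform of \<open>fX\<close> times
      \<open>\<phi>_tilde v\<close>, and the decay of this product is what the smooth case will
      use.\<close>
    have chsum: "(\<Sum>p\<in>J. expectation (\<lambda>\<omega>. iexp (t * (X (fst p) \<omega> + v p))))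
        = complex_of_real ?M * (fourier fX t * \<phi>_tilde v t)" for t
    proof -
      have "(\<Sum>p\<in>J. expectation (\<lambda>\<omega>. iexp (t * (X (fst p) \<omega> + v p))))
          = (\<Sum>p\<in>J. fourier fX t * iexp (t * v p))"
        by (intro sum.cong refl char_shift) auto
      then show ?thesis using M by (simp add: \<phi>_tilde_def sum_distrib_left)
    qed
    have "ennreal q \<le> (\<integral>\<^sup>+s. \<integral>\<^sup>+t. ennreal (cmod (a s) * cmod (a t) *
        (cmod (\<Sum>p\<in>J. expectation (\<lambda>\<omega>. iexp ((s + t) * (X (fst p) \<omega> + v p))))
         + cmod (\<Sum>p\<in>J. expectation (\<lambda>\<omega>. iexp ((s - t) * (X (fst p) \<omega> + v p)))))) \<partial>lborel \<partial>lborel)"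
      unfolding q_def G_def
    proof (rule expectation_fourier_square_le[OF _ _ a])
      fix p assume "p \<in> J"
      then have "fst p \<in> {1..n}" by auto
      then show "(\<lambda>\<omega>. X (fst p) \<omega> + v p) \<in> borel_measurable P" by measurable
    qed auto
    also have "\<dots> = (\<integral>\<^sup>+s. \<integral>\<^sup>+t. ennreal ?M * ennreal (cmod (a s) * cmod (a t) *
        (cmod (fourier fX (s + t) * \<phi>_tilde v (s + t))
         + cmod (fourier fX (s - t) * \<phi>_tilde v (s - t)))) \<partial>lborel \<partial>lborel)"
      unfolding chsum using M
      by (intro nn_integral_cong, subst ennreal_mult'[symmetric])
         (auto simp: norm_mult distrib_left mult_ac)
    also have "\<dots> = ennreal ?M * ?Q"
    proof -
      have [measurable]: "\<phi>_tilde v \<in> borel_measurable borel"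
        unfolding \<phi>_tilde_def by measurable
      show ?thesis by (simp add: nn_integral_cmult)
    qed
    finally show ?thesis .
  qed
  have E\<zeta>2: "(\<Sum>j=1..n. expectation (\<lambda>\<omega>. (\<zeta> j (X j \<omega>))\<^sup>2)) \<le> C\<^sub>1 / ?M\<^sup>2 * q"
  proof -
    have "(\<Sum>j=1..n. expectation (\<lambda>\<omega>. (\<zeta> j (X j \<omega>))\<^sup>2))
        \<le> (\<Sum>j=1..n. C\<^sub>1 / ?M\<^sup>2 * (\<Sum>k=1..N j. expectation (\<lambda>\<omega>. (G (X j \<omega> + v (j, k)))\<^sup>2)))"
    proof (rule sum_mono)
      fix j assume j: "j \<in> {1..n}"
      have "expectation (\<lambda>\<omega>. (\<zeta> j (X j \<omega>))\<^sup>2)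
          \<le> expectation (\<lambda>\<omega>. C\<^sub>1 / ?M\<^sup>2 * (\<Sum>k=1..N j. (G (X j \<omega> + v (j, k)))\<^sup>2))"
      proof (rule integral_mono)
        have "(\<zeta> j x)\<^sup>2 \<le> (1 / ?M * (C\<^sub>1 * B))\<^sup>2" for x
          using \<zeta>_le[OF j, of x] by (metis abs_ge_zero power2_abs power_mono)
        then show "integrable P (\<lambda>\<omega>. (\<zeta> j (X j \<omega>))\<^sup>2)"
          using j by (intro integrable_bounded[where B = "(1 / ?M * (C\<^sub>1 * B))\<^sup>2"]) auto
        show "integrable P (\<lambda>\<omega>. C\<^sub>1 / ?M\<^sup>2 * (\<Sum>k=1..N j. (G (X j \<omega> + v (j, k)))\<^sup>2))"
          by (intro integrable_mult_right Bochner_Integration.integrable_sum int_G2 j)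
        fix \<omega>
        have "(\<Sum>k=1..N j. G (X j \<omega> + v (j, k)))\<^sup>2 \<le> (\<Sum>k=1..N j. (G (X j \<omega> + v (j, k)))\<^sup>2) * real (N j)"
          using sum_squared_le_sum_of_squares[of "\<lambda>k. G (X j \<omega> + v (j, k))" "{1..N j}"] by simp
        also have "\<dots> \<le> (\<Sum>k=1..N j. (G (X j \<omega> + v (j, k)))\<^sup>2) * C\<^sub>1"
          using N_bounds(2)[OF j] by (intro mult_left_mono sum_nonneg) auto
        finally show "(\<zeta> j (X j \<omega>))\<^sup>2 \<le> C\<^sub>1 / ?M\<^sup>2 * (\<Sum>k=1..N j. (G (X j \<omega> + v (j, k)))\<^sup>2)"
          unfolding \<zeta>_def by (simp add: power_mult_distrib power_divide divide_right_mono mult.commute)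
      qed
      also have "\<dots> = C\<^sub>1 / ?M\<^sup>2 * (\<Sum>k=1..N j. expectation (\<lambda>\<omega>. (G (X j \<omega> + v (j, k)))\<^sup>2))"
        using int_G2[OF j] by (simp only: integral_mult_right_zero Bochner_Integration.integral_sum)
      finally show "expectation (\<lambda>\<omega>. (\<zeta> j (X j \<omega>))\<^sup>2)
          \<le> C\<^sub>1 / ?M\<^sup>2 * (\<Sum>k=1..N j. expectation (\<lambda>\<omega>. (G (X j \<omega> + v (j, k)))\<^sup>2))" .
    qed
    also have "\<dots> = C\<^sub>1 / ?M\<^sup>2 * (\<Sum>j=1..n. \<Sum>k=1..N j. expectation (\<lambda>\<omega>. (G (X j \<omega> + v (j, k)))\<^sup>2))"
      by (simp only: sum_distrib_left)
    also have "(\<Sum>j=1..n. \<Sum>k=1..N j. expectation (\<lambda>\<omega>. (G (X j \<omega> + v (j, k)))\<^sup>2)) = q"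
      unfolding q_def by (subst sum.Sigma) (auto simp: case_prod_beta)
    finally show ?thesis .
  qed
  let ?S = "\<lambda>\<omega>. \<Sum>j=1..n. \<zeta> j (X j \<omega>)"
  have S_int: "integrable P (\<lambda>\<omega>. (?S \<omega>)\<^sup>2)"
  proof (rule integrable_bounded)
    fix \<omega>
    have "\<bar>?S \<omega>\<bar> \<le> (\<Sum>j=1..n. 1 / ?M * (C\<^sub>1 * B))"
      by (intro order_trans[OF sum_abs] sum_mono \<zeta>_le)
    then show "norm ((?S \<omega>)\<^sup>2) \<le> (\<Sum>j=1..n. 1 / ?M * (C\<^sub>1 * B))\<^sup>2"
      by (metis abs_ge_zero power2_abs power_mono real_norm_def abs_power2)
  qed measurable
  have "(\<integral>\<^sup>+\<omega>. ennreal ((LINT t|lborel. Re (a t *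
      (1 / ?M * (\<Sum>p\<in>J. iexp (t * (xv \<omega> (fst p) + v p))))))\<^sup>2) \<partial>P) = ennreal (expectation (\<lambda>\<omega>. (?S \<omega>)\<^sup>2))"
    unfolding Z by (rule nn_integral_eq_integral[OF S_int]) auto
  also have "\<dots> \<le> ennreal (?m\<^sup>2 + C\<^sub>1 / ?M\<^sup>2 * q)"
  proof (intro ennreal_leI)
    have "expectation (\<lambda>\<omega>. (?S \<omega>)\<^sup>2) \<le> (\<Sum>j=1..n. expectation (\<lambda>\<omega>. \<zeta> j (X j \<omega>)))\<^sup>2
        + (\<Sum>j=1..n. expectation (\<lambda>\<omega>. (\<zeta> j (X j \<omega>))\<^sup>2))"
      by (rule expectation_square_indep_sum_le[OF _ ind \<zeta>_le]) auto
    then show "expectation (\<lambda>\<omega>. (?S \<omega>)\<^sup>2) \<le> ?m\<^sup>2 + C\<^sub>1 / ?M\<^sup>2 * q"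
      using E\<zeta>2 unfolding mean_sum by linarith
  qed
  also have "\<dots> = ennreal (?m\<^sup>2) + ennreal (C\<^sub>1 / ?M\<^sup>2) * ennreal q"
  proof -
    have "q \<ge> 0" unfolding q_def by (intro sum_nonneg Bochner_Integration.integral_nonneg) auto
    moreover have "0 \<le> C\<^sub>1 / ?M\<^sup>2" using C\<^sub>1 by simp
    ultimately show ?thesis by (simp only: ennreal_plus ennreal_mult zero_le_power2 mult_nonneg_nonneg)
  qed
  also have "\<dots> \<le> ennreal (?m\<^sup>2) + ennreal (C\<^sub>1 / ?M\<^sup>2) * (ennreal ?M * ?Q)"
    by (intro add_left_mono mult_left_mono q_le) auto
  also have "ennreal (C\<^sub>1 / ?M\<^sup>2) * (ennreal ?M * ?Q) = ennreal (C\<^sub>1 / ?M) * ?Q"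
  proof -
    have "ennreal (C\<^sub>1 / ?M\<^sup>2) * ennreal ?M = ennreal (C\<^sub>1 / ?M)"
      using M C\<^sub>1 by (subst ennreal_mult[symmetric]) (auto simp: power2_eq_square)
    then show ?thesis by (simp add: mult.assoc[symmetric])
  qed
  finally show ?thesis .
qed

end

section \<open>Risk decomposition\<close>

definition decay_integral :: "real \<Rightarrow> ennreal" where
  "decay_integral p = (\<integral>\<^sup>+t. ennreal ((1 + \<bar>t\<bar>) powr (- p)) \<partial>lborel)"

lemma decay_integral_finite:
  assumes p: "p > 1"
  shows "decay_integral p < \<infinity>"
proof -
  let ?f = "\<lambda>t. ennreal ((1 + t) powr (- p)) * indicator {0..} t"
  have F: "(\<integral>\<^sup>+t. ?f t \<partial>lborel) = ennreal (0 - (1 + 0) powr (1 - p) / (1 - p))"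
  proof (rule nn_integral_FTC_atLeast[where F = "\<lambda>t. (1 + t) powr (1 - p) / (1 - p)"])
    show "((\<lambda>t. (1 + t) powr (1 - p) / (1 - p)) has_real_derivative (1 + x) powr (- p)) (at x)"
      if "0 \<le> x" for x
    proof -
      have "((\<lambda>t. (1 + t) powr (1 - p)) has_real_derivative (1 - p) * (1 + x) powr (1 - p - 1) * 1) (at x)"
        using that by (intro DERIV_chain2[OF has_real_derivative_powr]) (auto intro!: derivative_eq_intros)
      from DERIV_cdivide[OF this, of "1 - p"] show ?thesis using p by simp
    qed
    have "((\<lambda>t. (1 + t) powr (1 - p)) \<longlongrightarrow> 0) at_top"
      using p by (intro tendsto_neg_powr filterlim_tendsto_add_at_top[OF tendsto_const] filterlim_ident) auto
    then show "((\<lambda>t. (1 + t) powr (1 - p) / (1 - p)) \<longlongrightarrow> 0) at_top"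
      using tendsto_divide[OF _ tendsto_const, of _ 0 _ "1 - p"] p by fastforce
  qed auto
  have "decay_integral p \<le> (\<integral>\<^sup>+t. ?f t + ?f (0 - t) \<partial>lborel)"
    unfolding decay_integral_def by (intro nn_integral_mono) (auto simp: indicator_def)
  also have "\<dots> = (\<integral>\<^sup>+t. ?f t \<partial>lborel) + (\<integral>\<^sup>+t. ?f (0 - t) \<partial>lborel)"
    by (rule nn_integral_add) auto
  also have "(\<integral>\<^sup>+t. ?f (0 - t) \<partial>lborel) = (\<integral>\<^sup>+t. ?f t \<partial>lborel)"
    by (rule nn_integral_lborel_reflect) auto
  also have "(\<integral>\<^sup>+t. ?f t \<partial>lborel) + (\<integral>\<^sup>+t. ?f t \<partial>lborel) < \<infinity>"
    unfolding F by simp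
  finally show ?thesis .
qed

text \<open>A bound for the fourth moment of \<open>1 + (\<bar>D\<bar> * sqrt n) ^ q\<close>: the 8
  comes from the fourth power of a sum of two terms, the rest is \<open>D_moment\<close> at total
  exponent \<open>4 * q\<close>.\<close>

definition ridge_moment :: "real \<Rightarrow> nat \<Rightarrow> real" where
  "ridge_moment C\<^sub>1 q = 8 * (1 + C\<^sub>1 ^ (4 * q) * (2 * fact (4 * q) * exp ((2 * C\<^sub>1\<^sup>2)\<^sup>2 / 2)))"

definition empirical_moment :: "real \<Rightarrow> real" where
  "empirical_moment C\<^sub>1 = 4 * (2 * fact 4 * exp ((2 * C\<^sub>1)\<^sup>2 / 2))"

text \<open>Kernel, bandwidth and evaluation point are hidden in the frequency weight
  \<open>om\<close> and the cutoff \<open>T\<close>. The ridge enters through two inequalities valid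
  for every real \<open>D\<close>, so the probabilistic argument uses the bandwidth conditions only
  in this form.\<close>

locale deconvolution_setting = replicated_setting P X U n N fX fU C\<^sub>1
  for P :: "'a measure" and X U n N fX fU C\<^sub>1 +
  fixes \<alpha> \<beta> B\<^sub>1 C\<^sub>2 \<kappa> T A \<rho> :: real and om :: "real \<Rightarrow> complex" and q :: nat
  assumes \<alpha>: "\<alpha> > 1 / 2" and const_pos: "B\<^sub>1 > 0" "C\<^sub>2 > 0" "\<kappa> > 0" "A > 0" "\<rho> > 0"
    and \<phi>_lower: "\<And>t. 1 / \<phi> t \<le> B\<^sub>1 * (1 + \<bar>t\<bar>) powr \<alpha>"
    and \<phi>_upper: "\<And>t. \<phi> t \<le> B\<^sub>1 * (1 + \<bar>t\<bar>) powr (- \<alpha>)"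
    and fX_decay: "\<And>t. cmod (fourier fX t) \<le> C\<^sub>2 * (1 + \<bar>t\<bar>) powr (- \<beta>)"
    and om_measurable[measurable]: "om \<in> borel_measurable borel"
    and om_bound: "\<And>t. cmod (om t) \<le> \<kappa> * indicator {-T..T} t"
    and ridge: "\<And>t D. \<bar>t\<bar> \<le> T \<Longrightarrow> \<bar>1 / (sqrt \<bar>(\<phi> t)\<^sup>2 + D\<bar> + \<rho>) - 1 / \<phi> t\<bar>
        \<le> A * (1 / sqrt n * (1 + \<bar>t\<bar>) powr (3 * \<alpha>)) * (1 + (\<bar>D\<bar> * sqrt n) ^ q)"
    and ridge2: "\<And>t D. \<bar>t\<bar> \<le> T \<Longrightarrow>
        \<bar>1 / (sqrt \<bar>(\<phi> t)\<^sup>2 + D\<bar> + \<rho>) - 1 / \<phi> t + D / (2 * \<phi> t ^ 3)\<bar>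
        \<le> A * (1 / n * (1 + \<bar>t\<bar>) powr (5 * \<alpha>)) * (1 + (\<bar>D\<bar> * sqrt n) ^ q)"
begin

definition R :: "(nat \<times> nat \<Rightarrow> real) \<Rightarrow> real \<Rightarrow> real" where
  "R v t = 1 / (sqrt \<bar>\<psi>_hat v t\<bar> + \<rho>) - 1 / \<phi> t"

definition R2 :: "(nat \<times> nat \<Rightarrow> real) \<Rightarrow> real \<Rightarrow> real" where
  "R2 v t = R v t + D v t / (2 * \<phi> t ^ 3)"

text \<open>The random factor in the bounds of both \<open>R\<close> and \<open>R2\<close>. Its
  moments are bounded uniformly in \<open>t\<close>, so it can be separated from the frequency
  weights by Tonelli or Minkowski.\<close>

definition Y :: "(nat \<times> nat \<Rightarrow> real) \<Rightarrow> real \<Rightarrow> real" where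
  "Y v t = 1 + (\<bar>D v t\<bar> * sqrt n) ^ q"

definition dev :: "(nat \<times> nat \<Rightarrow> real) \<Rightarrow> real \<Rightarrow> real" where
  "dev v t = cmod (\<phi>_tilde v t - \<phi> t) * sqrt n"

abbreviation wt :: "real \<Rightarrow> real \<Rightarrow> ennreal" where
  "wt \<gamma> t \<equiv> indicator {-T..T} t * ennreal ((1 + \<bar>t\<bar>) powr \<gamma>)"

lemma Y_ge_1: "Y v t \<ge> 1"
  by (simp add: Y_def)

lemma dev_nonneg: "dev v t \<ge> 0"
  by (simp add: dev_def)

lemma R_measurable[measurable]: "(\<lambda>(v, t). R v t) \<in> borel_measurable (MU \<Otimes>\<^sub>M borel)"
  unfolding R_def by measurable

lemma Y_measurable[measurable]: "(\<lambda>(v, t). Y v t) \<in> borel_measurable (MU \<Otimes>\<^sub>M borel)"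
  unfolding Y_def by measurable

lemma dev_measurable[measurable]: "(\<lambda>(v, t). dev v t) \<in> borel_measurable (MU \<Otimes>\<^sub>M borel)"
  unfolding dev_def by measurable

lemma fixed_measurable[measurable]:
  "\<psi>_hat v \<in> borel_measurable borel" "D v \<in> borel_measurable borel" "\<phi>_tilde v \<in> borel_measurable borel"
  "R v \<in> borel_measurable borel" "R2 v \<in> borel_measurable borel"
  "Y v \<in> borel_measurable borel" "dev v \<in> borel_measurable borel"
proof -
  show [measurable]: "\<psi>_hat v \<in> borel_measurable borel" unfolding \<psi>_hat_def by measurable
  show [measurable]: "D v \<in> borel_measurable borel" unfolding D_def by measurable
  show [measurable]: "\<phi>_tilde v \<in> borel_measurable borel" unfolding \<phi>_tilde_def by measurable
  show [measurable]: "R v \<in> borel_measurable borel" unfolding R_def by measurable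
  show "R2 v \<in> borel_measurable borel" unfolding R2_def by measurable
  show "Y v \<in> borel_measurable borel" unfolding Y_def by measurable
  show "dev v \<in> borel_measurable borel" unfolding dev_def by measurable
qed

lemma \<psi>_hat_eq: "\<psi>_hat v t = (\<phi> t)\<^sup>2 + D v t"
  by (simp add: D_def)

lemma R_bound: "\<bar>t\<bar> \<le> T \<Longrightarrow> \<bar>R v t\<bar> \<le> A / sqrt n * (1 + \<bar>t\<bar>) powr (3 * \<alpha>) * Y v t"
  unfolding R_def Y_def \<psi>_hat_eq using ridge[of t "D v t"] by simp

lemma R2_bound: "\<bar>t\<bar> \<le> T \<Longrightarrow> \<bar>R2 v t\<bar> \<le> A / n * (1 + \<bar>t\<bar>) powr (5 * \<alpha>) * Y v t"
  unfolding R2_def R_def Y_def \<psi>_hat_eq using ridge2[of t "D v t"] by simp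

lemma Y_moment: "(\<integral>\<^sup>+\<omega>. ennreal (Y (uv \<omega>) t ^ 4) \<partial>P) \<le> ennreal (ridge_moment C\<^sub>1 q)"
proof -
  have pow4: "(1 + x) ^ 4 \<le> 8 * (1 + x ^ 4)" for x :: real
  proof -
    have "(1 + x)\<^sup>2 \<le> 2 * (1 + x\<^sup>2)"
      using zero_le_power2[of "1 - x"] by (simp add: power2_eq_square algebra_simps)
    then have "((1 + x)\<^sup>2)\<^sup>2 \<le> (2 * (1 + x\<^sup>2))\<^sup>2" by (intro power_mono) auto
    also have "\<dots> \<le> 8 * (1 + (x\<^sup>2)\<^sup>2)"
      using zero_le_power2[of "1 - x\<^sup>2"] by (simp add: power2_eq_square algebra_simps)
    finally show ?thesis by (simp add: power_mult[symmetric])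
  qed
  let ?y = "\<lambda>\<omega>. (\<bar>D (uv \<omega>) t\<bar> * sqrt n) ^ (2 * (2 * q))"
  have "(\<integral>\<^sup>+\<omega>. ennreal (Y (uv \<omega>) t ^ 4) \<partial>P) \<le> (\<integral>\<^sup>+\<omega>. ennreal 8 * (1 + ennreal (?y \<omega>)) \<partial>P)"
  proof (intro nn_integral_mono)
    fix \<omega>
    have "Y (uv \<omega>) t ^ 4 \<le> 8 * (1 + ?y \<omega>)"
      using pow4[of "(\<bar>D (uv \<omega>) t\<bar> * sqrt n) ^ q"] by (simp add: Y_def power_mult[symmetric] mult.commute)
    then have "ennreal (Y (uv \<omega>) t ^ 4) \<le> ennreal (8 * (1 + ?y \<omega>))" by (rule ennreal_leI)
    also have "\<dots> = ennreal 8 * (1 + ennreal (?y \<omega>))"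
      by (subst ennreal_mult') (simp_all add: ennreal_plus)
    finally show "ennreal (Y (uv \<omega>) t ^ 4) \<le> ennreal 8 * (1 + ennreal (?y \<omega>))" .
  qed
  also have "\<dots> = ennreal 8 * (1 + (\<integral>\<^sup>+\<omega>. ennreal (?y \<omega>) \<partial>P))"
    by (subst nn_integral_cmult, measurable) (subst nn_integral_add, auto simp: emeasure_space_1)
  also have "\<dots> \<le> ennreal 8 * (1 + ennreal (C\<^sub>1 ^ (2 * (2 * q)) * (2 * fact (2 * (2 * q)) * exp ((2 * C\<^sub>1\<^sup>2)\<^sup>2 / 2))))"
    by (intro mult_left_mono add_left_mono D_moment) auto
  also have "\<dots> = ennreal (ridge_moment C\<^sub>1 q)"
    unfolding ridge_moment_def using C\<^sub>1
    by (subst ennreal_mult') (simp_all add: ennreal_plus)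
  finally show ?thesis .
qed

lemma dev_moment: "(\<integral>\<^sup>+\<omega>. ennreal (dev (uv \<omega>) t ^ 4) \<partial>P) \<le> ennreal (empirical_moment C\<^sub>1)"
  unfolding dev_def empirical_moment_def by (rule \<phi>_tilde_moment)

text \<open>Needed for the fluctuation part of the variance, where two amplitudes meet a deviation
  at \<open>r = s + t\<close> or \<open>r = s - t\<close>. All three depend on the same errors, so
  the product is split into fourth powers instead of being factored.\<close>

lemma YYdev_moment:
  "(\<integral>\<^sup>+\<omega>. ennreal (Y (uv \<omega>) s * Y (uv \<omega>) t * dev (uv \<omega>) r) \<partial>P)
    \<le> ennreal (2 * ridge_moment C\<^sub>1 q + empirical_moment C\<^sub>1 + 1)"
proof -
  have ineq: "x * y * z \<le> x ^ 4 + y ^ 4 + z ^ 4 + 1" if "x \<ge> 0" "y \<ge> 0" "z \<ge> 0" for x y z :: real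
  proof -
    have "2 * (x * y * z) \<le> (x * y)\<^sup>2 + z\<^sup>2"
      using zero_le_power2[of "x * y - z"] by (simp add: power2_diff)
    moreover have "2 * (x * y)\<^sup>2 \<le> x ^ 4 + y ^ 4"
      using zero_le_power2[of "x\<^sup>2 - y\<^sup>2"] by (simp add: power2_diff power_mult_distrib power_mult[symmetric])
    moreover have "2 * z\<^sup>2 \<le> z ^ 4 + 1"
      using zero_le_power2[of "z\<^sup>2 - 1"] by (simp add: power2_diff power_mult[symmetric])
    moreover have "0 \<le> x ^ 4" "0 \<le> y ^ 4" "0 \<le> z ^ 4" by auto
    ultimately show ?thesis by linarith
  qed
  let ?Y = "\<lambda>t \<omega>. ennreal (Y (uv \<omega>) t ^ 4)" and ?d = "\<lambda>\<omega>. ennreal (dev (uv \<omega>) r ^ 4)"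
  have "(\<integral>\<^sup>+\<omega>. ennreal (Y (uv \<omega>) s * Y (uv \<omega>) t * dev (uv \<omega>) r) \<partial>P)
      \<le> (\<integral>\<^sup>+\<omega>. ?Y s \<omega> + ?Y t \<omega> + ?d \<omega> + 1 \<partial>P)"
  proof (intro nn_integral_mono)
    fix \<omega>
    have nn: "0 \<le> Y (uv \<omega>) s" "0 \<le> Y (uv \<omega>) t" "0 \<le> dev (uv \<omega>) r"
      using Y_ge_1 order_trans zero_le_one dev_nonneg by blast+
    have "ennreal (Y (uv \<omega>) s * Y (uv \<omega>) t * dev (uv \<omega>) r)
        \<le> ennreal (Y (uv \<omega>) s ^ 4 + Y (uv \<omega>) t ^ 4 + dev (uv \<omega>) r ^ 4 + 1)"
      by (intro ennreal_leI ineq nn)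
    then show "ennreal (Y (uv \<omega>) s * Y (uv \<omega>) t * dev (uv \<omega>) r) \<le> ?Y s \<omega> + ?Y t \<omega> + ?d \<omega> + 1"
      by (simp add: ennreal_plus)
  qed
  also have "\<dots> = (\<integral>\<^sup>+\<omega>. ?Y s \<omega> \<partial>P) + (\<integral>\<^sup>+\<omega>. ?Y t \<omega> \<partial>P) + (\<integral>\<^sup>+\<omega>. ?d \<omega> \<partial>P) + 1"
    by (simp add: nn_integral_add emeasure_space_1)
  also have "\<dots> \<le> ennreal (ridge_moment C\<^sub>1 q) + ennreal (ridge_moment C\<^sub>1 q) + ennreal (empirical_moment C\<^sub>1) + 1"
    by (intro add_mono Y_moment dev_moment order_refl)
  also have "\<dots> = ennreal (2 * ridge_moment C\<^sub>1 q + empirical_moment C\<^sub>1 + 1)"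
  proof -
    have "0 \<le> ridge_moment C\<^sub>1 q" "0 \<le> empirical_moment C\<^sub>1"
      using C\<^sub>1 by (auto simp: ridge_moment_def empirical_moment_def)
    then show ?thesis by (simp only: mult_2 ennreal_plus add_nonneg_nonneg ennreal_1 zero_le_one)
  qed
  finally show ?thesis .
qed

lemma Y_square_moment: "(\<integral>\<^sup>+\<omega>. (ennreal (Y (uv \<omega>) t))\<^sup>2 \<partial>P) \<le> ennreal (ridge_moment C\<^sub>1 q)"
proof -
  have "(ennreal (Y (uv \<omega>) t))\<^sup>2 \<le> ennreal (Y (uv \<omega>) t ^ 4)" for \<omega>
  proof -
    have "Y (uv \<omega>) t ^ 2 \<le> Y (uv \<omega>) t ^ 4" by (rule power_increasing) (auto simp: Y_ge_1)
    moreover have "0 \<le> Y (uv \<omega>) t" using Y_ge_1 order_trans zero_le_one by blast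
    ultimately show ?thesis by (simp add: ennreal_power ennreal_leI)
  qed
  then have "(\<integral>\<^sup>+\<omega>. (ennreal (Y (uv \<omega>) t))\<^sup>2 \<partial>P) \<le> (\<integral>\<^sup>+\<omega>. ennreal (Y (uv \<omega>) t ^ 4) \<partial>P)"
    by (intro nn_integral_mono)
  also note Y_moment
  finally show ?thesis .
qed

text \<open>The random factor of the remainder: \<open>B\<^sub>1\<close> belongs to the second-order
  error of \<open>R\<close>, \<open>dev\<close> to the product of \<open>R\<close> with the
  fluctuation of \<open>\<phi>_tilde\<close>.\<close>

lemma Y_dev_square_moment:
  "(\<integral>\<^sup>+\<omega>. (ennreal (Y (uv \<omega>) t * (B\<^sub>1 + dev (uv \<omega>) t)))\<^sup>2 \<partial>P)
    \<le> ennreal (ridge_moment C\<^sub>1 q + 8 * (B\<^sub>1 ^ 4 + empirical_moment C\<^sub>1))"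
proof -
  have pow4: "(x * (b + z))\<^sup>2 \<le> x ^ 4 + 8 * (b ^ 4 + z ^ 4)" for x b z :: real
  proof -
    have "2 * (x * (b + z))\<^sup>2 \<le> x ^ 4 + (b + z) ^ 4"
      using zero_le_power2[of "x\<^sup>2 - (b + z)\<^sup>2"]
      by (simp add: power2_diff power_mult_distrib power_mult[symmetric])
    moreover have "(b + z)\<^sup>2 \<le> 2 * (b\<^sup>2 + z\<^sup>2)"
      using zero_le_power2[of "b - z"] by (simp add: power2_eq_square algebra_simps)
    then have "((b + z)\<^sup>2)\<^sup>2 \<le> (2 * (b\<^sup>2 + z\<^sup>2))\<^sup>2" by (intro power_mono) auto
    then have "(b + z) ^ 4 \<le> 4 * (b\<^sup>2 + z\<^sup>2)\<^sup>2"
      by (simp only: power_mult_distrib power_mult[symmetric]) simp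
    moreover have "(b\<^sup>2 + z\<^sup>2)\<^sup>2 \<le> 2 * (b ^ 4 + z ^ 4)"
      using zero_le_power2[of "b\<^sup>2 - z\<^sup>2"] by (simp add: power2_diff power2_sum power_mult[symmetric])
    moreover have "0 \<le> (x * (b + z))\<^sup>2" by simp
    ultimately show ?thesis by linarith
  qed
  let ?d = "\<lambda>\<omega>. ennreal (dev (uv \<omega>) t ^ 4)"
  have "(\<integral>\<^sup>+\<omega>. (ennreal (Y (uv \<omega>) t * (B\<^sub>1 + dev (uv \<omega>) t)))\<^sup>2 \<partial>P)
      \<le> (\<integral>\<^sup>+\<omega>. ennreal (Y (uv \<omega>) t ^ 4) + ennreal 8 * (ennreal (B\<^sub>1 ^ 4) + ?d \<omega>) \<partial>P)"
  proof (intro nn_integral_mono)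
    fix \<omega>
    have nn: "0 \<le> Y (uv \<omega>) t * (B\<^sub>1 + dev (uv \<omega>) t)"
      using Y_ge_1[of "uv \<omega>" t] dev_nonneg[of "uv \<omega>" t] const_pos(1) by (intro mult_nonneg_nonneg) linarith+
    have "(ennreal (Y (uv \<omega>) t * (B\<^sub>1 + dev (uv \<omega>) t)))\<^sup>2
        \<le> ennreal (Y (uv \<omega>) t ^ 4 + 8 * (B\<^sub>1 ^ 4 + dev (uv \<omega>) t ^ 4))"
      unfolding ennreal_power[OF nn] by (intro ennreal_leI pow4)
    also have "\<dots> = ennreal (Y (uv \<omega>) t ^ 4) + ennreal (8 * (B\<^sub>1 ^ 4 + dev (uv \<omega>) t ^ 4))"
      by (rule ennreal_plus) auto
    also have "ennreal (8 * (B\<^sub>1 ^ 4 + dev (uv \<omega>) t ^ 4)) = ennreal 8 * ennreal (B\<^sub>1 ^ 4 + dev (uv \<omega>) t ^ 4)"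
      by (rule ennreal_mult) auto
    also have "ennreal (B\<^sub>1 ^ 4 + dev (uv \<omega>) t ^ 4) = ennreal (B\<^sub>1 ^ 4) + ?d \<omega>"
      by (rule ennreal_plus) auto
    finally show "(ennreal (Y (uv \<omega>) t * (B\<^sub>1 + dev (uv \<omega>) t)))\<^sup>2
        \<le> ennreal (Y (uv \<omega>) t ^ 4) + ennreal 8 * (ennreal (B\<^sub>1 ^ 4) + ?d \<omega>)" .
  qed
  also have "\<dots> = (\<integral>\<^sup>+\<omega>. ennreal (Y (uv \<omega>) t ^ 4) \<partial>P) + ennreal 8 * (ennreal (B\<^sub>1 ^ 4) + (\<integral>\<^sup>+\<omega>. ?d \<omega> \<partial>P))"
    by (subst nn_integral_add, measurable, subst nn_integral_cmult, measurable, subst nn_integral_add)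
      (auto simp: emeasure_space_1)
  also have "\<dots> \<le> ennreal (ridge_moment C\<^sub>1 q) + ennreal 8 * (ennreal (B\<^sub>1 ^ 4) + ennreal (empirical_moment C\<^sub>1))"
    by (intro add_mono mult_left_mono Y_moment dev_moment order_refl) auto
  also have "\<dots> = ennreal (ridge_moment C\<^sub>1 q + 8 * (B\<^sub>1 ^ 4 + empirical_moment C\<^sub>1))"
  proof -
    have nn: "0 \<le> ridge_moment C\<^sub>1 q" "0 \<le> empirical_moment C\<^sub>1"
      using C\<^sub>1 by (auto simp: ridge_moment_def empirical_moment_def)
    have "ennreal 8 * (ennreal (B\<^sub>1 ^ 4) + ennreal (empirical_moment C\<^sub>1)) = ennreal (8 * (B\<^sub>1 ^ 4 + empirical_moment C\<^sub>1))"
      using nn by (subst ennreal_plus[symmetric]) (auto simp: ennreal_mult)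
    then show ?thesis using nn by (simp add: ennreal_plus)
  qed
  finally show ?thesis .
qed

end

section \<open>The squared conditional mean\<close>

lemma integrable_bounded_compact:
  fixes f :: "real \<Rightarrow> 'b :: {banach, second_countable_topology}"
  assumes "f \<in> borel_measurable borel" "\<And>t. norm (f t) \<le> B * indicator {-T..T} t"
  shows "integrable lborel f"
proof (rule Bochner_Integration.integrable_bound[where f = "\<lambda>t. B * indicator {-T..T} t"])
  show "integrable lborel (\<lambda>t. B * indicator {-T..T} t :: real)"
    by (intro integrable_mult_right integrable_real_indicator) (auto simp: emeasure_lborel_Icc_eq)
  have "norm (f t) \<le> norm (B * indicator {-T..T} t :: real)" for t
    using order_trans[OF assms(2)[of t] abs_ge_self] by simp
  then show "AE t in lborel. norm (f t) \<le> norm (B * indicator {-T..T} t :: real)" by simp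
qed (use assms in auto)

text \<open>The 8 is 2, from squaring linear part plus remainder, times the 4 of Schur's test; the
  further factors bound the squared weight and the integral of the squared transform of the errors.
  Extended-real values postpone the finiteness question to the end.\<close>

definition lin_const :: "real \<Rightarrow> real \<Rightarrow> real \<Rightarrow> real \<Rightarrow> real \<Rightarrow> ennreal" where
  "lin_const C\<^sub>1 \<alpha> B\<^sub>1 C\<^sub>2 \<kappa> =
    8 * ennreal (C\<^sub>1 ^ 6 * (\<kappa> * C\<^sub>2 * B\<^sub>1\<^sup>2 / 2)\<^sup>2 * B\<^sub>1\<^sup>2) * decay_integral (2 * \<alpha>)"

definition quad_const :: "real \<Rightarrow> real \<Rightarrow> real \<Rightarrow> real \<Rightarrow> real \<Rightarrow> nat \<Rightarrow> ennreal" where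
  "quad_const C\<^sub>1 B\<^sub>1 C\<^sub>2 \<kappa> A q =
    4 * ennreal ((\<kappa> * C\<^sub>2 * A)\<^sup>2 * (ridge_moment C\<^sub>1 q + 8 * (B\<^sub>1 ^ 4 + empirical_moment C\<^sub>1)))"

context deconvolution_setting
begin

definition amp :: "(nat \<times> nat \<Rightarrow> real) \<Rightarrow> real \<Rightarrow> complex" where
  "amp v t = om t * complex_of_real (R v t)"

text \<open>A deterministic bound from the ridge alone. It may grow with \<open>n\<close> and serves
  integrability, not the rate.\<close>

definition Rmax :: real where "Rmax = 1 / \<rho> + B\<^sub>1 * (1 + T) powr \<alpha>"

lemma inverse_\<phi>_le:
  assumes "\<bar>t\<bar> \<le> T"
  shows "1 / \<phi> t \<le> B\<^sub>1 * (1 + T) powr \<alpha>"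
proof -
  have "B\<^sub>1 * (1 + \<bar>t\<bar>) powr \<alpha> \<le> B\<^sub>1 * (1 + T) powr \<alpha>"
    using assms \<alpha> const_pos by (intro mult_left_mono powr_mono2) auto
  then show ?thesis using \<phi>_lower[of t] by linarith
qed

lemma R_le_Rmax:
  assumes t: "\<bar>t\<bar> \<le> T"
  shows "\<bar>R v t\<bar> \<le> Rmax"
proof -
  have "0 < 1 / (sqrt \<bar>\<psi>_hat v t\<bar> + \<rho>)" "1 / (sqrt \<bar>\<psi>_hat v t\<bar> + \<rho>) \<le> 1 / \<rho>"
    using const_pos(5) by (auto intro!: divide_left_mono add_nonneg_pos mult_pos_pos)
  moreover have "0 < 1 / \<phi> t" using \<phi>_pos[of t] by simp
  ultimately show ?thesis
    unfolding R_def Rmax_def abs_le_iff using inverse_\<phi>_le[OF t] by linarith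
qed

lemma amp_measurable[measurable]: "amp v \<in> borel_measurable borel"
  unfolding amp_def by measurable

lemma om_outside: "\<not> \<bar>t\<bar> \<le> T \<Longrightarrow> om t = 0"
  using om_bound[of t] by (auto simp: indicator_def abs_le_iff split: if_splits)

lemma indicator_outside: "\<not> \<bar>t\<bar> \<le> T \<Longrightarrow> indicator {-T..T} t = (0 :: real)"
  by (auto simp: indicator_def abs_le_iff)

lemma amp_bounded: "norm (amp v t) \<le> (\<kappa> * Rmax) * indicator {-T..T} t"
proof (cases "\<bar>t\<bar> \<le> T")
  case True
  then have "cmod (om t) * \<bar>R v t\<bar> \<le> \<kappa> * Rmax"
    using om_bound[of t] R_le_Rmax[OF True, of v] const_pos
    by (intro mult_mono) (auto simp: indicator_def abs_le_iff)
  then show ?thesis using True by (simp add: amp_def norm_mult indicator_def abs_le_iff)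
qed (simp add: amp_def om_outside indicator_outside)

lemma amp_integrable: "integrable lborel (amp v)"
  using amp_measurable amp_bounded by (rule integrable_bounded_compact)

lemma amp_le: "ennreal (cmod (amp v t)) \<le> ennreal (\<kappa> * A / sqrt n) * (wt (3 * \<alpha>) t * ennreal (Y v t))"
proof (cases "\<bar>t\<bar> \<le> T")
  case True
  have Y0: "0 \<le> Y v t" using Y_ge_1[of v t] by linarith
  have "cmod (om t) * \<bar>R v t\<bar> \<le> \<kappa> * (A / sqrt n * (1 + \<bar>t\<bar>) powr (3 * \<alpha>) * Y v t)"
    using om_bound[of t] R_bound[OF True, of v] const_pos True
    by (intro mult_mono) (auto simp: indicator_def abs_le_iff)
  also have "\<dots> = \<kappa> * A / sqrt n * ((1 + \<bar>t\<bar>) powr (3 * \<alpha>) * Y v t)" by simp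
  finally have "ennreal (cmod (amp v t)) \<le> ennreal (\<kappa> * A / sqrt n * ((1 + \<bar>t\<bar>) powr (3 * \<alpha>) * Y v t))"
    by (intro ennreal_leI) (simp add: amp_def norm_mult)
  also have "\<dots> = ennreal (\<kappa> * A / sqrt n) * (wt (3 * \<alpha>) t * ennreal (Y v t))"
    using True const_pos Y0 by (subst ennreal_mult) (auto simp: ennreal_mult indicator_def abs_le_iff)
  finally show ?thesis .
qed (simp add: amp_def om_outside)

lemma sigma_finite_sample_lborel: "sigma_finite_measure P" "sigma_finite_measure (lborel :: real measure)"
  by unfold_locales

lemma trunc_moment_wt: "(\<integral>\<^sup>+t. wt \<gamma> t \<partial>lborel) = trunc_moment \<gamma> T"
  by (simp add: trunc_moment_def)

lemma uv_joint_measurable[measurable]: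
  assumes [measurable]: "f \<in> measurable K borel" "g \<in> measurable K P"
  shows "(\<lambda>z. Y (uv (g z)) (f z)) \<in> borel_measurable K"
    "(\<lambda>z. dev (uv (g z)) (f z)) \<in> borel_measurable K"
    "(\<lambda>z. D (uv (g z)) (f z)) \<in> borel_measurable K"
    "(\<lambda>z. R (uv (g z)) (f z)) \<in> borel_measurable K"
    "(\<lambda>z. \<phi>_tilde (uv (g z)) (f z)) \<in> borel_measurable K"
proof -
  have *: "(\<lambda>z. (uv (g z), f z)) \<in> measurable K (MU \<Otimes>\<^sub>M borel)" by measurable
  show "(\<lambda>z. Y (uv (g z)) (f z)) \<in> borel_measurable K"
    "(\<lambda>z. dev (uv (g z)) (f z)) \<in> borel_measurable K"
    "(\<lambda>z. D (uv (g z)) (f z)) \<in> borel_measurable K"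
    "(\<lambda>z. R (uv (g z)) (f z)) \<in> borel_measurable K"
    "(\<lambda>z. \<phi>_tilde (uv (g z)) (f z)) \<in> borel_measurable K"
    using measurable_compose[OF * Y_measurable] measurable_compose[OF * dev_measurable]
      measurable_compose[OF * D_measurable] measurable_compose[OF * R_measurable]
      measurable_compose[OF * \<phi>_tilde_measurable] by simp_all
qed

text \<open>The coefficient of \<open>D\<close> in the conditional mean:
  \<open>- 1 / (2 * \<phi> t ^ 3)\<close> from the reciprocal, times \<open>\<phi> t\<close> in
  place of \<open>\<phi>_tilde\<close>, times the weight and the transform of \<open>fX\<close>. One
  power of \<open>\<phi>\<close> cancels.\<close>

definition lin_weight :: "real \<Rightarrow> real" where
  "lin_weight t = - Re (om t * fourier fX t) / (2 * (\<phi> t)\<^sup>2)"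

lemma lin_weight_measurable[measurable]: "lin_weight \<in> borel_measurable borel"
  unfolding lin_weight_def by measurable

lemma abs_lin_weight:
  "\<bar>lin_weight t\<bar> \<le> \<kappa> * C\<^sub>2 * B\<^sub>1\<^sup>2 / 2 * (1 + \<bar>t\<bar>) powr (2 * \<alpha> - \<beta>) * indicator {-T..T} t"
proof (cases "\<bar>t\<bar> \<le> T")
  case True
  have "\<bar>lin_weight t\<bar> = \<bar>Re (om t * fourier fX t)\<bar> * ((1 / \<phi> t)\<^sup>2 / 2)"
    unfolding lin_weight_def by (simp add: power_divide del: times_complex.sel)
  also have "\<dots> \<le> (\<kappa> * (C\<^sub>2 * (1 + \<bar>t\<bar>) powr (- \<beta>))) * ((B\<^sub>1 * (1 + \<bar>t\<bar>) powr \<alpha>)\<^sup>2 / 2)"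
  proof (intro mult_mono divide_right_mono power_mono \<phi>_lower)
    have "\<bar>Re (om t * fourier fX t)\<bar> \<le> cmod (om t) * cmod (fourier fX t)"
      using abs_Re_le_cmod[of "om t * fourier fX t"] by (simp add: norm_mult)
    also have "\<dots> \<le> \<kappa> * (C\<^sub>2 * (1 + \<bar>t\<bar>) powr (- \<beta>))"
      using om_bound[of t] True const_pos
      by (intro mult_mono fX_decay) (auto simp: indicator_def abs_le_iff)
    finally show "\<bar>Re (om t * fourier fX t)\<bar> \<le> \<kappa> * (C\<^sub>2 * (1 + \<bar>t\<bar>) powr (- \<beta>))" .
  qed (use const_pos \<phi>_pos[of t] in auto)
  also have "\<dots> = \<kappa> * C\<^sub>2 * B\<^sub>1\<^sup>2 / 2 * ((1 + \<bar>t\<bar>) powr (- \<beta>) * ((1 + \<bar>t\<bar>) powr \<alpha>)\<^sup>2)"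
    by (simp add: power_mult_distrib)
  also have "(1 + \<bar>t\<bar>) powr (- \<beta>) * ((1 + \<bar>t\<bar>) powr \<alpha>)\<^sup>2 = (1 + \<bar>t\<bar>) powr (2 * \<alpha> - \<beta>)"
    by (simp add: power2_eq_square powr_add[symmetric])
  finally show ?thesis using True by (simp add: indicator_def abs_le_iff)
qed (simp add: lin_weight_def om_outside indicator_outside)

lemma lin_weight_integrable: "integrable lborel lin_weight"
proof (rule integrable_bounded_compact)
  fix t
  show "norm (lin_weight t) \<le> (\<kappa> * (B\<^sub>1 * (1 + T) powr \<alpha>)\<^sup>2 / 2) * indicator {-T..T} t"
  proof (cases "\<bar>t\<bar> \<le> T")
    case True
    have "\<bar>lin_weight t\<bar> = \<bar>Re (om t * fourier fX t)\<bar> * ((1 / \<phi> t)\<^sup>2 / 2)"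
      unfolding lin_weight_def by (simp add: power_divide del: times_complex.sel)
    also have "\<dots> \<le> (\<kappa> * 1) * ((B\<^sub>1 * (1 + T) powr \<alpha>)\<^sup>2 / 2)"
    proof (intro mult_mono divide_right_mono power_mono inverse_\<phi>_le True)
      have "\<bar>Re (om t * fourier fX t)\<bar> \<le> cmod (om t) * cmod (fourier fX t)"
        using abs_Re_le_cmod[of "om t * fourier fX t"] by (simp add: norm_mult)
      also have "\<dots> \<le> \<kappa> * 1"
        using om_bound[of t] True const_pos
        by (intro mult_mono fourier_density_le_1 fX) (auto simp: indicator_def abs_le_iff)
      finally show "\<bar>Re (om t * fourier fX t)\<bar> \<le> \<kappa> * 1" .
    qed (use const_pos \<phi>_pos[of t] in auto)
    finally show ?thesis using True by (simp add: indicator_def abs_le_iff)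
  qed (simp add: lin_weight_def om_outside indicator_outside)
qed measurable

text \<open>Schur's test yields the L2 norm of the weight instead of the square of its L1 norm,
  hence a first power of the moment of order 4\<alpha>-2\<beta>. The kernel is the squared transform
  of the errors, with decay exponent 2\<alpha>.\<close>

lemma linear_part_bound:
  "(\<integral>\<^sup>+\<omega>. ennreal ((LINT t|lborel. lin_weight t * D (uv \<omega>) t)\<^sup>2) \<partial>P)
    \<le> ennreal (C\<^sub>1 ^ 6 / n) * (4 * (ennreal ((\<kappa> * C\<^sub>2 * B\<^sub>1\<^sup>2 / 2)\<^sup>2) * trunc_moment (4 * \<alpha> - 2 * \<beta>) T)
        * (ennreal (B\<^sub>1\<^sup>2) * decay_integral (2 * \<alpha>)))"
proof -
  have "(\<integral>\<^sup>+\<omega>. ennreal ((LINT t|lborel. lin_weight t * D (uv \<omega>) t)\<^sup>2) \<partial>P)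
      \<le> ennreal (C\<^sub>1 ^ 6 / n) * (\<integral>\<^sup>+s. \<integral>\<^sup>+t. ennreal (\<bar>lin_weight s\<bar> * \<bar>lin_weight t\<bar> *
        ((\<phi> (s + t))\<^sup>2 + (\<phi> (s - t))\<^sup>2)) \<partial>lborel \<partial>lborel)"
    by (rule linear_functional_second_moment[OF lin_weight_integrable])
  also have "(\<integral>\<^sup>+s. \<integral>\<^sup>+t. ennreal (\<bar>lin_weight s\<bar> * \<bar>lin_weight t\<bar> *
        ((\<phi> (s + t))\<^sup>2 + (\<phi> (s - t))\<^sup>2)) \<partial>lborel \<partial>lborel)
      = (\<integral>\<^sup>+s. \<integral>\<^sup>+t. ennreal \<bar>lin_weight s\<bar> * ennreal \<bar>lin_weight t\<bar> *
        (ennreal ((\<phi> (s + t))\<^sup>2) + ennreal ((\<phi> (s - t))\<^sup>2)) \<partial>lborel \<partial>lborel)"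
    by (intro nn_integral_cong) (simp add: ennreal_mult ennreal_plus)
  also have "\<dots> \<le> 4 * (\<integral>\<^sup>+t. (ennreal \<bar>lin_weight t\<bar>)\<^sup>2 \<partial>lborel) * (\<integral>\<^sup>+t. ennreal ((\<phi> t)\<^sup>2) \<partial>lborel)"
    by (rule nn_integral_convolution_form_le) (simp_all add: \<phi>_uminus)
  also have "\<dots> \<le> 4 * (ennreal ((\<kappa> * C\<^sub>2 * B\<^sub>1\<^sup>2 / 2)\<^sup>2) * trunc_moment (4 * \<alpha> - 2 * \<beta>) T)
        * (ennreal (B\<^sub>1\<^sup>2) * decay_integral (2 * \<alpha>))"
  proof (intro mult_mono order_refl)
    have "(ennreal \<bar>lin_weight t\<bar>)\<^sup>2 \<le> ennreal ((\<kappa> * C\<^sub>2 * B\<^sub>1\<^sup>2 / 2)\<^sup>2) * wt (4 * \<alpha> - 2 * \<beta>) t" for t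
    proof (cases "\<bar>t\<bar> \<le> T")
      case True
      have "\<bar>lin_weight t\<bar>\<^sup>2 \<le> (\<kappa> * C\<^sub>2 * B\<^sub>1\<^sup>2 / 2 * (1 + \<bar>t\<bar>) powr (2 * \<alpha> - \<beta>))\<^sup>2"
        using abs_lin_weight[of t] True by (intro power_mono) (auto simp: indicator_def abs_le_iff)
      also have "\<dots> = (\<kappa> * C\<^sub>2 * B\<^sub>1\<^sup>2 / 2)\<^sup>2 * ((1 + \<bar>t\<bar>) powr (2 * \<alpha> - \<beta>))\<^sup>2"
        by (rule power_mult_distrib)
      also have "((1 + \<bar>t\<bar>) powr (2 * \<alpha> - \<beta>))\<^sup>2 = (1 + \<bar>t\<bar>) powr (4 * \<alpha> - 2 * \<beta>)"
        by (simp add: power2_eq_square powr_add[symmetric])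
      finally have "ennreal (\<bar>lin_weight t\<bar>\<^sup>2) \<le> ennreal ((\<kappa> * C\<^sub>2 * B\<^sub>1\<^sup>2 / 2)\<^sup>2) * ennreal ((1 + \<bar>t\<bar>) powr (4 * \<alpha> - 2 * \<beta>))"
        by (subst ennreal_mult[symmetric]) (auto intro: ennreal_leI)
      then show ?thesis using True by (simp add: ennreal_power indicator_def abs_le_iff)
    qed (simp add: lin_weight_def om_outside indicator_outside)
    then have "(\<integral>\<^sup>+t. (ennreal \<bar>lin_weight t\<bar>)\<^sup>2 \<partial>lborel)
        \<le> (\<integral>\<^sup>+t. ennreal ((\<kappa> * C\<^sub>2 * B\<^sub>1\<^sup>2 / 2)\<^sup>2) * wt (4 * \<alpha> - 2 * \<beta>) t \<partial>lborel)"
      by (intro nn_integral_mono)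
    then show "(\<integral>\<^sup>+t. (ennreal \<bar>lin_weight t\<bar>)\<^sup>2 \<partial>lborel)
        \<le> ennreal ((\<kappa> * C\<^sub>2 * B\<^sub>1\<^sup>2 / 2)\<^sup>2) * trunc_moment (4 * \<alpha> - 2 * \<beta>) T"
      by (simp add: nn_integral_cmult trunc_moment_wt)
    have "ennreal ((\<phi> t)\<^sup>2) \<le> ennreal (B\<^sub>1\<^sup>2) * ennreal ((1 + \<bar>t\<bar>) powr (- (2 * \<alpha>)))" for t
    proof -
      have "(\<phi> t)\<^sup>2 \<le> (B\<^sub>1 * (1 + \<bar>t\<bar>) powr (- \<alpha>))\<^sup>2"
        using \<phi>_upper[of t] \<phi>_pos[of t] by (intro power_mono) auto
      also have "\<dots> = B\<^sub>1\<^sup>2 * ((1 + \<bar>t\<bar>) powr (- \<alpha>))\<^sup>2" by (rule power_mult_distrib)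
      also have "((1 + \<bar>t\<bar>) powr (- \<alpha>))\<^sup>2 = (1 + \<bar>t\<bar>) powr (- (2 * \<alpha>))"
        by (simp add: power2_eq_square powr_add[symmetric])
      finally show ?thesis by (subst ennreal_mult[symmetric]) (auto intro: ennreal_leI)
    qed
    then have "(\<integral>\<^sup>+t. ennreal ((\<phi> t)\<^sup>2) \<partial>lborel)
        \<le> (\<integral>\<^sup>+t. ennreal (B\<^sub>1\<^sup>2) * ennreal ((1 + \<bar>t\<bar>) powr (- (2 * \<alpha>))) \<partial>lborel)"
      by (intro nn_integral_mono)
    then show "(\<integral>\<^sup>+t. ennreal ((\<phi> t)\<^sup>2) \<partial>lborel) \<le> ennreal (B\<^sub>1\<^sup>2) * decay_integral (2 * \<alpha>)"
      by (simp add: nn_integral_cmult decay_integral_def)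
  qed auto
  finally show ?thesis by (simp add: mult_left_mono)
qed

text \<open>What the linear part leaves: the second-order error of \<open>R\<close> at the true
  \<open>\<phi>\<close>, and the product of two small quantities, \<open>R\<close> and the
  fluctuation of \<open>\<phi>_tilde\<close>. Both are of order 1/n.\<close>

definition remainder :: "(nat \<times> nat \<Rightarrow> real) \<Rightarrow> real \<Rightarrow> complex" where
  "remainder v t = om t * fourier fX t *
    (complex_of_real (R2 v t * \<phi> t) + complex_of_real (R v t) * (\<phi>_tilde v t - \<phi> t))"

lemma remainder_measurable[measurable]: "remainder v \<in> borel_measurable borel"
  unfolding remainder_def by measurable

text \<open>The first piece has exponent 5\<alpha>-\<alpha> because \<open>\<phi>\<close> decays;
  the second has only 3\<alpha> and is enlarged to 4\<alpha>. The transform of \<open>fX\<close>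
  contributes -\<beta> to both.\<close>

lemma remainder_le:
  "ennreal (cmod (remainder v t)) \<le> ennreal (\<kappa> * C\<^sub>2 * A / n) *
    (wt (4 * \<alpha> - \<beta>) t * ennreal (Y v t * (B\<^sub>1 + dev v t)))"
proof (cases "\<bar>t\<bar> \<le> T")
  case True
  have Y0: "0 \<le> Y v t" using Y_ge_1[of v t] by linarith
  have g1: "1 + \<bar>t\<bar> \<ge> 1" by simp
  let ?g = "\<lambda>x. (1 + \<bar>t\<bar>) powr x"
  have "\<bar>R2 v t * \<phi> t\<bar> \<le> (A / n * ?g (5 * \<alpha>) * Y v t) * (B\<^sub>1 * ?g (- \<alpha>))"
    unfolding abs_mult using R2_bound[OF True, of v] \<phi>_upper[of t] \<phi>_pos[of t] Y0 const_pos
    by (intro mult_mono) auto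
  also have "\<dots> = A / n * (?g (5 * \<alpha>) * ?g (- \<alpha>)) * Y v t * B\<^sub>1" by simp
  also have "?g (5 * \<alpha>) * ?g (- \<alpha>) = ?g (4 * \<alpha>)" by (simp add: powr_add[symmetric])
  finally have 1: "\<bar>R2 v t * \<phi> t\<bar> \<le> A / n * ?g (4 * \<alpha>) * Y v t * B\<^sub>1" .
  have "cmod (complex_of_real (R v t) * (\<phi>_tilde v t - \<phi> t)) = \<bar>R v t\<bar> * (dev v t / sqrt n)"
    using n by (simp add: norm_mult dev_def)
  also have "\<dots> \<le> (A / sqrt n * ?g (3 * \<alpha>) * Y v t) * (dev v t / sqrt n)"
    using R_bound[OF True, of v] dev_nonneg[of v t] by (intro mult_right_mono) auto
  also have "\<dots> = A / n * ?g (3 * \<alpha>) * Y v t * dev v t"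
    by simp
  also have "\<dots> \<le> A / n * ?g (4 * \<alpha>) * Y v t * dev v t"
    using \<alpha> const_pos Y0 dev_nonneg[of v t] by (intro mult_right_mono mult_left_mono powr_mono) auto
  finally have 2: "cmod (complex_of_real (R v t) * (\<phi>_tilde v t - \<phi> t)) \<le> A / n * ?g (4 * \<alpha>) * Y v t * dev v t" .
  have "cmod (remainder v t) \<le> (\<kappa> * (C\<^sub>2 * ?g (- \<beta>))) *
      (A / n * ?g (4 * \<alpha>) * Y v t * B\<^sub>1 + A / n * ?g (4 * \<alpha>) * Y v t * dev v t)"
    unfolding remainder_def norm_mult
  proof (intro mult_mono)
    show "cmod (om t) \<le> \<kappa>" using om_bound[of t] True by (simp add: indicator_def abs_le_iff)
    show "cmod (complex_of_real (R2 v t * \<phi> t) + complex_of_real (R v t) * (\<phi>_tilde v t - \<phi> t))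
        \<le> A / n * ?g (4 * \<alpha>) * Y v t * B\<^sub>1 + A / n * ?g (4 * \<alpha>) * Y v t * dev v t"
      using 1 2 by (intro order_trans[OF norm_triangle_ineq] add_mono) (auto simp only: norm_of_real)
  qed (use const_pos fX_decay in auto)
  also have "\<dots> = \<kappa> * C\<^sub>2 * A / n * ((?g (4 * \<alpha>) * ?g (- \<beta>)) * (Y v t * (B\<^sub>1 + dev v t)))"
    by (simp add: algebra_simps)
  also have "?g (4 * \<alpha>) * ?g (- \<beta>) = ?g (4 * \<alpha> - \<beta>)" by (simp add: powr_add[symmetric])
  finally have "ennreal (cmod (remainder v t))
      \<le> ennreal (\<kappa> * C\<^sub>2 * A / n * (?g (4 * \<alpha> - \<beta>) * (Y v t * (B\<^sub>1 + dev v t))))"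
    by (rule ennreal_leI)
  also have "\<dots> = ennreal (\<kappa> * C\<^sub>2 * A / n) * (wt (4 * \<alpha> - \<beta>) t * ennreal (Y v t * (B\<^sub>1 + dev v t)))"
  proof -
    have "0 \<le> \<kappa> * C\<^sub>2 * A / n" "0 \<le> Y v t * (B\<^sub>1 + dev v t)"
      using const_pos Y0 dev_nonneg[of v t] by auto
    then show ?thesis using True
      by (simp only: ennreal_mult mult_nonneg_nonneg powr_ge_zero) (simp add: indicator_def abs_le_iff)
  qed
  finally show ?thesis .
qed (simp add: remainder_def om_outside)

lemma remainder_part_bound:
  "(\<integral>\<^sup>+\<omega>. (\<integral>\<^sup>+t. ennreal (cmod (remainder (uv \<omega>) t)) \<partial>lborel)\<^sup>2 \<partial>P)
    \<le> (ennreal (\<kappa> * C\<^sub>2 * A / n))\<^sup>2 * (2 * ennreal (ridge_moment C\<^sub>1 q + 8 * (B\<^sub>1 ^ 4 + empirical_moment C\<^sub>1))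
        * (trunc_moment (4 * \<alpha> - \<beta>) T)\<^sup>2)"
proof -
  let ?k = "ennreal (\<kappa> * C\<^sub>2 * A / n)"
  let ?B = "\<lambda>t \<omega>. ennreal (Y (uv \<omega>) t * (B\<^sub>1 + dev (uv \<omega>) t))"
  have "(\<integral>\<^sup>+\<omega>. (\<integral>\<^sup>+t. ennreal (cmod (remainder (uv \<omega>) t)) \<partial>lborel)\<^sup>2 \<partial>P)
      \<le> (\<integral>\<^sup>+\<omega>. ?k\<^sup>2 * (\<integral>\<^sup>+t. wt (4 * \<alpha> - \<beta>) t * ?B t \<omega> \<partial>lborel)\<^sup>2 \<partial>P)"
  proof (intro nn_integral_mono)
    fix \<omega>
    have "(\<integral>\<^sup>+t. ennreal (cmod (remainder (uv \<omega>) t)) \<partial>lborel)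
        \<le> (\<integral>\<^sup>+t. ?k * (wt (4 * \<alpha> - \<beta>) t * ?B t \<omega>) \<partial>lborel)"
      by (intro nn_integral_mono remainder_le)
    also have "\<dots> = ?k * (\<integral>\<^sup>+t. wt (4 * \<alpha> - \<beta>) t * ?B t \<omega> \<partial>lborel)"
      by (rule nn_integral_cmult) measurable
    finally show "(\<integral>\<^sup>+t. ennreal (cmod (remainder (uv \<omega>) t)) \<partial>lborel)\<^sup>2
        \<le> ?k\<^sup>2 * (\<integral>\<^sup>+t. wt (4 * \<alpha> - \<beta>) t * ?B t \<omega> \<partial>lborel)\<^sup>2"
      by (simp only: power_mult_distrib[symmetric]) (rule power_mono, auto)
  qed
  also have "\<dots> = ?k\<^sup>2 * (\<integral>\<^sup>+\<omega>. (\<integral>\<^sup>+t. wt (4 * \<alpha> - \<beta>) t * ?B t \<omega> \<partial>lborel)\<^sup>2 \<partial>P)"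
    by (rule nn_integral_cmult) measurable
  also have "(\<integral>\<^sup>+\<omega>. (\<integral>\<^sup>+t. wt (4 * \<alpha> - \<beta>) t * ?B t \<omega> \<partial>lborel)\<^sup>2 \<partial>P)
      \<le> 2 * ennreal (ridge_moment C\<^sub>1 q + 8 * (B\<^sub>1 ^ 4 + empirical_moment C\<^sub>1)) * (\<integral>\<^sup>+t. wt (4 * \<alpha> - \<beta>) t \<partial>lborel)\<^sup>2"
    by (rule nn_integral_power2_integral_le[OF sigma_finite_sample_lborel]) (measurable, rule Y_dev_square_moment)
  finally show ?thesis by (simp add: trunc_moment_wt mult_left_mono)
qed

lemma mean_decomposition:
  "(LINT t|lborel. Re (amp v t * (fourier fX t * \<phi>_tilde v t)))
    = (LINT t|lborel. lin_weight t * D v t) + (LINT t|lborel. Re (remainder v t))"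
proof -
  have eq: "Re (amp v t * (fourier fX t * \<phi>_tilde v t)) = lin_weight t * D v t + Re (remainder v t)" for t
  proof -
    \<comment> \<open>The cubic denominator of the linear part becomes a square after multiplication
      by \<open>\<phi> t\<close>, which is how \<open>lin_weight\<close> arises.\<close>
    have R: "R v t * \<phi> t = R2 v t * \<phi> t - D v t / (2 * (\<phi> t)\<^sup>2)"
      unfolding R2_def using \<phi>_pos[of t] by (simp add: field_simps eval_nat_numeral)
    have "amp v t * (fourier fX t * \<phi>_tilde v t)
        = om t * fourier fX t * (complex_of_real (R v t * \<phi> t) + complex_of_real (R v t) * (\<phi>_tilde v t - \<phi> t))"
      by (simp add: amp_def algebra_simps)
    also have "\<dots> = remainder v t - complex_of_real (D v t / (2 * (\<phi> t)\<^sup>2)) * (om t * fourier fX t)"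
      unfolding R remainder_def by (simp add: algebra_simps)
    finally have "Re (amp v t * (fourier fX t * \<phi>_tilde v t))
        = Re (remainder v t) - D v t / (2 * (\<phi> t)\<^sup>2) * Re (om t * fourier fX t)"
      by (simp only: minus_complex.sel Re_complex_of_real times_complex.sel Im_complex_of_real)
    then show ?thesis by (simp add: lin_weight_def mult.commute del: times_complex.sel)
  qed
  have int1: "integrable lborel (\<lambda>t. Re (amp v t * (fourier fX t * \<phi>_tilde v t)))"
  proof (intro integrable_Re integrable_mult_bounded[OF amp_integrable, where B = 1])
    fix t show "norm (fourier fX t * \<phi>_tilde v t) \<le> 1"
      using mult_mono[OF fourier_density_le_1[OF fX, of t] \<phi>_tilde_le_1[of v t]] by (simp add: norm_mult)
  qed measurable
  have int2: "integrable lborel (\<lambda>t. lin_weight t * D v t)"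
  proof (rule Bochner_Integration.integrable_bound[where f = "\<lambda>t. 2 * lin_weight t"])
    have "\<bar>D v t\<bar> \<le> 2" for t
    proof -
      have "(\<phi> t)\<^sup>2 \<le> 1" using \<phi>_pos[of t] \<phi>_le_1[of t] by (simp add: power_le_one)
      then show ?thesis using abs_\<psi>_hat_le_1[of v t] zero_le_power2[of "\<phi> t"] unfolding D_def by linarith
    qed
    then have "\<bar>lin_weight t\<bar> * \<bar>D v t\<bar> \<le> \<bar>lin_weight t\<bar> * 2" for t
      by (intro mult_left_mono) auto
    then show "AE t in lborel. norm (lin_weight t * D v t) \<le> norm (2 * lin_weight t)"
      by (simp add: abs_mult mult.commute)
  qed (use lin_weight_integrable in auto)
  \<comment> \<open>Integrability of the remainder is obtained as that of a difference of two
    integrable functions, with no separate estimate.\<close>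
  have "integrable lborel (\<lambda>t. Re (amp v t * (fourier fX t * \<phi>_tilde v t)) - lin_weight t * D v t)"
    using int1 int2 by (rule Bochner_Integration.integrable_diff)
  then have int3: "integrable lborel (\<lambda>t. Re (remainder v t))" unfolding eq by simp
  show ?thesis unfolding eq by (rule Bochner_Integration.integral_add[OF int2 int3])
qed

lemma mean_term_bound:
  "(\<integral>\<^sup>+\<omega>. ennreal ((LINT t|lborel. Re (amp (uv \<omega>) t * (fourier fX t * \<phi>_tilde (uv \<omega>) t)))\<^sup>2) \<partial>P)
    \<le> lin_const C\<^sub>1 \<alpha> B\<^sub>1 C\<^sub>2 \<kappa> * (ennreal (1 / n) * trunc_moment (4 * \<alpha> - 2 * \<beta>) T)
      + quad_const C\<^sub>1 B\<^sub>1 C\<^sub>2 \<kappa> A q * (ennreal (1 / (real n)\<^sup>2) * (trunc_moment (4 * \<alpha> - \<beta>) T)\<^sup>2)"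
proof -
  let ?lin = "\<lambda>\<omega>. LINT t|lborel. lin_weight t * D (uv \<omega>) t"
  let ?rem = "\<lambda>\<omega>. \<integral>\<^sup>+t. ennreal (cmod (remainder (uv \<omega>) t)) \<partial>lborel"
  have rem_meas: "?rem \<in> borel_measurable P"
    unfolding remainder_def R2_def by measurable
  have "(\<integral>\<^sup>+\<omega>. ennreal ((LINT t|lborel. Re (amp (uv \<omega>) t * (fourier fX t * \<phi>_tilde (uv \<omega>) t)))\<^sup>2) \<partial>P)
      \<le> (\<integral>\<^sup>+\<omega>. 2 * ennreal ((?lin \<omega>)\<^sup>2) + 2 * (?rem \<omega>)\<^sup>2 \<partial>P)"
  proof (intro nn_integral_mono)
    fix \<omega>
    let ?r = "LINT t|lborel. Re (remainder (uv \<omega>) t)"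
    have "(x + y)\<^sup>2 \<le> 2 * x\<^sup>2 + 2 * y\<^sup>2" for x y :: real
      using zero_le_power2[of "x - y"] by (simp add: power2_sum power2_diff)
    then have "ennreal ((LINT t|lborel. Re (amp (uv \<omega>) t * (fourier fX t * \<phi>_tilde (uv \<omega>) t)))\<^sup>2)
        \<le> ennreal (2 * (?lin \<omega>)\<^sup>2 + 2 * ?r\<^sup>2)"
      unfolding mean_decomposition by (rule ennreal_leI)
    also have "\<dots> = 2 * ennreal ((?lin \<omega>)\<^sup>2) + 2 * ennreal (?r\<^sup>2)"
      by (simp add: ennreal_plus ennreal_mult')
    also have "ennreal (?r\<^sup>2) \<le> (?rem \<omega>)\<^sup>2"
    proof -
      \<comment> \<open>In the non-integrable case the integral has the default value 0 and the
        bound is trivial.\<close>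
      have "ennreal \<bar>?r\<bar> \<le> (\<integral>\<^sup>+t. ennreal \<bar>Re (remainder (uv \<omega>) t)\<bar> \<partial>lborel)"
        using integral_norm_bound_ennreal[of lborel "\<lambda>t. Re (remainder (uv \<omega>) t)"]
        by (cases "integrable lborel (\<lambda>t. Re (remainder (uv \<omega>) t))") (auto simp: not_integrable_integral_eq)
      also have "\<dots> \<le> ?rem \<omega>"
        by (intro nn_integral_mono ennreal_leI abs_Re_le_cmod)
      finally have "(ennreal \<bar>?r\<bar>)\<^sup>2 \<le> (?rem \<omega>)\<^sup>2" by (intro power_mono) auto
      then show ?thesis by (simp add: ennreal_power)
    qed
    finally show "ennreal ((LINT t|lborel. Re (amp (uv \<omega>) t * (fourier fX t * \<phi>_tilde (uv \<omega>) t)))\<^sup>2)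
        \<le> 2 * ennreal ((?lin \<omega>)\<^sup>2) + 2 * (?rem \<omega>)\<^sup>2" by (simp add: add_left_mono mult_left_mono)
  qed
  also have "\<dots> = 2 * (\<integral>\<^sup>+\<omega>. ennreal ((?lin \<omega>)\<^sup>2) \<partial>P) + 2 * (\<integral>\<^sup>+\<omega>. (?rem \<omega>)\<^sup>2 \<partial>P)"
    using rem_meas by (subst nn_integral_add, measurable) (simp add: nn_integral_cmult)
  also have "\<dots> \<le> 2 * (ennreal (C\<^sub>1 ^ 6 / n) * (4 * (ennreal ((\<kappa> * C\<^sub>2 * B\<^sub>1\<^sup>2 / 2)\<^sup>2) * trunc_moment (4 * \<alpha> - 2 * \<beta>) T)
        * (ennreal (B\<^sub>1\<^sup>2) * decay_integral (2 * \<alpha>))))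
      + 2 * ((ennreal (\<kappa> * C\<^sub>2 * A / n))\<^sup>2 * (2 * ennreal (ridge_moment C\<^sub>1 q + 8 * (B\<^sub>1 ^ 4 + empirical_moment C\<^sub>1))
        * (trunc_moment (4 * \<alpha> - \<beta>) T)\<^sup>2))"
    by (intro add_mono mult_left_mono linear_part_bound remainder_part_bound) auto
  also have "2 * (ennreal (C\<^sub>1 ^ 6 / n) * (4 * (ennreal ((\<kappa> * C\<^sub>2 * B\<^sub>1\<^sup>2 / 2)\<^sup>2) * trunc_moment (4 * \<alpha> - 2 * \<beta>) T)
        * (ennreal (B\<^sub>1\<^sup>2) * decay_integral (2 * \<alpha>))))
      = lin_const C\<^sub>1 \<alpha> B\<^sub>1 C\<^sub>2 \<kappa> * (ennreal (1 / n) * trunc_moment (4 * \<alpha> - 2 * \<beta>) T)"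
  proof -
    have 1: "ennreal (C\<^sub>1 ^ 6 / n) = ennreal (C\<^sub>1 ^ 6) * ennreal (1 / n)"
      using C\<^sub>1 by (subst ennreal_mult[symmetric]) auto
    have 2: "ennreal (C\<^sub>1 ^ 6 * (\<kappa> * C\<^sub>2 * B\<^sub>1\<^sup>2 / 2)\<^sup>2 * B\<^sub>1\<^sup>2)
        = ennreal (C\<^sub>1 ^ 6) * ennreal ((\<kappa> * C\<^sub>2 * B\<^sub>1\<^sup>2 / 2)\<^sup>2) * ennreal (B\<^sub>1\<^sup>2)"
    proof -
      have "0 \<le> C\<^sub>1 ^ 6" using C\<^sub>1 by simp
      then show ?thesis by (simp only: ennreal_mult zero_le_power2 mult_nonneg_nonneg)
    qed
    have 3: "(2 :: ennreal) * 4 = 8" by simp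
    show ?thesis unfolding lin_const_def 1 2 3[symmetric] by (simp only: mult_ac)
  qed
  also have "2 * ((ennreal (\<kappa> * C\<^sub>2 * A / n))\<^sup>2 * (2 * ennreal (ridge_moment C\<^sub>1 q + 8 * (B\<^sub>1 ^ 4 + empirical_moment C\<^sub>1))
        * (trunc_moment (4 * \<alpha> - \<beta>) T)\<^sup>2))
      = quad_const C\<^sub>1 B\<^sub>1 C\<^sub>2 \<kappa> A q * (ennreal (1 / (real n)\<^sup>2) * (trunc_moment (4 * \<alpha> - \<beta>) T)\<^sup>2)"
  proof -
    let ?E = "ridge_moment C\<^sub>1 q + 8 * (B\<^sub>1 ^ 4 + empirical_moment C\<^sub>1)"
    have E: "0 \<le> ?E" using C\<^sub>1 by (auto simp: ridge_moment_def empirical_moment_def)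
    have k: "0 \<le> \<kappa> * C\<^sub>2 * A / n" using const_pos by simp
    have "(ennreal (\<kappa> * C\<^sub>2 * A / n))\<^sup>2 = ennreal ((\<kappa> * C\<^sub>2 * A)\<^sup>2 * (1 / (real n)\<^sup>2))"
      unfolding ennreal_power[OF k] by (simp add: power_divide)
    also have "\<dots> = ennreal ((\<kappa> * C\<^sub>2 * A)\<^sup>2) * ennreal (1 / (real n)\<^sup>2)"
      by (rule ennreal_mult) auto
    finally have 1: "(ennreal (\<kappa> * C\<^sub>2 * A / n))\<^sup>2 = \<dots>" .
    have 2: "ennreal ((\<kappa> * C\<^sub>2 * A)\<^sup>2 * ?E) = ennreal ((\<kappa> * C\<^sub>2 * A)\<^sup>2) * ennreal ?E"
      using E by (intro ennreal_mult) auto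
    have 3: "(2 :: ennreal) * 2 = 4" by simp
    show ?thesis unfolding quad_const_def 1 2 3[symmetric] by (simp only: mult_ac)
  qed
  finally show ?thesis .
qed

end

section \<open>The conditional variance\<close>

definition rough_const :: "real \<Rightarrow> real \<Rightarrow> real \<Rightarrow> nat \<Rightarrow> ennreal" where
  "rough_const C\<^sub>1 \<kappa> A q = 4 * ennreal ((\<kappa> * A)\<^sup>2) * ennreal (ridge_moment C\<^sub>1 q)"

definition smooth_const :: "real \<Rightarrow> real \<Rightarrow> real \<Rightarrow> real \<Rightarrow> real \<Rightarrow> real \<Rightarrow> real \<Rightarrow> nat \<Rightarrow> ennreal" where
  "smooth_const C\<^sub>1 \<alpha> \<beta> B\<^sub>1 C\<^sub>2 \<kappa> A q = 4 * ennreal ((\<kappa> * A)\<^sup>2) * ennreal (ridge_moment C\<^sub>1 q)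
    * (ennreal (C\<^sub>2 * B\<^sub>1) * decay_integral (\<alpha> + \<beta>))"

text \<open>The 2 counts the frequencies \<open>s + t\<close> and \<open>s - t\<close>; the moment
  is that of two \<open>Y\<close> factors and one \<open>dev\<close>.\<close>

definition fluctuation_const :: "real \<Rightarrow> real \<Rightarrow> real \<Rightarrow> nat \<Rightarrow> ennreal" where
  "fluctuation_const C\<^sub>1 \<kappa> A q =
    2 * ennreal ((\<kappa> * A)\<^sup>2) * ennreal (2 * ridge_moment C\<^sub>1 q + empirical_moment C\<^sub>1 + 1)"

context deconvolution_setting
begin

text \<open>The quadratic form that \<open>conditional_second_moment\<close> produces for the
  amplitude \<open>amp v\<close>.\<close>

definition noise_form :: "(nat \<times> nat \<Rightarrow> real) \<Rightarrow> ennreal" where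
  "noise_form v = (\<integral>\<^sup>+s. \<integral>\<^sup>+t. ennreal (cmod (amp v s) * cmod (amp v t) *
        (cmod (fourier fX (s + t) * \<phi>_tilde v (s + t))
         + cmod (fourier fX (s - t) * \<phi>_tilde v (s - t)))) \<partial>lborel \<partial>lborel)"

lemma amp_scale_square: "(ennreal (\<kappa> * A / sqrt n))\<^sup>2 = ennreal ((\<kappa> * A)\<^sup>2) * ennreal (1 / n)"
proof -
  have "0 \<le> \<kappa> * A / sqrt n" using const_pos by simp
  then have "(ennreal (\<kappa> * A / sqrt n))\<^sup>2 = ennreal ((\<kappa> * A)\<^sup>2 * (1 / n))"
    by (simp add: ennreal_power power_divide)
  also have "\<dots> = ennreal ((\<kappa> * A)\<^sup>2) * ennreal (1 / n)" by (rule ennreal_mult) auto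
  finally show ?thesis .
qed

text \<open>The transform of \<open>fX\<close> times \<open>\<phi>_tilde\<close> has modulus at most
  1, so the form is at most twice the square of the integral of \<open>cmod (amp v t)\<close>; the
  integral form of Minkowski's inequality then takes the expectation.\<close>

lemma rough_noise_bound:
  "(\<integral>\<^sup>+\<omega>. noise_form (uv \<omega>) \<partial>P) \<le> rough_const C\<^sub>1 \<kappa> A q * (ennreal (1 / n) * (trunc_moment (3 * \<alpha>) T)\<^sup>2)"
proof -
  let ?k = "ennreal (\<kappa> * A / sqrt n)"
  let ?I = "\<lambda>\<omega>. \<integral>\<^sup>+t. wt (3 * \<alpha>) t * ennreal (Y (uv \<omega>) t) \<partial>lborel"
  have form: "noise_form v \<le> 2 * (\<integral>\<^sup>+t. ennreal (cmod (amp v t)) \<partial>lborel)\<^sup>2" for v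
  proof -
    have "noise_form v \<le> (\<integral>\<^sup>+s. \<integral>\<^sup>+t. 2 * (ennreal (cmod (amp v s)) * ennreal (cmod (amp v t))) \<partial>lborel \<partial>lborel)"
      unfolding noise_form_def
    proof (intro nn_integral_mono)
      fix s t
      have le1: "cmod (fourier fX r * \<phi>_tilde v r) \<le> 1" for r
        using mult_mono[OF fourier_density_le_1[OF fX, of r] \<phi>_tilde_le_1[of v r]] by (simp add: norm_mult)
      have "cmod (amp v s) * cmod (amp v t) * (cmod (fourier fX (s + t) * \<phi>_tilde v (s + t))
         + cmod (fourier fX (s - t) * \<phi>_tilde v (s - t))) \<le> cmod (amp v s) * cmod (amp v t) * (1 + 1)"
        by (intro mult_left_mono add_mono le1) auto
      then have "ennreal (cmod (amp v s) * cmod (amp v t) * (cmod (fourier fX (s + t) * \<phi>_tilde v (s + t))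
         + cmod (fourier fX (s - t) * \<phi>_tilde v (s - t)))) \<le> ennreal (2 * (cmod (amp v s) * cmod (amp v t)))"
        by (intro ennreal_leI) simp
      then show "ennreal (cmod (amp v s) * cmod (amp v t) * (cmod (fourier fX (s + t) * \<phi>_tilde v (s + t))
         + cmod (fourier fX (s - t) * \<phi>_tilde v (s - t)))) \<le> 2 * (ennreal (cmod (amp v s)) * ennreal (cmod (amp v t)))"
        by (simp add: ennreal_mult)
    qed
    also have "\<dots> = 2 * (\<integral>\<^sup>+s. \<integral>\<^sup>+t. ennreal (cmod (amp v s)) * ennreal (cmod (amp v t)) \<partial>lborel \<partial>lborel)"
      by (simp add: nn_integral_cmult)
    also have "(\<integral>\<^sup>+s. \<integral>\<^sup>+t. ennreal (cmod (amp v s)) * ennreal (cmod (amp v t)) \<partial>lborel \<partial>lborel)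
        = (\<integral>\<^sup>+t. ennreal (cmod (amp v t)) \<partial>lborel)\<^sup>2"
      by (rule nn_integral_square_eq[symmetric]) measurable
    finally show ?thesis .
  qed
  have "(\<integral>\<^sup>+\<omega>. noise_form (uv \<omega>) \<partial>P) \<le> (\<integral>\<^sup>+\<omega>. 2 * (?k\<^sup>2 * (?I \<omega>)\<^sup>2) \<partial>P)"
  proof (intro nn_integral_mono)
    fix \<omega>
    have "(\<integral>\<^sup>+t. ennreal (cmod (amp (uv \<omega>) t)) \<partial>lborel) \<le> (\<integral>\<^sup>+t. ?k * (wt (3 * \<alpha>) t * ennreal (Y (uv \<omega>) t)) \<partial>lborel)"
      by (intro nn_integral_mono amp_le)
    also have "\<dots> = ?k * ?I \<omega>"
      by (rule nn_integral_cmult) measurable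
    finally have "(\<integral>\<^sup>+t. ennreal (cmod (amp (uv \<omega>) t)) \<partial>lborel)\<^sup>2 \<le> ?k\<^sup>2 * (?I \<omega>)\<^sup>2"
      by (simp only: power_mult_distrib[symmetric]) (rule power_mono, auto)
    then show "noise_form (uv \<omega>) \<le> 2 * (?k\<^sup>2 * (?I \<omega>)\<^sup>2)"
      using form[of "uv \<omega>"] by (meson mult_left_mono order_trans zero_le)
  qed
  also have "\<dots> = 2 * (?k\<^sup>2 * (\<integral>\<^sup>+\<omega>. (?I \<omega>)\<^sup>2 \<partial>P))"
    by (subst nn_integral_cmult, measurable) (subst nn_integral_cmult, measurable)
  also have "\<dots> \<le> 2 * (?k\<^sup>2 * (2 * ennreal (ridge_moment C\<^sub>1 q) * (\<integral>\<^sup>+t. wt (3 * \<alpha>) t \<partial>lborel)\<^sup>2))"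
    by (intro mult_left_mono nn_integral_power2_integral_le[OF sigma_finite_sample_lborel])
      (measurable, auto intro: Y_square_moment)
  also have "\<dots> = rough_const C\<^sub>1 \<kappa> A q * (ennreal (1 / n) * (trunc_moment (3 * \<alpha>) T)\<^sup>2)"
  proof -
    have 2: "(2 :: ennreal) * 2 = 4" by simp
    show ?thesis
      unfolding rough_const_def amp_scale_square trunc_moment_wt 2[symmetric] by (simp only: mult_ac)
  qed
  finally show ?thesis .
qed

text \<open>In the kernel, \<open>\<phi>_tilde\<close> is split into \<open>\<phi>\<close>, whose
  product with the transform of \<open>fX\<close> has decay exponent \<alpha>+\<beta>, and a
  fluctuation of order n^(-1/2). Schur's test handles the first part and gives the single moment of
  order 6\<alpha>; the second is bounded absolutely, as the square of the moment of order
  3\<alpha>.\<close>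

lemma smooth_noise_bound:
  "(\<integral>\<^sup>+\<omega>. noise_form (uv \<omega>) \<partial>P)
    \<le> smooth_const C\<^sub>1 \<alpha> \<beta> B\<^sub>1 C\<^sub>2 \<kappa> A q * (ennreal (1 / n) * trunc_moment (6 * \<alpha>) T)
      + fluctuation_const C\<^sub>1 \<kappa> A q * (ennreal (1 / (n * sqrt n)) * (trunc_moment (3 * \<alpha>) T)\<^sup>2)"
proof -
  let ?k = "ennreal (\<kappa> * A / sqrt n)"
  define e where "e v t = ennreal (cmod (amp v t))" for v t
  define c where "c r = ennreal (C\<^sub>2 * B\<^sub>1) * ennreal ((1 + \<bar>r\<bar>) powr (- (\<alpha> + \<beta>)))" for r
  define d where "d v r = ennreal (dev v r / sqrt n)" for v r
  have [measurable]: "c \<in> borel_measurable borel" "d v \<in> borel_measurable borel" "e v \<in> borel_measurable borel" for v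
    unfolding c_def d_def e_def by measurable
  have [measurable]: "(\<lambda>z. d (uv (g z)) (f z)) \<in> borel_measurable K"
    if [measurable]: "f \<in> measurable K borel" "g \<in> measurable K P" for f g and K :: "'d measure"
    unfolding d_def by measurable
  have chi: "cmod (fourier fX r * \<phi>_tilde v r) \<le> C\<^sub>2 * B\<^sub>1 * (1 + \<bar>r\<bar>) powr (- (\<alpha> + \<beta>)) + dev v r / sqrt n" for v r
  proof -
    have "fourier fX r * \<phi>_tilde v r = fourier fX r * \<phi> r + fourier fX r * (\<phi>_tilde v r - \<phi> r)"
      by (simp add: algebra_simps)
    then have "cmod (fourier fX r * \<phi>_tilde v r)
        \<le> cmod (fourier fX r) * \<phi> r + cmod (fourier fX r) * cmod (\<phi>_tilde v r - \<phi> r)"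
      using norm_triangle_ineq[of "fourier fX r * \<phi> r" "fourier fX r * (\<phi>_tilde v r - \<phi> r)"] \<phi>_pos[of r]
      by (simp add: norm_mult)
    also have "\<dots> \<le> (C\<^sub>2 * (1 + \<bar>r\<bar>) powr (- \<beta>)) * (B\<^sub>1 * (1 + \<bar>r\<bar>) powr (- \<alpha>)) + 1 * cmod (\<phi>_tilde v r - \<phi> r)"
      using const_pos \<phi>_pos[of r]
      by (intro add_mono mult_mono fX_decay \<phi>_upper fourier_density_le_1 fX) auto
    also have "(C\<^sub>2 * (1 + \<bar>r\<bar>) powr (- \<beta>)) * (B\<^sub>1 * (1 + \<bar>r\<bar>) powr (- \<alpha>))
        = C\<^sub>2 * B\<^sub>1 * ((1 + \<bar>r\<bar>) powr (- \<beta>) * (1 + \<bar>r\<bar>) powr (- \<alpha>))" by simp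
    also have "(1 + \<bar>r\<bar>) powr (- \<beta>) * (1 + \<bar>r\<bar>) powr (- \<alpha>) = (1 + \<bar>r\<bar>) powr (- (\<alpha> + \<beta>))"
      unfolding powr_add[symmetric] by (rule arg_cong[of _ _ "(powr) (1 + \<bar>r\<bar>)"]) simp
    finally show ?thesis using n by (simp add: dev_def)
  qed
  have chi': "ennreal (cmod (fourier fX r * \<phi>_tilde v r)) \<le> c r + d v r" for v r
  proof -
    have "ennreal (cmod (fourier fX r * \<phi>_tilde v r))
        \<le> ennreal (C\<^sub>2 * B\<^sub>1 * (1 + \<bar>r\<bar>) powr (- (\<alpha> + \<beta>)) + dev v r / sqrt n)"
      by (rule ennreal_leI[OF chi])
    also have "\<dots> = ennreal (C\<^sub>2 * B\<^sub>1 * (1 + \<bar>r\<bar>) powr (- (\<alpha> + \<beta>))) + d v r"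
      unfolding d_def using const_pos dev_nonneg[of v r] by (intro ennreal_plus) auto
    also have "ennreal (C\<^sub>2 * B\<^sub>1 * (1 + \<bar>r\<bar>) powr (- (\<alpha> + \<beta>))) = c r"
      unfolding c_def using const_pos by (intro ennreal_mult) auto
    finally show ?thesis .
  qed
  have form: "noise_form v \<le> 4 * (\<integral>\<^sup>+t. (e v t)\<^sup>2 \<partial>lborel) * (\<integral>\<^sup>+t. c t \<partial>lborel)
      + (\<integral>\<^sup>+s. \<integral>\<^sup>+t. e v s * e v t * (d v (s + t) + d v (s - t)) \<partial>lborel \<partial>lborel)" for v
  proof -
    have "noise_form v \<le> (\<integral>\<^sup>+s. \<integral>\<^sup>+t. e v s * e v t * (c (s + t) + c (s - t))
        + e v s * e v t * (d v (s + t) + d v (s - t)) \<partial>lborel \<partial>lborel)"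
      unfolding noise_form_def
    proof (intro nn_integral_mono)
      fix s t
      have "ennreal (cmod (amp v s) * cmod (amp v t) * (cmod (fourier fX (s + t) * \<phi>_tilde v (s + t))
           + cmod (fourier fX (s - t) * \<phi>_tilde v (s - t))))
          = e v s * e v t * (ennreal (cmod (fourier fX (s + t) * \<phi>_tilde v (s + t)))
           + ennreal (cmod (fourier fX (s - t) * \<phi>_tilde v (s - t))))"
        unfolding e_def
        by (simp only: ennreal_mult ennreal_plus norm_ge_zero mult_nonneg_nonneg add_nonneg_nonneg)
      also have "\<dots> \<le> e v s * e v t * ((c (s + t) + d v (s + t)) + (c (s - t) + d v (s - t)))"
        by (intro mult_left_mono add_mono chi') auto
      also have "\<dots> = e v s * e v t * (c (s + t) + c (s - t)) + e v s * e v t * (d v (s + t) + d v (s - t))"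
        by (simp only: distrib_left add_ac)
      finally show "ennreal (cmod (amp v s) * cmod (amp v t) * (cmod (fourier fX (s + t) * \<phi>_tilde v (s + t))
           + cmod (fourier fX (s - t) * \<phi>_tilde v (s - t))))
          \<le> e v s * e v t * (c (s + t) + c (s - t)) + e v s * e v t * (d v (s + t) + d v (s - t))" .
    qed
    also have "\<dots> = (\<integral>\<^sup>+s. \<integral>\<^sup>+t. e v s * e v t * (c (s + t) + c (s - t)) \<partial>lborel \<partial>lborel)
        + (\<integral>\<^sup>+s. \<integral>\<^sup>+t. e v s * e v t * (d v (s + t) + d v (s - t)) \<partial>lborel \<partial>lborel)"
      by (simp add: nn_integral_add)
    also have "\<dots> \<le> 4 * (\<integral>\<^sup>+t. (e v t)\<^sup>2 \<partial>lborel) * (\<integral>\<^sup>+t. c t \<partial>lborel)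
        + (\<integral>\<^sup>+s. \<integral>\<^sup>+t. e v s * e v t * (d v (s + t) + d v (s - t)) \<partial>lborel \<partial>lborel)"
      by (intro add_right_mono nn_integral_convolution_form_le) (simp_all add: c_def)
    finally show ?thesis .
  qed
  have e_le: "e v t \<le> ?k * (wt (3 * \<alpha>) t * ennreal (Y v t))" for v t
    unfolding e_def by (rule amp_le)
  have e2_le: "(e v t)\<^sup>2 \<le> ?k\<^sup>2 * (wt (6 * \<alpha>) t * (ennreal (Y v t))\<^sup>2)" for v t
  proof -
    have "(e v t)\<^sup>2 \<le> (?k * (wt (3 * \<alpha>) t * ennreal (Y v t)))\<^sup>2" by (intro power_mono e_le) auto
    also have "\<dots> = ?k\<^sup>2 * ((wt (3 * \<alpha>) t)\<^sup>2 * (ennreal (Y v t))\<^sup>2)" by (simp only: power_mult_distrib)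
    also have "(wt (3 * \<alpha>) t)\<^sup>2 = wt (6 * \<alpha>) t"
    proof -
      have "((1 + \<bar>t\<bar>) powr (3 * \<alpha>))\<^sup>2 = (1 + \<bar>t\<bar>) powr (6 * \<alpha>)"
        by (simp add: power2_eq_square powr_add[symmetric])
      then show ?thesis by (simp add: indicator_def ennreal_power)
    qed
    finally show ?thesis .
  qed
  let ?A = "\<lambda>\<omega>. \<integral>\<^sup>+t. wt (6 * \<alpha>) t * (ennreal (Y (uv \<omega>) t))\<^sup>2 \<partial>lborel"
  let ?F = "\<lambda>s t \<omega>. ennreal (Y (uv \<omega>) s) * ennreal (Y (uv \<omega>) t) * (d (uv \<omega>) (s + t) + d (uv \<omega>) (s - t))"
  let ?B = "\<lambda>\<omega>. \<integral>\<^sup>+s. \<integral>\<^sup>+t. wt (3 * \<alpha>) s * wt (3 * \<alpha>) t * ?F s t \<omega> \<partial>lborel \<partial>lborel"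
  let ?c = "\<integral>\<^sup>+t. c t \<partial>lborel"
  \<comment> \<open>Schur's test is applied for each sample point, since its kernel \<open>c\<close>
    is deterministic, and leaves only the square of \<open>Y\<close> in \<open>?A\<close>. The
    random kernel \<open>d\<close> stays in \<open>?B\<close> until the expectation is
    taken.\<close>
  have step: "noise_form (uv \<omega>) \<le> 4 * ?c * ?k\<^sup>2 * ?A \<omega> + ?k\<^sup>2 * ?B \<omega>" for \<omega>
  proof -
    have "(\<integral>\<^sup>+t. (e (uv \<omega>) t)\<^sup>2 \<partial>lborel) \<le> (\<integral>\<^sup>+t. ?k\<^sup>2 * (wt (6 * \<alpha>) t * (ennreal (Y (uv \<omega>) t))\<^sup>2) \<partial>lborel)"
      by (intro nn_integral_mono e2_le)
    also have "\<dots> = ?k\<^sup>2 * ?A \<omega>" by (rule nn_integral_cmult) measurable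
    finally have 1: "4 * (\<integral>\<^sup>+t. (e (uv \<omega>) t)\<^sup>2 \<partial>lborel) * ?c \<le> 4 * (?k\<^sup>2 * ?A \<omega>) * ?c"
      by (intro mult_right_mono mult_left_mono) auto
    have "(\<integral>\<^sup>+s. \<integral>\<^sup>+t. e (uv \<omega>) s * e (uv \<omega>) t * (d (uv \<omega>) (s + t) + d (uv \<omega>) (s - t)) \<partial>lborel \<partial>lborel)
        \<le> (\<integral>\<^sup>+s. \<integral>\<^sup>+t. ?k\<^sup>2 * (wt (3 * \<alpha>) s * wt (3 * \<alpha>) t * ?F s t \<omega>) \<partial>lborel \<partial>lborel)"
    proof (intro nn_integral_mono)
      fix s t
      have "e (uv \<omega>) s * e (uv \<omega>) t * (d (uv \<omega>) (s + t) + d (uv \<omega>) (s - t))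
          \<le> (?k * (wt (3 * \<alpha>) s * ennreal (Y (uv \<omega>) s))) * (?k * (wt (3 * \<alpha>) t * ennreal (Y (uv \<omega>) t)))
            * (d (uv \<omega>) (s + t) + d (uv \<omega>) (s - t))"
        by (intro mult_right_mono mult_mono e_le) auto
      also have "\<dots> = ?k\<^sup>2 * (wt (3 * \<alpha>) s * wt (3 * \<alpha>) t * ?F s t \<omega>)"
        by (simp only: power2_eq_square mult_ac)
      finally show "e (uv \<omega>) s * e (uv \<omega>) t * (d (uv \<omega>) (s + t) + d (uv \<omega>) (s - t))
          \<le> ?k\<^sup>2 * (wt (3 * \<alpha>) s * wt (3 * \<alpha>) t * ?F s t \<omega>)" .
    qed
    also have "\<dots> = ?k\<^sup>2 * ?B \<omega>"
      by (subst nn_integral_cmult[symmetric], measurable) (intro nn_integral_cong nn_integral_cmult, measurable)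
    finally have "noise_form (uv \<omega>) \<le> 4 * (?k\<^sup>2 * ?A \<omega>) * ?c + ?k\<^sup>2 * ?B \<omega>"
      using order_trans[OF form[of "uv \<omega>"] add_mono[OF 1]] by blast
    also have "4 * (?k\<^sup>2 * ?A \<omega>) * ?c = 4 * ?c * ?k\<^sup>2 * ?A \<omega>" by (simp only: mult_ac)
    finally show ?thesis .
  qed
  have A_bound: "(\<integral>\<^sup>+\<omega>. ?A \<omega> \<partial>P) \<le> ennreal (ridge_moment C\<^sub>1 q) * trunc_moment (6 * \<alpha>) T"
  proof -
    interpret LxM: pair_sigma_finite lborel P ..
    have "(\<integral>\<^sup>+\<omega>. ?A \<omega> \<partial>P) = (\<integral>\<^sup>+t. (\<integral>\<^sup>+\<omega>. wt (6 * \<alpha>) t * (ennreal (Y (uv \<omega>) t))\<^sup>2 \<partial>P) \<partial>lborel)"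
      by (rule LxM.Fubini') measurable
    also have "\<dots> = (\<integral>\<^sup>+t. wt (6 * \<alpha>) t * (\<integral>\<^sup>+\<omega>. (ennreal (Y (uv \<omega>) t))\<^sup>2 \<partial>P) \<partial>lborel)"
      by (intro nn_integral_cong nn_integral_cmult) measurable
    also have "\<dots> \<le> (\<integral>\<^sup>+t. wt (6 * \<alpha>) t * ennreal (ridge_moment C\<^sub>1 q) \<partial>lborel)"
      by (intro nn_integral_mono mult_left_mono Y_square_moment) auto
    also have "\<dots> = trunc_moment (6 * \<alpha>) T * ennreal (ridge_moment C\<^sub>1 q)"
      unfolding trunc_moment_wt[symmetric] by (rule nn_integral_multc) measurable
    finally show ?thesis by (simp add: mult.commute)
  qed
  let ?m = "ennreal (2 * ridge_moment C\<^sub>1 q + empirical_moment C\<^sub>1 + 1)"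
  have B_bound: "(\<integral>\<^sup>+\<omega>. ?B \<omega> \<partial>P) \<le> (2 * (ennreal (1 / sqrt n) * ?m)) * (\<integral>\<^sup>+t. wt (3 * \<alpha>) t \<partial>lborel)\<^sup>2"
  proof (rule nn_integral_double_form_le[OF sigma_finite_sample_lborel])
    fix s t :: real
    have one: "(\<integral>\<^sup>+\<omega>. ennreal (Y (uv \<omega>) s) * ennreal (Y (uv \<omega>) t) * d (uv \<omega>) r \<partial>P) \<le> ennreal (1 / sqrt n) * ?m" for r
    proof -
      have "ennreal (Y v s) * ennreal (Y v t) * d v r
          = ennreal (1 / sqrt n) * ennreal (Y v s * Y v t * dev v r)" for v
      proof -
        have nn: "0 \<le> Y v s" "0 \<le> Y v t" "0 \<le> dev v r"
          using Y_ge_1[of v s] Y_ge_1[of v t] dev_nonneg[of v r] by linarith+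
        have "ennreal (Y v s) * ennreal (Y v t) * d v r = ennreal (Y v s * Y v t * (dev v r / sqrt n))"
          unfolding d_def using nn by (subst ennreal_mult, auto)+
        also have "Y v s * Y v t * (dev v r / sqrt n) = 1 / sqrt n * (Y v s * Y v t * dev v r)" by simp
        also have "ennreal \<dots> = ennreal (1 / sqrt n) * ennreal (Y v s * Y v t * dev v r)"
          using nn by (intro ennreal_mult) auto
        finally show ?thesis .
      qed
      then have "(\<integral>\<^sup>+\<omega>. ennreal (Y (uv \<omega>) s) * ennreal (Y (uv \<omega>) t) * d (uv \<omega>) r \<partial>P)
          = (\<integral>\<^sup>+\<omega>. ennreal (1 / sqrt n) * ennreal (Y (uv \<omega>) s * Y (uv \<omega>) t * dev (uv \<omega>) r) \<partial>P)"
        by simp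
      also have "\<dots> = ennreal (1 / sqrt n) * (\<integral>\<^sup>+\<omega>. ennreal (Y (uv \<omega>) s * Y (uv \<omega>) t * dev (uv \<omega>) r) \<partial>P)"
        by (rule nn_integral_cmult) measurable
      also have "\<dots> \<le> ennreal (1 / sqrt n) * ?m" by (intro mult_left_mono YYdev_moment) auto
      finally show ?thesis .
    qed
    have "(\<integral>\<^sup>+\<omega>. ?F s t \<omega> \<partial>P) = (\<integral>\<^sup>+\<omega>. ennreal (Y (uv \<omega>) s) * ennreal (Y (uv \<omega>) t) * d (uv \<omega>) (s + t) \<partial>P)
        + (\<integral>\<^sup>+\<omega>. ennreal (Y (uv \<omega>) s) * ennreal (Y (uv \<omega>) t) * d (uv \<omega>) (s - t) \<partial>P)"
      unfolding distrib_left by (rule nn_integral_add) measurable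
    also have "\<dots> \<le> ennreal (1 / sqrt n) * ?m + ennreal (1 / sqrt n) * ?m"
      by (intro add_mono one)
    finally show "(\<integral>\<^sup>+\<omega>. ?F s t \<omega> \<partial>P) \<le> 2 * (ennreal (1 / sqrt n) * ?m)" by (simp only: mult_2)
  qed measurable
  have "(\<integral>\<^sup>+\<omega>. noise_form (uv \<omega>) \<partial>P) \<le> (\<integral>\<^sup>+\<omega>. 4 * ?c * ?k\<^sup>2 * ?A \<omega> + ?k\<^sup>2 * ?B \<omega> \<partial>P)"
    by (intro nn_integral_mono step)
  also have "\<dots> = (\<integral>\<^sup>+\<omega>. 4 * ?c * ?k\<^sup>2 * ?A \<omega> \<partial>P) + (\<integral>\<^sup>+\<omega>. ?k\<^sup>2 * ?B \<omega> \<partial>P)"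
    by (rule nn_integral_add) measurable
  also have "(\<integral>\<^sup>+\<omega>. 4 * ?c * ?k\<^sup>2 * ?A \<omega> \<partial>P) = 4 * ?c * ?k\<^sup>2 * (\<integral>\<^sup>+\<omega>. ?A \<omega> \<partial>P)"
    by (rule nn_integral_cmult) measurable
  also have "(\<integral>\<^sup>+\<omega>. ?k\<^sup>2 * ?B \<omega> \<partial>P) = ?k\<^sup>2 * (\<integral>\<^sup>+\<omega>. ?B \<omega> \<partial>P)"
    by (rule nn_integral_cmult) measurable
  also have "4 * ?c * ?k\<^sup>2 * (\<integral>\<^sup>+\<omega>. ?A \<omega> \<partial>P) + ?k\<^sup>2 * (\<integral>\<^sup>+\<omega>. ?B \<omega> \<partial>P)
      \<le> 4 * ?c * ?k\<^sup>2 * (ennreal (ridge_moment C\<^sub>1 q) * trunc_moment (6 * \<alpha>) T)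
        + ?k\<^sup>2 * ((2 * (ennreal (1 / sqrt n) * ?m)) * (\<integral>\<^sup>+t. wt (3 * \<alpha>) t \<partial>lborel)\<^sup>2)"
    by (intro add_mono mult_left_mono A_bound B_bound) auto
  also have "?c = ennreal (C\<^sub>2 * B\<^sub>1) * decay_integral (\<alpha> + \<beta>)"
    unfolding c_def decay_integral_def by (rule nn_integral_cmult) measurable
  also have "4 * (ennreal (C\<^sub>2 * B\<^sub>1) * decay_integral (\<alpha> + \<beta>)) * ?k\<^sup>2 * (ennreal (ridge_moment C\<^sub>1 q) * trunc_moment (6 * \<alpha>) T)
      = smooth_const C\<^sub>1 \<alpha> \<beta> B\<^sub>1 C\<^sub>2 \<kappa> A q * (ennreal (1 / n) * trunc_moment (6 * \<alpha>) T)"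
    unfolding smooth_const_def amp_scale_square by (simp only: mult_ac)
  also have "?k\<^sup>2 * ((2 * (ennreal (1 / sqrt n) * ?m)) * (\<integral>\<^sup>+t. wt (3 * \<alpha>) t \<partial>lborel)\<^sup>2)
      = fluctuation_const C\<^sub>1 \<kappa> A q * (ennreal (1 / (n * sqrt n)) * (trunc_moment (3 * \<alpha>) T)\<^sup>2)"
  proof -
    have "ennreal (1 / (n * sqrt n)) = ennreal (1 / n) * ennreal (1 / sqrt n)"
      by (subst ennreal_mult[symmetric]) auto
    then show ?thesis
      unfolding fluctuation_const_def amp_scale_square trunc_moment_wt by (simp only: mult_ac)
  qed
  finally show ?thesis .
qed

end

section \<open>Finiteness of the constants and assembly of the risk bound\<close>

definition noise_const ::
  "real \<Rightarrow> real \<Rightarrow> real \<Rightarrow> real \<Rightarrow> real \<Rightarrow> real \<Rightarrow> real \<Rightarrow> nat \<Rightarrow> ennreal" where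
  "noise_const C\<^sub>1 \<alpha> \<beta> B\<^sub>1 C\<^sub>2 \<kappa> A q = ennreal C\<^sub>1 * (if \<beta> \<le> \<alpha> then rough_const C\<^sub>1 \<kappa> A q
    else smooth_const C\<^sub>1 \<alpha> \<beta> B\<^sub>1 C\<^sub>2 \<kappa> A q + fluctuation_const C\<^sub>1 \<kappa> A q)"

definition risk_const ::
  "real \<Rightarrow> real \<Rightarrow> real \<Rightarrow> real \<Rightarrow> real \<Rightarrow> real \<Rightarrow> real \<Rightarrow> nat \<Rightarrow> ennreal" where
  "risk_const C\<^sub>1 \<alpha> \<beta> B\<^sub>1 C\<^sub>2 \<kappa> A q = lin_const C\<^sub>1 \<alpha> B\<^sub>1 C\<^sub>2 \<kappa> + quad_const C\<^sub>1 B\<^sub>1 C\<^sub>2 \<kappa> A q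
    + noise_const C\<^sub>1 \<alpha> \<beta> B\<^sub>1 C\<^sub>2 \<kappa> A q"

text \<open>The linear part needs 2\<alpha> > 1. The decay integral of order \<alpha>+\<beta> enters
  only if \<beta> > \<alpha>, and then \<alpha>+\<beta> > 2\<alpha> > 1.\<close>

lemma risk_const_finite:
  assumes "\<alpha> > 1 / 2"
  shows "risk_const C\<^sub>1 \<alpha> \<beta> B\<^sub>1 C\<^sub>2 \<kappa> A q < \<infinity>"
proof -
  have "decay_integral (2 * \<alpha>) < \<infinity>" using assms by (intro decay_integral_finite) auto
  moreover have "decay_integral (\<alpha> + \<beta>) < \<infinity>" if "\<not> \<beta> \<le> \<alpha>"
    using assms that by (intro decay_integral_finite) auto
  ultimately show ?thesis
    by (auto simp: risk_const_def noise_const_def lin_const_def quad_const_def rough_const_def smooth_const_def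
        fluctuation_const_def ennreal_mult_less_top)
qed

context deconvolution_setting
begin

lemma noise_term_bound:
  "ennreal (C\<^sub>1 / total_obs n N) * (\<integral>\<^sup>+\<omega>. noise_form (uv \<omega>) \<partial>P)
    \<le> noise_const C\<^sub>1 \<alpha> \<beta> B\<^sub>1 C\<^sub>2 \<kappa> A q * noise_rate \<alpha> \<beta> n T"
proof -
  have "C\<^sub>1 / total_obs n N \<le> C\<^sub>1 * (1 / n)"
    using total_obs_bounds n C\<^sub>1 by (simp add: frac_le)
  then have "ennreal (C\<^sub>1 / total_obs n N) \<le> ennreal (C\<^sub>1 * (1 / n))" by (rule ennreal_leI)
  also have "\<dots> = ennreal C\<^sub>1 * ennreal (1 / n)" using C\<^sub>1 by (intro ennreal_mult) auto
  finally have scale: "ennreal (C\<^sub>1 / total_obs n N) \<le> ennreal C\<^sub>1 * ennreal (1 / n)" .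
  have n2: "ennreal (1 / n) * ennreal (1 / n) = ennreal (1 / (real n)\<^sup>2)"
    by (subst ennreal_mult[symmetric]) (auto simp: power2_eq_square)
  have n3: "ennreal (1 / n) * ennreal (1 / (n * sqrt n)) = ennreal (1 / ((real n)\<^sup>2 * sqrt n))"
    by (subst ennreal_mult[symmetric]) (auto simp: power2_eq_square)
  show ?thesis
  proof (cases "\<beta> \<le> \<alpha>")
    case True
    have "ennreal (C\<^sub>1 / total_obs n N) * (\<integral>\<^sup>+\<omega>. noise_form (uv \<omega>) \<partial>P)
        \<le> (ennreal C\<^sub>1 * ennreal (1 / n)) * (rough_const C\<^sub>1 \<kappa> A q * (ennreal (1 / n) * (trunc_moment (3 * \<alpha>) T)\<^sup>2))"
      by (intro mult_mono scale rough_noise_bound) auto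
    also have "\<dots> = ennreal C\<^sub>1 * rough_const C\<^sub>1 \<kappa> A q * (ennreal (1 / (real n)\<^sup>2) * (trunc_moment (3 * \<alpha>) T)\<^sup>2)"
      unfolding n2[symmetric] by (simp only: mult_ac)
    finally show ?thesis using True by (simp add: noise_const_def noise_rate_def)
  next
    case False
    let ?x = "ennreal (1 / (real n)\<^sup>2) * trunc_moment (6 * \<alpha>) T"
    let ?y = "ennreal (1 / ((real n)\<^sup>2 * sqrt n)) * (trunc_moment (3 * \<alpha>) T)\<^sup>2"
    let ?a = "smooth_const C\<^sub>1 \<alpha> \<beta> B\<^sub>1 C\<^sub>2 \<kappa> A q" and ?b = "fluctuation_const C\<^sub>1 \<kappa> A q"
    have "ennreal (C\<^sub>1 / total_obs n N) * (\<integral>\<^sup>+\<omega>. noise_form (uv \<omega>) \<partial>P)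
        \<le> (ennreal C\<^sub>1 * ennreal (1 / n)) * (?a * (ennreal (1 / n) * trunc_moment (6 * \<alpha>) T)
          + ?b * (ennreal (1 / (n * sqrt n)) * (trunc_moment (3 * \<alpha>) T)\<^sup>2))"
      by (intro mult_mono scale smooth_noise_bound) auto
    also have "\<dots> = ennreal C\<^sub>1 * (?a * ?x + ?b * ?y)"
      unfolding n2[symmetric] n3[symmetric] by (simp only: distrib_left mult_ac)
    also have "\<dots> \<le> ennreal C\<^sub>1 * ((?a + ?b) * ?x + (?a + ?b) * ?y)"
      by (intro mult_left_mono add_mono mult_right_mono) auto
    also have "\<dots> = ennreal C\<^sub>1 * (?a + ?b) * (?x + ?y)" by (simp only: distrib_left mult_ac)
    finally show ?thesis using False by (simp add: noise_const_def noise_rate_def)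
  qed
qed

text \<open>With the errors frozen, \<open>amp (uv \<omega>')\<close> is a deterministic weight, so
  the conditional bound applies inside; integrating over the errors then gives the mean and noise
  terms.\<close>

lemma second_moment_bound:
  "(\<integral>\<^sup>+\<omega>. ennreal ((LINT t|lborel. Re (amp (uv \<omega>) t *
      (1 / total_obs n N * (\<Sum>p\<in>J. iexp (t * (xv \<omega> (fst p) + uv \<omega> p))))))\<^sup>2) \<partial>P)
    \<le> risk_const C\<^sub>1 \<alpha> \<beta> B\<^sub>1 C\<^sub>2 \<kappa> A q * risk_bound \<alpha> \<beta> n T"
proof -
  define F where "F z = ennreal ((LINT t|lborel. Re (amp (snd z) t *
      (1 / total_obs n N * (\<Sum>p\<in>J. iexp (t * (fst z (fst p) + snd z p))))))\<^sup>2)"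
    for z :: "(nat \<Rightarrow> real) \<times> (nat \<times> nat \<Rightarrow> real)"
  have F_meas: "F \<in> borel_measurable (MX \<Otimes>\<^sub>M MU)"
  proof -
    have "(\<lambda>y. iexp (snd y * (fst (fst y) (fst p) + snd (fst y) p))) \<in> borel_measurable ((MX \<Otimes>\<^sub>M MU) \<Otimes>\<^sub>M lborel)"
      if "p \<in> J" for p
    proof -
      have [measurable]: "(\<lambda>v. v (fst p)) \<in> borel_measurable MX"
        by (rule measurable_component_singleton) (use that in auto)
      have [measurable]: "(\<lambda>v. v p) \<in> borel_measurable MU" by (rule component_measurable[OF that])
      show ?thesis by measurable
    qed
    then have [measurable]: "(\<lambda>y. \<Sum>p\<in>J. iexp (snd y * (fst (fst y) (fst p) + snd (fst y) p)))
        \<in> borel_measurable ((MX \<Otimes>\<^sub>M MU) \<Otimes>\<^sub>M lborel)" by (rule borel_measurable_sum)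
    have [measurable]: "(\<lambda>y. R (snd (fst y)) (snd y)) \<in> borel_measurable ((MX \<Otimes>\<^sub>M MU) \<Otimes>\<^sub>M lborel)"
    proof -
      have "(\<lambda>y. (snd (fst y), snd y)) \<in> measurable ((MX \<Otimes>\<^sub>M MU) \<Otimes>\<^sub>M lborel) (MU \<Otimes>\<^sub>M borel)" by measurable
      from measurable_compose[OF this R_measurable] show ?thesis by simp
    qed
    show ?thesis unfolding F_def[abs_def] amp_def by measurable
  qed
  have noise_meas: "(\<lambda>\<omega>. noise_form (uv \<omega>)) \<in> borel_measurable P"
    unfolding noise_form_def amp_def by measurable
  have mean_meas: "(\<lambda>\<omega>. ennreal ((LINT t|lborel. Re (amp (uv \<omega>) t * (fourier fX t * \<phi>_tilde (uv \<omega>) t)))\<^sup>2))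
      \<in> borel_measurable P"
    unfolding amp_def by measurable
  have "(\<integral>\<^sup>+\<omega>. F (xv \<omega>, uv \<omega>) \<partial>P) = (\<integral>\<^sup>+\<omega>'. \<integral>\<^sup>+\<omega>. F (xv \<omega>, uv \<omega>') \<partial>P \<partial>P)"
    by (rule nn_integral_xv_uv[OF F_meas])
  also have "\<dots> \<le> (\<integral>\<^sup>+\<omega>'. ennreal ((LINT t|lborel. Re (amp (uv \<omega>') t * (fourier fX t * \<phi>_tilde (uv \<omega>') t)))\<^sup>2)
      + ennreal (C\<^sub>1 / total_obs n N) * noise_form (uv \<omega>') \<partial>P)"
    unfolding F_def noise_form_def fst_conv snd_conv
    by (intro nn_integral_mono conditional_second_moment amp_integrable)
  also have "\<dots> = (\<integral>\<^sup>+\<omega>'. ennreal ((LINT t|lborel. Re (amp (uv \<omega>') t * (fourier fX t * \<phi>_tilde (uv \<omega>') t)))\<^sup>2) \<partial>P)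
      + ennreal (C\<^sub>1 / total_obs n N) * (\<integral>\<^sup>+\<omega>'. noise_form (uv \<omega>') \<partial>P)"
    using mean_meas noise_meas by (simp add: nn_integral_add nn_integral_cmult)
  also have "\<dots> \<le> lin_const C\<^sub>1 \<alpha> B\<^sub>1 C\<^sub>2 \<kappa> * (ennreal (1 / n) * trunc_moment (4 * \<alpha> - 2 * \<beta>) T)
      + quad_const C\<^sub>1 B\<^sub>1 C\<^sub>2 \<kappa> A q * (ennreal (1 / (real n)\<^sup>2) * (trunc_moment (4 * \<alpha> - \<beta>) T)\<^sup>2)
      + noise_const C\<^sub>1 \<alpha> \<beta> B\<^sub>1 C\<^sub>2 \<kappa> A q * noise_rate \<alpha> \<beta> n T"
    by (intro add_mono mean_term_bound noise_term_bound)
  also have "\<dots> \<le> risk_const C\<^sub>1 \<alpha> \<beta> B\<^sub>1 C\<^sub>2 \<kappa> A q * risk_bound \<alpha> \<beta> n T"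
  proof -
    have "a * x + b * y + c * z \<le> (a + b + c) * (x + y + z)" for a b c x y z :: ennreal
    proof -
      have "a * x + b * y + c * z \<le> (a + b + c) * x + (a + b + c) * y + (a + b + c) * z"
        by (intro add_mono mult_right_mono) (auto intro: add_increasing add_increasing2)
      then show ?thesis by (simp only: distrib_left)
    qed
    then show ?thesis unfolding risk_const_def risk_bound_def .
  qed
  finally show ?thesis by (simp only: F_def fst_conv snd_conv)
qed

end

section \<open>From the kernel estimators to one Fourier integral\<close>

lemma deconv_kernel_scaled:
  assumes h: "h > 0"
  shows "deconv_kernel K h g ((x - w) / h) = h * Re (CLINT t|lborel.
      iexp (- (t * x)) * fourier K (h * t) / complex_of_real (2 * pi) / g t * iexp (t * w))"
proof -
  let ?f = "\<lambda>s. iexp (- (s * ((x - w) / h))) * (fourier K s / g (s / h))"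
  let ?r = "\<lambda>t. iexp (- (t * x)) * fourier K (h * t) / complex_of_real (2 * pi) / g t * iexp (t * w)"
  \<comment> \<open>The substitution \<open>s = h * t\<close> moves the bandwidth into the kernel
    transform, evaluates \<open>g\<close> at the plain frequency, and produces the factor
    \<open>h\<close> that cancels the 1/h of the estimator.\<close>
  have "(CLINT s|lborel. ?f s) = h *\<^sub>R (CLINT t|lborel. ?f (0 + h * t))"
    using lborel_integral_real_affine[of h ?f 0] h by simp
  also have "(CLINT t|lborel. ?f (0 + h * t)) = (CLINT t|lborel. complex_of_real (2 * pi) * ?r t)"
  proof (rule Bochner_Integration.integral_cong[OF refl])
    fix t
    have e: "iexp (- ((0 + h * t) * ((x - w) / h))) = iexp (- (t * x)) * iexp (t * w)"
    proof -
      have r: "- ((0 + h * t) * ((x - w) / h)) = - (t * x) + t * w" using h by (simp add: field_simps)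
      show ?thesis unfolding r by (simp only: of_real_add distrib_left exp_add)
    qed
    show "?f (0 + h * t) = complex_of_real (2 * pi) * ?r t"
      unfolding e using h by simp
  qed
  also have "\<dots> = complex_of_real (2 * pi) * (CLINT t|lborel. ?r t)" by (rule integral_mult_right_zero)
  finally have "complex_of_real (1 / (2 * pi)) * (CLINT s|lborel. ?f s)
      = complex_of_real h * (CLINT t|lborel. ?r t)"
    by (simp add: scaleR_conv_of_real)
  then show ?thesis unfolding deconv_kernel_def by (simp only: Re_complex_of_real times_complex.sel Im_complex_of_real)
qed

context replicated_setting
begin

lemma fU_hat_eq: "fU_hat n N w t = sqrt \<bar>\<psi>_hat (\<lambda>p. w (fst p) (snd p)) t\<bar>"
  by (simp add: fU_hat_def \<psi>_hat_def case_prod_beta)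

text \<open>Both estimators are linear in the reciprocal they use, so their difference carries the
  difference of the reciprocals. The data \<open>w\<close> are fixed numbers here: the identity
  holds for each sample point.\<close>

lemma estimator_difference:
  fixes K :: "real \<Rightarrow> real" and w :: "nat \<Rightarrow> nat \<Rightarrow> real" and x h c \<rho> \<kappa> B :: real
  assumes K: "K \<in> borel_measurable borel" "\<And>t. cmod (fourier K t) \<le> \<kappa>"
      "\<And>t. \<bar>t\<bar> > c \<Longrightarrow> fourier K t = 0"
    and h: "h > 0" and \<rho>: "\<rho> > 0" and \<phi>_inv: "\<And>t. \<bar>t\<bar> \<le> c / h \<Longrightarrow> 1 / \<phi> t \<le> B"
  defines "om \<equiv> \<lambda>t. iexp (- (t * x)) * fourier K (h * t) / complex_of_real (2 * pi)"
  shows "fX_hat K h \<rho> n N w x - fX_tilde K h fU n N w x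
    = (LINT t|lborel. Re (om t * complex_of_real (1 / (fU_hat n N w t + \<rho>) - 1 / \<phi> t) *
        (1 / total_obs n N * (\<Sum>p\<in>J. iexp (t * w (fst p) (snd p))))))"
proof -
  note [measurable] = K(1)
  have M: "total_obs n N > 0" by (rule total_obs_pos)
  have \<kappa>: "\<kappa> \<ge> 0" using order_trans[OF norm_ge_zero K(2)] .
  have om_meas[measurable]: "om \<in> borel_measurable borel" unfolding om_def by measurable
  have om_le: "cmod (om t) \<le> \<kappa> * indicator {- (c / h)..c / h} t" for t
  proof (cases "\<bar>t\<bar> \<le> c / h")
    case True
    have "cmod (om t) = cmod (fourier K (h * t)) / (2 * pi)"
      unfolding om_def by (simp add: norm_mult norm_divide)
    also have "\<dots> \<le> \<kappa> / 1" using K(2) \<kappa> pi_ge_two by (intro frac_le) auto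
    finally show ?thesis using True by (simp add: indicator_def abs_le_iff)
  next
    case False
    then have "\<bar>h * t\<bar> > c" using h by (simp add: abs_mult field_simps)
    then show ?thesis using K(3) \<kappa> by (simp add: om_def)
  qed
  let ?v = "\<lambda>p. w (fst p) (snd p)"
  have hat_meas[measurable]: "fU_hat n N w \<in> borel_measurable borel"
    unfolding fU_hat_eq[abs_def] \<psi>_hat_def by measurable
  have hat_pos: "fU_hat n N w t + \<rho> > 0" for t
    unfolding fU_hat_eq using \<rho> by (intro add_nonneg_pos) auto
  \<comment> \<open>Subtracting the integrals needs both to exist. A general \<open>g\<close> covers
    the two denominators: one is kept away from 0 by the ridge, the other by the hypothesis on the
    cutoff range.\<close>
  have int: "integrable lborel (\<lambda>t. om t / complex_of_real (g t) * iexp (t * y))"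
    if [measurable]: "g \<in> borel_measurable borel" and g: "\<And>t. g t > 0" "\<And>t. \<bar>t\<bar> \<le> c / h \<Longrightarrow> 1 / g t \<le> b"
    for g y and b :: real
  proof (rule integrable_bounded_compact[where B = "\<kappa> * b" and T = "c / h"])
    fix t
    show "norm (om t / complex_of_real (g t) * iexp (t * y)) \<le> \<kappa> * b * indicator {- (c / h)..c / h} t"
    proof (cases "\<bar>t\<bar> \<le> c / h")
      case True
      have "cmod (om t) * (1 / g t) \<le> \<kappa> * b"
        using om_le[of t] True g(1)[of t] g(2)[of t] \<kappa> by (intro mult_mono) (auto simp: indicator_def abs_le_iff)
      then show ?thesis using True g(1)[of t] by (simp add: norm_mult norm_divide indicator_def abs_le_iff)
    next
      case False
      then have "om t = 0" using om_le[of t] by (auto simp: indicator_def abs_le_iff split: if_splits)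
      moreover have "indicator {- (c / h)..c / h} t = (0 :: real)" using False by (auto simp: indicator_def abs_le_iff)
      ultimately show ?thesis by simp
    qed
  qed measurable
  have int1: "integrable lborel (\<lambda>t. om t / complex_of_real (fU_hat n N w t + \<rho>) * iexp (t * y))" for y
  proof (rule int)
    fix t
    show "1 / (fU_hat n N w t + \<rho>) \<le> 1 / \<rho>"
      using \<rho> hat_pos[of t] by (intro divide_left_mono) (auto simp: fU_hat_eq)
  qed (use hat_pos in measurable)
  have int2: "integrable lborel (\<lambda>t. om t / complex_of_real (\<phi> t) * iexp (t * y))" for y
    by (rule int[OF _ \<phi>_pos \<phi>_inv]) measurable
  have diff: "L_hat K h \<rho> n N w ((x - y) / h) - L_true K h fU ((x - y) / h)
      = h * (LINT t|lborel. Re (om t * complex_of_real (1 / (fU_hat n N w t + \<rho>) - 1 / \<phi> t) * iexp (t * y)))" for y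
  proof -
    have "L_hat K h \<rho> n N w ((x - y) / h) - L_true K h fU ((x - y) / h)
        = h * Re ((CLINT t|lborel. om t / complex_of_real (fU_hat n N w t + \<rho>) * iexp (t * y))
            - (CLINT t|lborel. om t / complex_of_real (\<phi> t) * iexp (t * y)))"
      unfolding L_hat_def L_true_def deconv_kernel_scaled[OF h] fourier_fU om_def
      by (simp only: minus_complex.sel right_diff_distrib)
    also have "(CLINT t|lborel. om t / complex_of_real (fU_hat n N w t + \<rho>) * iexp (t * y))
            - (CLINT t|lborel. om t / complex_of_real (\<phi> t) * iexp (t * y))
        = (CLINT t|lborel. om t / complex_of_real (fU_hat n N w t + \<rho>) * iexp (t * y)
            - om t / complex_of_real (\<phi> t) * iexp (t * y))"
      by (rule Bochner_Integration.integral_diff[OF int1 int2, symmetric])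
    also have "Re \<dots> = (LINT t|lborel. Re (om t / complex_of_real (fU_hat n N w t + \<rho>) * iexp (t * y)
            - om t / complex_of_real (\<phi> t) * iexp (t * y)))"
      by (rule integral_Re[symmetric]) (rule Bochner_Integration.integrable_diff[OF int1 int2])
    also have "\<dots> = (LINT t|lborel. Re (om t * complex_of_real (1 / (fU_hat n N w t + \<rho>) - 1 / \<phi> t) * iexp (t * y)))"
    proof (rule Bochner_Integration.integral_cong[OF refl])
      fix t
      have "a / b * e - a / b' * e = a * (1 / b - 1 / b') * e" for a b b' e :: complex
        by (simp add: algebra_simps)
      then show "Re (om t / complex_of_real (fU_hat n N w t + \<rho>) * iexp (t * y)
            - om t / complex_of_real (\<phi> t) * iexp (t * y))
          = Re (om t * complex_of_real (1 / (fU_hat n N w t + \<rho>) - 1 / \<phi> t) * iexp (t * y))"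
        by (simp only: of_real_diff of_real_divide of_real_1)
    qed
    finally show ?thesis .
  qed
  let ?I = "\<lambda>t y. om t * complex_of_real (1 / (fU_hat n N w t + \<rho>) - 1 / \<phi> t) * iexp (t * y)"
  have intI: "integrable lborel (\<lambda>t. Re (?I t y))" for y
  proof -
    have "?I t y = om t / complex_of_real (fU_hat n N w t + \<rho>) * iexp (t * y)
        - om t / complex_of_real (\<phi> t) * iexp (t * y)" for t
      by (simp add: algebra_simps)
    then show ?thesis
      using integrable_Re[OF Bochner_Integration.integrable_diff[OF int1[of y] int2[of y]]] by simp
  qed
  have "fX_hat K h \<rho> n N w x - fX_tilde K h fU n N w x
      = 1 / (total_obs n N * h) * (\<Sum>j=1..n. \<Sum>k=1..N j.
          L_hat K h \<rho> n N w ((x - w j k) / h) - L_true K h fU ((x - w j k) / h))"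
    unfolding fX_hat_def fX_tilde_def kernel_estimator_def
    by (simp only: right_diff_distrib[symmetric] sum_subtractf[symmetric])
  also have "\<dots> = 1 / (total_obs n N * h) * (\<Sum>j=1..n. \<Sum>k=1..N j. h * (LINT t|lborel. Re (?I t (w j k))))"
    by (simp only: diff)
  also have "\<dots> = 1 / total_obs n N * (\<Sum>j=1..n. \<Sum>k=1..N j. (LINT t|lborel. Re (?I t (w j k))))"
    using h by (simp add: sum_distrib_left[symmetric])
  also have "(\<Sum>j=1..n. \<Sum>k=1..N j. (LINT t|lborel. Re (?I t (w j k))))
      = (\<Sum>p\<in>J. (LINT t|lborel. Re (?I t (?v p))))"
    by (subst sum.Sigma) (auto simp: case_prod_beta)
  also have "\<dots> = (LINT t|lborel. (\<Sum>p\<in>J. Re (?I t (?v p))))"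
    by (rule Bochner_Integration.integral_sum[symmetric]) (rule intI)
  also have "1 / total_obs n N * \<dots> = (LINT t|lborel. 1 / total_obs n N * (\<Sum>p\<in>J. Re (?I t (?v p))))"
    by (rule integral_mult_right_zero[symmetric])
  also have "\<dots> = (LINT t|lborel. Re (om t * complex_of_real (1 / (fU_hat n N w t + \<rho>) - 1 / \<phi> t) *
        (1 / total_obs n N * (\<Sum>p\<in>J. iexp (t * w (fst p) (snd p))))))"
  proof (rule Bochner_Integration.integral_cong[OF refl])
    fix t
    have Re_scale: "Re (complex_of_real r * z) = r * Re z" for r z by simp
    have "1 / total_obs n N * (\<Sum>p\<in>J. Re (?I t (?v p)))
        = Re (complex_of_real (1 / total_obs n N) * (\<Sum>p\<in>J. ?I t (?v p)))"
      by (simp only: Re_scale Re_sum)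
    also have "complex_of_real (1 / total_obs n N) * (\<Sum>p\<in>J. ?I t (?v p))
        = om t * complex_of_real (1 / (fU_hat n N w t + \<rho>) - 1 / \<phi> t) *
        (1 / total_obs n N * (\<Sum>p\<in>J. iexp (t * w (fst p) (snd p))))"
      unfolding sum_distrib_left[symmetric] by simp
    finally show "1 / total_obs n N * (\<Sum>p\<in>J. Re (?I t (?v p)))
        = Re (om t * complex_of_real (1 / (fU_hat n N w t + \<rho>) - 1 / \<phi> t) *
        (1 / total_obs n N * (\<Sum>p\<in>J. iexp (t * w (fst p) (snd p)))))" .
  qed
  finally show ?thesis .
qed

end

section \<open>The rate of convergence\<close>

text \<open>The hypothesis on \<open>g\<close> makes \<open>g\<^sup>2 * (1 / sqrt n)\<close> of
  order n^(-\<delta>/2), so its \<open>q\<close>-th power is of order n^(-c_2-1); division by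
  \<rho>, at least of order n^(-c_2), leaves 1/n.\<close>

lemma ridge_tail_bound:
  fixes g B A\<^sub>0 c\<^sub>1 c\<^sub>2 \<delta> \<rho> :: real and n q :: nat
  assumes n: "n \<ge> 1" and g: "g \<ge> 0" "g ^ 4 \<le> A\<^sub>0 * real n powr (1 - \<delta>)" and A\<^sub>0: "A\<^sub>0 > 0"
    and \<delta>: "\<delta> > 0" and c: "c\<^sub>1 > 0" and \<rho>: "c\<^sub>1 * real n powr (- c\<^sub>2) \<le> \<rho>"
    and q: "real q \<ge> 2 * (c\<^sub>2 + 1) / \<delta>"
  shows "(2 * B\<^sup>2 * g\<^sup>2 * (1 / sqrt n)) ^ q / \<rho> \<le> (2 * B\<^sup>2 * sqrt A\<^sub>0) ^ q / c\<^sub>1 * (1 / sqrt n)\<^sup>2"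
proof -
  have n0: "real n > 0" using n by simp
  have "(g\<^sup>2 * (1 / sqrt n))\<^sup>2 = g ^ 4 * (1 / n)"
    by (simp add: power_mult_distrib power_divide power_mult[symmetric])
  also have "\<dots> \<le> A\<^sub>0 * real n powr (1 - \<delta>) * (1 / n)" using g(2) by (intro mult_right_mono) auto
  also have "\<dots> = A\<^sub>0 * real n powr (- \<delta>)" using n0 by (simp add: powr_diff powr_minus field_simps)
  also have "\<dots> = (sqrt A\<^sub>0 * real n powr (- \<delta> / 2))\<^sup>2"
    using A\<^sub>0 by (simp add: power_mult_distrib power2_eq_square[of "real n powr _"] powr_add[symmetric])
  finally have "g\<^sup>2 * (1 / sqrt n) \<le> sqrt A\<^sub>0 * real n powr (- \<delta> / 2)"
    by (rule power2_le_imp_le) (use A\<^sub>0 in auto)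
  then have "2 * B\<^sup>2 * (g\<^sup>2 * (1 / sqrt n)) \<le> 2 * B\<^sup>2 * (sqrt A\<^sub>0 * real n powr (- \<delta> / 2))"
    by (intro mult_left_mono) auto
  then have "(2 * B\<^sup>2 * g\<^sup>2 * (1 / sqrt n)) ^ q \<le> (2 * B\<^sup>2 * sqrt A\<^sub>0 * real n powr (- \<delta> / 2)) ^ q"
    by (intro power_mono) (simp_all add: mult.assoc)
  also have "\<dots> = (2 * B\<^sup>2 * sqrt A\<^sub>0) ^ q * real n powr (- \<delta> / 2 * real q)"
    using n0 by (simp add: power_mult_distrib powr_realpow[symmetric] powr_powr)
  also have "\<dots> \<le> (2 * B\<^sup>2 * sqrt A\<^sub>0) ^ q * real n powr (- (c\<^sub>2 + 1))"
  proof (intro mult_left_mono powr_mono)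
    have "c\<^sub>2 + 1 \<le> \<delta> / 2 * real q" using q \<delta> by (simp add: field_simps)
    then show "- \<delta> / 2 * real q \<le> - (c\<^sub>2 + 1)" by simp
  qed (use n A\<^sub>0 in auto)
  finally have num: "(2 * B\<^sup>2 * g\<^sup>2 * (1 / sqrt n)) ^ q \<le> (2 * B\<^sup>2 * sqrt A\<^sub>0) ^ q * real n powr (- (c\<^sub>2 + 1))" .
  have \<rho>0: "c\<^sub>1 * real n powr (- c\<^sub>2) > 0" using c n0 by simp
  have "(2 * B\<^sup>2 * g\<^sup>2 * (1 / sqrt n)) ^ q / \<rho>
      \<le> (2 * B\<^sup>2 * sqrt A\<^sub>0) ^ q * real n powr (- (c\<^sub>2 + 1)) / (c\<^sub>1 * real n powr (- c\<^sub>2))"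
    using num \<rho> \<rho>0 A\<^sub>0 by (intro frac_le) auto
  also have "\<dots> = (2 * B\<^sup>2 * sqrt A\<^sub>0) ^ q / c\<^sub>1 * (real n powr (- (c\<^sub>2 + 1)) / real n powr (- c\<^sub>2))" by simp
  also have "real n powr (- (c\<^sub>2 + 1)) / real n powr (- c\<^sub>2) = real n powr (- 1)"
    by (simp add: powr_diff[symmetric])
  also have "real n powr (- 1) = (1 / sqrt n)\<^sup>2" using n0 by (simp add: powr_minus_divide power_divide)
  finally show ?thesis .
qed

text \<open>The lower bound on the bandwidth, solved for 1/h and raised to the power 4\<alpha>; the
  saving \<delta> in the exponent of \<open>n\<close> is kept because it pays for the ridge.\<close>

lemma bandwidth_power_le:
  fixes \<alpha> c H h \<epsilon> \<delta> :: real and n :: nat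
  assumes \<alpha>: "\<alpha> > 0" and c: "c > 0" and h: "0 < h" "h \<le> H" and n: "n \<ge> 1" and \<epsilon>: "\<epsilon> > 0"
    and lower: "\<epsilon> \<le> real n powr ((1 - \<delta>) / (4 * \<alpha>)) * h"
  shows "(1 + c / h) powr (4 * \<alpha>) \<le> ((H + c) / \<epsilon>) powr (4 * \<alpha>) * real n powr (1 - \<delta>)"
proof -
  let ?r = "real n powr ((1 - \<delta>) / (4 * \<alpha>))"
  have "1 + c / h = (h + c) / h" using h by (simp add: field_simps)
  also have "\<dots> \<le> (H + c) / h" using h by (intro divide_right_mono) auto
  also have "1 / h \<le> ?r / \<epsilon>" using lower h \<epsilon> by (simp add: field_simps)
  then have "(H + c) / h \<le> (H + c) / \<epsilon> * ?r"
    using mult_left_mono[of "1 / h" "?r / \<epsilon>" "H + c"] h c by simp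
  finally have "(1 + c / h) powr (4 * \<alpha>) \<le> ((H + c) / \<epsilon> * ?r) powr (4 * \<alpha>)"
    using \<alpha> c h by (intro powr_mono2) auto
  also have "\<dots> = ((H + c) / \<epsilon>) powr (4 * \<alpha>) * ?r powr (4 * \<alpha>)"
    by (rule powr_mult)
  also have "?r powr (4 * \<alpha>) = real n powr (1 - \<delta>)" using \<alpha> by (simp add: powr_powr)
  finally show ?thesis .
qed

theorem theorem3p1:
  fixes \<alpha> \<beta> B\<^sub>1 C\<^sub>1 C\<^sub>2 c\<^sub>1 c\<^sub>2 c\<^sub>3 :: real
    and N :: "nat \<Rightarrow> nat"
    and f\<^sub>U K :: "real \<Rightarrow> real"
    and h\<^sub>1 h\<^sub>2 :: "nat \<Rightarrow> real"
    and k :: nat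
  assumes parameters: "\<alpha> > 0" "B\<^sub>1 > 1" "C\<^sub>1 > 1" "C\<^sub>2 > 0" "\<beta> > 0"
    and fU_density: "prob_density f\<^sub>U"
    and fU_real_nonzero: "\<forall>t. fourier f\<^sub>U t \<in> \<real> \<and> fourier f\<^sub>U t \<noteq> 0"
    and kernel: "symmetric_kernel K"
    and i: "\<forall>j\<ge>1. 1 \<le> N j \<and> real (N j) \<le> C\<^sub>1"
    and ii: "\<forall>n\<ge>1. num_pairs n N \<ge> real n / C\<^sub>1"
    and iii: "\<forall>t. (1 + \<bar>t\<bar>) powr (- \<alpha>) / B\<^sub>1 \<le> cmod (fourier f\<^sub>U t)
                 \<and> cmod (fourier f\<^sub>U t) \<le> B\<^sub>1 * (1 + \<bar>t\<bar>) powr (- \<alpha>)"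
    and iv: "\<alpha> > 1 / 2"
    and v: "bdd_above (range (\<lambda>t. cmod (fourier K t)))"
           "\<exists>c>0. \<forall>t. \<bar>t\<bar> > c \<longrightarrow> fourier K t = 0"
    and vi: "\<forall>n\<ge>1. 0 < h\<^sub>1 n \<and> h\<^sub>1 n \<le> h\<^sub>2 n"
            "h\<^sub>2 \<longlonglongrightarrow> 0"
            "\<exists>\<delta>>0. \<exists>\<epsilon>>0. \<forall>n\<ge>1. real n powr ((1 - \<delta>) / (4 * \<alpha>)) * h\<^sub>1 n \<ge> \<epsilon>"
    and vii: "c\<^sub>1 > 0" "c\<^sub>2 > 0" "c\<^sub>3 > 0"
    and k: "k \<ge> 1"
  shows "\<exists>C>0. \<forall>n\<ge>1. \<forall>h \<rho>.
           h\<^sub>1 n \<le> h \<and> h \<le> h\<^sub>2 n \<and>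
           c\<^sub>1 * real n powr (- c\<^sub>2) \<le> \<rho> \<and>
           \<rho> \<le> c\<^sub>3 * min (h\<^sub>1 n powr (4 * \<alpha> + 2)) (1 / real n) \<longrightarrow>
           (\<forall>f\<^sub>X \<in> density_class \<beta> C\<^sub>2. \<forall>(P :: 'a measure) X U.
              replicated_sample P n N f\<^sub>X f\<^sub>U X U \<longrightarrow>
              (SUP x. \<integral>\<^sup>+ \<omega>. ennreal
                 ((fX_hat K h \<rho> n N (\<lambda>j m. X j \<omega> + U j m \<omega>) x
                   - fX_tilde K h f\<^sub>U n N (\<lambda>j m. X j \<omega> + U j m \<omega>) x)\<^sup>2) \<partial>P)
              \<le> ennreal (C * p_rate \<alpha> \<beta> k n h))"
proof -
  have K_meas: "K \<in> borel_measurable borel"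
    using kernel borel_measurable_integrable by (auto simp: symmetric_kernel_def)
  obtain c where c: "c > 0" "\<And>t. \<bar>t\<bar> > c \<Longrightarrow> fourier K t = 0" using v(2) by auto
  obtain \<delta> \<epsilon> where \<delta>: "\<delta> > 0" and \<epsilon>: "\<epsilon> > 0"
    and h1_lower: "\<And>n. n \<ge> 1 \<Longrightarrow> real n powr ((1 - \<delta>) / (4 * \<alpha>)) * h\<^sub>1 n \<ge> \<epsilon>" using vi(3) by blast
  obtain \<kappa> where \<kappa>: "\<kappa> > 0" "\<And>t. cmod (fourier K t) \<le> \<kappa>"
  proof -
    obtain b where "\<And>t. cmod (fourier K t) \<le> b" using v(1) by (auto simp: bdd_above_def)
    then show thesis by (intro that[of "max b 1"]) (auto intro: order_trans[of _ b])
  qed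
  obtain H where H: "H > 0" "\<And>n. h\<^sub>2 n \<le> H"
  proof -
    obtain b where "\<And>n. norm (h\<^sub>2 n) \<le> b" using convergent_imp_Bseq[OF convergentI[OF vi(2)]] by (auto simp: Bseq_def)
    then have "h\<^sub>2 n \<le> max b 1" for n by (smt (verit) real_norm_def)
    then show thesis by (intro that[of "max b 1"]) auto
  qed
  \<comment> \<open>The constant delivered by \<open>bandwidth_power_le\<close>; it also serves as
    the constant of admissibility, where the saving \<delta> is given up.\<close>
  define A\<^sub>0 where "A\<^sub>0 = ((H + c) / \<epsilon>) powr (4 * \<alpha>)"
  have A\<^sub>0: "A\<^sub>0 > 0" using H(1) c(1) \<epsilon> by (simp add: A\<^sub>0_def)
  \<comment> \<open>Large enough for \<open>ridge_tail_bound\<close>, and at least 2 so that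
    \<open>1 + y ^ q\<close> dominates \<open>y\<close> and its square.\<close>
  define q where "q = max 2 (nat \<lceil>2 * (c\<^sub>2 + 1) / \<delta>\<rceil>)"
  have q: "q \<ge> 2" "real q \<ge> 2 * (c\<^sub>2 + 1) / \<delta>"
    unfolding q_def using real_nat_ceiling_ge[of "2 * (c\<^sub>2 + 1) / \<delta>"] by (auto simp: max_def)
  define A\<^sub>1 where "A\<^sub>1 = (2 * B\<^sub>1\<^sup>2 * sqrt A\<^sub>0) ^ q / c\<^sub>1"
  define A where "A = 5 * B\<^sub>1 ^ 5 + 2 * B\<^sub>1 ^ 3 + 4 * c\<^sub>3 * B\<^sub>1\<^sup>2 + A\<^sub>1"
  have A: "A > 0"
    unfolding A_def A\<^sub>1_def using parameters A\<^sub>0 vii by (intro add_pos_pos) auto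
  interpret bw: bandwidth_regime \<alpha> c H A\<^sub>0
    by unfold_locales (use iv c H A\<^sub>0 in auto)
  obtain C\<^sub>p where C\<^sub>p: "C\<^sub>p > 0" "\<And>n h. bw.admissible n h \<Longrightarrow>
      risk_bound \<alpha> \<beta> n (c / h) \<le> ennreal (C\<^sub>p * p_rate \<alpha> \<beta> k n h)"
    using bw.risk_bound_le_p_rate by blast
  define C\<^sub>r where "C\<^sub>r = enn2real (risk_const C\<^sub>1 \<alpha> \<beta> B\<^sub>1 C\<^sub>2 \<kappa> A q)"
  have C\<^sub>r: "risk_const C\<^sub>1 \<alpha> \<beta> B\<^sub>1 C\<^sub>2 \<kappa> A q = ennreal C\<^sub>r" "C\<^sub>r \<ge> 0"
    using risk_const_finite[OF iv, of C\<^sub>1 \<beta> B\<^sub>1 C\<^sub>2 \<kappa> A q] by (auto simp: C\<^sub>r_def)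
  \<comment> \<open>The added 1 keeps \<open>C\<close> positive even if \<open>C\<^sub>r\<close> is
    0.\<close>
  define C where "C = (C\<^sub>r + 1) * C\<^sub>p"
  have "C > 0" using C\<^sub>r C\<^sub>p(1) by (simp add: C_def)
  moreover have "(SUP x. \<integral>\<^sup>+ \<omega>. ennreal
                 ((fX_hat K h \<rho> n N (\<lambda>j m. X j \<omega> + U j m \<omega>) x
                   - fX_tilde K h f\<^sub>U n N (\<lambda>j m. X j \<omega> + U j m \<omega>) x)\<^sup>2) \<partial>P)
              \<le> ennreal (C * p_rate \<alpha> \<beta> k n h)"
    if n: "n \<ge> 1" and hyp: "h\<^sub>1 n \<le> h \<and> h \<le> h\<^sub>2 n \<and> c\<^sub>1 * real n powr (- c\<^sub>2) \<le> \<rho> \<and>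
           \<rho> \<le> c\<^sub>3 * min (h\<^sub>1 n powr (4 * \<alpha> + 2)) (1 / real n)"
      and fX: "f\<^sub>X \<in> density_class \<beta> C\<^sub>2" and sample: "replicated_sample P n N f\<^sub>X f\<^sub>U X U"
    for n h \<rho> f\<^sub>X and P :: "'a measure" and X U
  proof (rule SUP_least)
    fix x :: real
    have h: "h > 0" "h \<le> H" using hyp vi(1) n H(2)[of n] by (auto intro: less_le_trans order_trans)
    have \<rho>: "\<rho> > 0" "c\<^sub>1 * real n powr (- c\<^sub>2) \<le> \<rho>"
      using hyp vii n by (auto intro: less_le_trans[of 0 "c\<^sub>1 * real n powr (- c\<^sub>2)"])
    have \<rho>_le: "\<rho> \<le> c\<^sub>3 * (1 / sqrt n)\<^sup>2"
    proof -
      have "\<rho> \<le> c\<^sub>3 * min (h\<^sub>1 n powr (4 * \<alpha> + 2)) (1 / real n)" using hyp by simp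
      also have "\<dots> \<le> c\<^sub>3 * (1 / real n)" using vii by (intro mult_left_mono) auto
      finally show ?thesis by (simp add: power_divide)
    qed
    have pow: "(1 + c / h) powr (4 * \<alpha>) \<le> A\<^sub>0 * real n powr (1 - \<delta>)"
      unfolding A\<^sub>0_def
    proof (rule bandwidth_power_le)
      have "real n powr ((1 - \<delta>) / (4 * \<alpha>)) * h\<^sub>1 n \<le> real n powr ((1 - \<delta>) / (4 * \<alpha>)) * h"
        using hyp by (intro mult_left_mono) auto
      then show "\<epsilon> \<le> real n powr ((1 - \<delta>) / (4 * \<alpha>)) * h" using h1_lower[OF n] by linarith
    qed (use h n \<epsilon> c parameters in auto)
    have adm: "bw.admissible n h"
    proof -
      have "real n powr (1 - \<delta>) \<le> real n powr 1" using n \<delta> by (intro powr_mono) auto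
      then have "A\<^sub>0 * real n powr (1 - \<delta>) \<le> A\<^sub>0 * real n" using A\<^sub>0 n by (intro mult_left_mono) auto
      then show ?thesis unfolding bw.admissible_def using n h pow by auto
    qed
    interpret S: replicated_setting P X U n N f\<^sub>X f\<^sub>U C\<^sub>1
      by unfold_locales (use sample fX fU_density fU_real_nonzero n parameters i ii in \<open>auto simp: density_class_def\<close>)
    have cmod_\<phi>: "cmod (fourier f\<^sub>U t) = S.\<phi> t" for t
      using S.\<phi>_pos[of t] by (simp add: S.fourier_fU)
    have \<phi>_lower: "1 / S.\<phi> t \<le> B\<^sub>1 * (1 + \<bar>t\<bar>) powr \<alpha>" for t
    proof -
      have "(1 + \<bar>t\<bar>) powr (- \<alpha>) / B\<^sub>1 \<le> S.\<phi> t" using iii cmod_\<phi> by metis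
      then show ?thesis using S.\<phi>_pos[of t] parameters by (simp add: powr_minus field_simps)
    qed
    let ?om = "\<lambda>t. iexp (- (t * x)) * fourier K (h * t) / complex_of_real (2 * pi)"
    have ridge: "\<bar>1 / (sqrt \<bar>(S.\<phi> t)\<^sup>2 + D\<bar> + \<rho>) - 1 / S.\<phi> t\<bar>
          \<le> A * (1 / sqrt n * (1 + \<bar>t\<bar>) powr (3 * \<alpha>)) * (1 + (\<bar>D\<bar> * sqrt n) ^ q) \<and>
        \<bar>1 / (sqrt \<bar>(S.\<phi> t)\<^sup>2 + D\<bar> + \<rho>) - 1 / S.\<phi> t + D / (2 * S.\<phi> t ^ 3)\<bar>
          \<le> A * (1 / n * (1 + \<bar>t\<bar>) powr (5 * \<alpha>)) * (1 + (\<bar>D\<bar> * sqrt n) ^ q)"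
      if t: "\<bar>t\<bar> \<le> c / h" for t D
    proof -
      let ?g = "(1 + \<bar>t\<bar>) powr \<alpha>"
      have g_pow: "?g ^ m = (1 + \<bar>t\<bar>) powr (real m * \<alpha>)" for m
        by (simp add: powr_realpow[symmetric] powr_powr mult.commute)
      have g1: "?g \<ge> 1" using parameters by (intro ge_one_powr_ge_zero) auto
      have "?g ^ 4 = (1 + \<bar>t\<bar>) powr (4 * \<alpha>)" by (simp add: g_pow)
      also have "\<dots> \<le> (1 + c / h) powr (4 * \<alpha>)" using t parameters by (intro powr_mono2) auto
      also note pow
      finally have g4: "?g ^ 4 \<le> A\<^sub>0 * real n powr (1 - \<delta>)" .
      have tail: "(2 * B\<^sub>1\<^sup>2 * ?g\<^sup>2 * (1 / sqrt n)) ^ q / \<rho> \<le> A\<^sub>1 * (1 / sqrt n)\<^sup>2"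
        unfolding A\<^sub>1_def using n g1 g4 A\<^sub>0 \<delta> vii \<rho> q by (intro ridge_tail_bound) auto
      have B1: "B\<^sub>1 > 0" using parameters by simp
      have \<nu>: "0 < 1 / sqrt n" "1 / sqrt n \<le> 1" using n by auto
      note sb = scaled_ridge_reciprocal_bounds[OF S.\<phi>_pos[of t] \<phi>_lower g1 B1 \<nu> \<rho>(1) \<rho>_le q(1) tail,
          of D, folded A_def]
      have y: "\<bar>D\<bar> / (1 / sqrt n) = \<bar>D\<bar> * sqrt n" by simp
      have g35: "?g ^ 3 = (1 + \<bar>t\<bar>) powr (3 * \<alpha>)" "?g ^ 5 = (1 + \<bar>t\<bar>) powr (5 * \<alpha>)"
        by (simp_all add: g_pow)
      have \<nu>2: "(1 / sqrt n)\<^sup>2 = 1 / n" by (simp add: power_divide)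
      show ?thesis using sb unfolding y g35 \<nu>2 by (rule conjI)
    qed
    \<comment> \<open>The point \<open>x\<close> enters through a phase of modulus 1 in
      \<open>?om\<close>, so no constant depends on it and the supremum over \<open>x\<close> costs
      nothing.\<close>
    interpret D: deconvolution_setting P X U n N f\<^sub>X f\<^sub>U C\<^sub>1 \<alpha> \<beta> B\<^sub>1 C\<^sub>2 \<kappa> "c / h" A \<rho> ?om q
    proof unfold_locales
      show "S.\<phi> t \<le> B\<^sub>1 * (1 + \<bar>t\<bar>) powr (- \<alpha>)" for t using iii cmod_\<phi> by metis
      show "cmod (fourier f\<^sub>X t) \<le> C\<^sub>2 * (1 + \<bar>t\<bar>) powr (- \<beta>)" for t
      proof -
        have "(1 + \<bar>t\<bar>) powr \<beta> * cmod (fourier f\<^sub>X t) \<le> C\<^sub>2" using fX by (simp add: density_class_def)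
        then show ?thesis by (simp add: powr_minus field_simps)
      qed
      show "?om \<in> borel_measurable borel" using K_meas by measurable
      show "cmod (?om t) \<le> \<kappa> * indicator {- (c / h)..c / h} t" for t
      proof (cases "\<bar>t\<bar> \<le> c / h")
        case True
        have "cmod (?om t) = cmod (fourier K (h * t)) / (2 * pi)" by (simp add: norm_mult norm_divide)
        also have "\<dots> \<le> \<kappa> / 1" using \<kappa> pi_ge_two by (intro frac_le) auto
        finally show ?thesis using True by (simp add: indicator_def abs_le_iff)
      next
        case False
        then have "\<bar>h * t\<bar> > c" using h by (simp add: abs_mult field_simps)
        then show ?thesis using c(2) \<kappa>(1) by simp
      qed
    qed (use iv parameters \<kappa> A \<rho> \<phi>_lower ridge in auto)
    have "(\<integral>\<^sup>+ \<omega>. ennreal ((fX_hat K h \<rho> n N (\<lambda>j m. X j \<omega> + U j m \<omega>) x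
            - fX_tilde K h f\<^sub>U n N (\<lambda>j m. X j \<omega> + U j m \<omega>) x)\<^sup>2) \<partial>P)
        = (\<integral>\<^sup>+\<omega>. ennreal ((LINT t|lborel. Re (D.amp (S.uv \<omega>) t *
      (1 / total_obs n N * (\<Sum>p\<in>S.J. iexp (t * (S.xv \<omega> (fst p) + S.uv \<omega> p))))))\<^sup>2) \<partial>P)"
    proof (intro nn_integral_cong)
      fix \<omega>
      let ?w = "\<lambda>j m. X j \<omega> + U j m \<omega>"
      \<comment> \<open>The \<open>X j\<close> cancel in the differences of observations of one
        individual, so the estimated error transform is a function of the errors alone.\<close>
      have hat: "fU_hat n N ?w t = sqrt \<bar>S.\<psi>_hat (S.uv \<omega>) t\<bar>" for t
      proof -
        have "S.\<psi>_hat (\<lambda>p. ?w (fst p) (snd p)) t = S.\<psi>_hat (S.uv \<omega>) t"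
          unfolding S.\<psi>_hat_def
        proof (intro arg_cong[of _ _ "(*) _"] sum.cong refl)
          fix j p assume "j \<in> {1..n}" "p \<in> pair_set (N j)"
          then have "(j, fst p) \<in> S.J" "(j, snd p) \<in> S.J" by (auto simp: pair_set_def)
          then show "cos (t * (?w (fst (j, fst p)) (snd (j, fst p)) - ?w (fst (j, snd p)) (snd (j, snd p))))
              = cos (t * (S.uv \<omega> (j, fst p) - S.uv \<omega> (j, snd p)))"
            by (simp only: S.uv_apply fst_conv snd_conv) simp
        qed
        then show ?thesis by (simp only: S.fU_hat_eq)
      qed
      have sum: "(\<Sum>p\<in>S.J. iexp (t * ?w (fst p) (snd p)))
          = (\<Sum>p\<in>S.J. iexp (t * (S.xv \<omega> (fst p) + S.uv \<omega> p)))" for t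
      proof (rule sum.cong[OF refl])
        fix p assume p: "p \<in> S.J"
        then have "S.xv \<omega> (fst p) = X (fst p) \<omega>" by (auto simp: S.xv_def)
        then show "iexp (t * ?w (fst p) (snd p)) = iexp (t * (S.xv \<omega> (fst p) + S.uv \<omega> p))"
          by (simp only: S.uv_apply[OF p])
      qed
      have "fX_hat K h \<rho> n N ?w x - fX_tilde K h f\<^sub>U n N ?w x
          = (LINT t|lborel. Re (?om t * complex_of_real (1 / (fU_hat n N ?w t + \<rho>) - 1 / S.\<phi> t) *
        (1 / total_obs n N * (\<Sum>p\<in>S.J. iexp (t * ?w (fst p) (snd p))))))"
        by (rule S.estimator_difference[OF K_meas \<kappa>(2) c(2) h(1) \<rho>(1) D.inverse_\<phi>_le])
      then show "ennreal ((fX_hat K h \<rho> n N ?w x - fX_tilde K h f\<^sub>U n N ?w x)\<^sup>2)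
          = ennreal ((LINT t|lborel. Re (D.amp (S.uv \<omega>) t *
      (1 / total_obs n N * (\<Sum>p\<in>S.J. iexp (t * (S.xv \<omega> (fst p) + S.uv \<omega> p))))))\<^sup>2)"
        unfolding D.amp_def D.R_def hat sum by (simp only:)
    qed
    also have "\<dots> \<le> ennreal C\<^sub>r * risk_bound \<alpha> \<beta> n (c / h)"
      using D.second_moment_bound unfolding C\<^sub>r(1) .
    also have "\<dots> \<le> ennreal C\<^sub>r * ennreal (C\<^sub>p * p_rate \<alpha> \<beta> k n h)"
      by (intro mult_left_mono C\<^sub>p(2) adm) auto
    also have "\<dots> = ennreal (C\<^sub>r * (C\<^sub>p * p_rate \<alpha> \<beta> k n h))"
      using C\<^sub>r(2) by (simp only: ennreal_mult')
    also have "\<dots> \<le> ennreal (C * p_rate \<alpha> \<beta> k n h)"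
    proof -
      have "0 \<le> p_rate \<alpha> \<beta> k n h" by (rule order_trans[OF _ bw.p_rate_ge(2)[OF adm]]) simp
      then have "0 \<le> C\<^sub>p * p_rate \<alpha> \<beta> k n h" using C\<^sub>p(1) by simp
      then show ?thesis by (intro ennreal_leI) (simp add: C_def algebra_simps)
    qed
    finally show "(\<integral>\<^sup>+ \<omega>. ennreal ((fX_hat K h \<rho> n N (\<lambda>j m. X j \<omega> + U j m \<omega>) x
            - fX_tilde K h f\<^sub>U n N (\<lambda>j m. X j \<omega> + U j m \<omega>) x)\<^sup>2) \<partial>P)
        \<le> ennreal (C * p_rate \<alpha> \<beta> k n h)" .
  qed
  ultimately show ?thesis by blast
qed

end
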